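(* Let $n=2m+1$ with $m\in\mathbb N$, and let $\mathcal T=(\tau_\nu)_{\nu=0}^{n-1}\in\mathfrak T_n$ be fixed. For arbitrary functions $\tau_{\nu,i}\in L_1[0,1]$ and constants $c_{\nu,i}\in\mathbb C$, $\nu=0,\dots,n-1$, $i=0,\dots,i_\nu-1$, put $$\tau_{\nu,i_\nu}:=(-1)^{i_\nu}\Bigl(\tau_\nu-\sum_{i=0}^{i_\nu-1}(-1)^i\tau_{\nu,i}^{(i)}\Bigr)^{(-i_\nu)}+\sum_{i=0}^{i_\nu-1}c_{\nu,i}x^i,\qquad \nu=0,\dots,n-1.$$ Then $\tau_{\nu,i_\nu}\in L_1[0,1]$. Denote $$\mathscr F(\mathcal T,(\tau_{\nu,i},c_{\nu,i})):=\mathscr S_n(Q),\qquad Q(x):=\sum_{\nu=0}^{n-1}\sum_{i=0}^{i_\nu}\tau_{\nu,i}(x)\chi_{\nu,i}.$$ Then the set of all matrices of $\mathfrak F_n$ associated with the differential expression $\ell_n$ with coefficients $\mathcal T$ is $$\mathfrak F(\mathcal T)=\bigl\{\mathscr F(\mathcal T,(\tau_{\nu,i},c_{\nu,i})):\ \tau_{\nu,i}\in L_1[0,1],\ c_{\nu,i}\in\mathbb C,\ \nu=0,\dots,n-2,\ i=0,\dots,i_\nu-1\bigr\}.$$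
   Context: All functions are complex-valued. $n=2m+1$, $m\in\mathbb N$. $\mathfrak D=C_0^\infty(0,1)$, $\mathfrak D'$ is the space of distributions on $(0,1)$. For $i\ge 0$, $W_1^{-i}[0,1]$ is the set of distributions $\sigma^{(i)}$ with $\sigma\in L_1[0,1]$ ($W_1^0=L_1$). Singularity orders: $i_{2k+j}:=m-k-j$ for $k\ge 0$, $j\in\{0,1\}$ (so $i_{n-1}=0$ and there are no parameters $\tau_{n-1,i},c_{n-1,i}$ with $i<i_{n-1}$). Coefficient space: $\mathfrak T_n:=\{\mathcal T=(\tau_\nu)_{\nu=0}^{n-1}:\tau_\nu\in W_1^{-i_\nu}[0,1],\ \nu=0,\dots,n-1\}$. Differential expression with coefficients $\mathcal T$: $$\ell_n(y)=y^{(n)}+\sum_{k=0}^{m}(-1)^k(\tau_{2k}y^{(k)})^{(k)}+\sum_{k=0}^{m-1}(-1)^{k+1}\Bigl((\tau_{2k+1}y^{(k)})^{(k+1)}+(\tau_{2k+1}y^{(k+1)})^{(k)}\Bigr),$$ understood in $\mathfrak D'$; the product of $\tau=\sigma^{(i)}$, $\sigma\in L_1[0,1]$, and $g\in W_1^{i+1}[0,1]$ is $(\tau g,z)=(-1)^i\int_0^1\sigma\,(gz)^{(i)}\,dx$, $z\in\mathfrak D$. $\mathfrak F_n$ is the set of $n\times n$ matrix functions $F=[f_{k,j}]_{k,j=1}^n$ on $[0,1]$ such that $f_{k,j}\in L_1[0,1]$ for $k=m+1,\dots,2m+1$, $j=1,\dots,m+1$, and $f_{k,j}=0$ whenever $k<m+1$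 or $j>m+1$. For $F\in\mathfrak F_n$ the quasi-derivatives are $y^{[0]}:=y$, $y^{[k]}:=(y^{[k-1]})'-\sum_{j=1}^k f_{k,j}y^{[j-1]}$, $k=1,\dots,n$, and $\mathcal D_F:=\{y: y^{[k]}\in W_1^1[0,1],\ k=0,\dots,n-1\}$ (so $\mathcal D_F\subset W_1^{m+1}[0,1]$). $F\in\mathfrak F_n$ is called associated with $\ell_n(y)$ if $\ell_n(y)=y^{[n]}$ for every $y\in\mathcal D_F$. $\mathfrak F(\mathcal T)\subset\mathfrak F_n$ is the set of all matrices associated with the expression $\ell_n$ having coefficients $\mathcal T$. Constant matrices $\chi_{\nu,i}=[\chi_{\nu,i;r,j}]_{r,j=0}^m$, $\nu=0,\dots,n-1$, $i=0,\dots,i_\nu$: $\chi_{2k,i;\,p+k,\,i-p+k}=\binom{i}{p}$ for $p=0,\dots,i$; $\chi_{2k+1,i;\,p+k,\,i+1-p+k}=\binom{i+1}{p}-2\binom{i}{p-1}$ for $p=0,\dots,i+1$ (with $\binom{i}{-1}:=0$); all other entries are zero. The map $F=\mathscr S_n(Q)$ for $Q=[q_{r,j}]_{r,j=0}^m$ with $L_1$ entries: $f_{k,j}:=(-1)^kq_{j-1,2m+1-k}$ for $k=m+1,\dots,2m+1$, $j=1,\dots,m+1$; all other $f_{k,j}:=0$. Notation $y^{(-i)}$: a fixed choice of antiderivative of order $i$ of the distribution $y$; for example, the choice $w=y^{(-i)}$ fixed by $\int_0^1x^kw(x)\,dx=0$, $k=0,\dots,i-1$. *)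

theory Defs
  imports "HOL-Analysis.Analysis"
begin

text \<open>Elements of \<open>L\<^sub>1[0,1]\<close> are represented by functions on the reals of which only the values on
  \<open>[0,1]\<close>, up to Lebesgue null sets, are relevant.\<close>

definition L1 :: "(real \<Rightarrow> complex) set" where
  "L1 = {f. integrable (lebesgue_on {0..1}) f}"

definition vderiv :: "(real \<Rightarrow> complex) \<Rightarrow> real \<Rightarrow> complex" where
  "vderiv f = (\<lambda>x. vector_derivative f (at x))"

text \<open>The closed support is bounded, hence compact, once it lies in the open unit interval.\<close>

definition test_functions :: "(real \<Rightarrow> complex) set" where
  "test_functions = {z. (\<forall>k x. (vderiv ^^ k) z differentiable (at x)) \<and>
                        closure {x. z x \<noteq> 0} \<subseteq> {0<..<1}}"

text \<open>Functionals are normalised to vanish off the test functions, so that equality of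
  distributions is equality of HOL functions.\<close>

type_synonym functional = "(real \<Rightarrow> complex) \<Rightarrow> complex"

definition distributions :: "functional set" where
  "distributions = {u.
     (\<forall>z. z \<notin> test_functions \<longrightarrow> u z = 0) \<and>
     (\<forall>z\<in>test_functions. \<forall>w\<in>test_functions. u (\<lambda>x. z x + w x) = u z + u w) \<and>
     (\<forall>a. \<forall>z\<in>test_functions. u (\<lambda>x. a * z x) = a * u z) \<and>
     (\<forall>K. compact K \<and> K \<subseteq> {0<..<1} \<longrightarrow>
        (\<exists>C N. \<forall>z\<in>test_functions. (\<forall>x. x \<notin> K \<longrightarrow> z x = 0) \<longrightarrow>
           norm (u z) \<le> C * (\<Sum>k\<le>N. SUP x. norm ((vderiv ^^ k) z x))))}"

definition reg :: "(real \<Rightarrow> complex) \<Rightarrow> functional" where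
  "reg f = (\<lambda>z. if z \<in> test_functions
                then integral\<^sup>L (lebesgue_on {0..1}) (\<lambda>x. f x * z x) else 0)"

definition ddiff :: "functional \<Rightarrow> functional" where
  "ddiff u = (\<lambda>z. if z \<in> test_functions then - u (vderiv z) else 0)"

text \<open>The \<open>L\<^sub>1\<close> representative of a distribution; it is unique up to null sets, and meaningful
  only if there is one.\<close>

definition density :: "functional \<Rightarrow> real \<Rightarrow> complex" where
  "density u = (SOME f. f \<in> L1 \<and> u = reg f)"

definition wderiv :: "nat \<Rightarrow> (real \<Rightarrow> complex) \<Rightarrow> real \<Rightarrow> complex" where
  "wderiv i f = density ((ddiff ^^ i) (reg f))"

definition W1 :: "nat \<Rightarrow> (real \<Rightarrow> complex) set" where
  "W1 i = {f \<in> L1. \<forall>j\<le>i. (ddiff ^^ j) (reg f) \<in> reg ` L1}"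

definition W1_neg :: "nat \<Rightarrow> functional set" where
  "W1_neg i = (\<lambda>\<sigma>. (ddiff ^^ i) (reg \<sigma>)) ` L1"

text \<open>Product of \<open>\<tau> = \<sigma>\<^sup>(\<^sup>i\<^sup>) \<in> W\<^sub>1\<^sup>-\<^sup>i\<close> and \<open>g \<in> W\<^sub>1\<^sup>i\<^sup>+\<^sup>1\<close>. The value does not depend on the
  choice of \<open>\<sigma>\<close>, which is unique up to polynomials of degree less than \<open>i\<close>.\<close>

definition dmul :: "nat \<Rightarrow> functional \<Rightarrow> (real \<Rightarrow> complex) \<Rightarrow> functional" where
  "dmul i \<tau> g =
     (let \<sigma> = (SOME \<sigma>. \<sigma> \<in> L1 \<and> \<tau> = (ddiff ^^ i) (reg \<sigma>)) in
      (\<lambda>z. if z \<in> test_functions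
           then (-1) ^ i *
                integral\<^sup>L (lebesgue_on {0..1}) (\<lambda>x. \<sigma> x * wderiv i (\<lambda>t. g t * z t) x)
           else 0))"

text \<open>A choice of antiderivatives of all orders. The restriction to \<open>W\<^sub>1\<^sup>-\<^sup>i\<close> is where the
  moment-normalised antiderivative makes sense.\<close>

definition antiderivative_choice :: "(nat \<Rightarrow> functional \<Rightarrow> functional) \<Rightarrow> bool" where
  "antiderivative_choice A \<longleftrightarrow>
     (\<forall>i. \<forall>u\<in>W1_neg i. A i u \<in> distributions \<and> (ddiff ^^ i) (A i u) = u)"

text \<open>All objects below belong to the odd order \<open>n = 2 * m + 1\<close>.
  For \<open>\<nu> \<le> 2 * m\<close> the subtraction does not truncate.\<close>

definition sing_order :: "nat \<Rightarrow> nat \<Rightarrow> nat" where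
  "sing_order m \<nu> = m - \<nu> div 2 - \<nu> mod 2"

definition coeff_space :: "nat \<Rightarrow> (nat \<Rightarrow> functional) set" where
  "coeff_space m = {\<tau>. \<forall>\<nu><2*m+1. \<tau> \<nu> \<in> W1_neg (sing_order m \<nu>)}"

definition diff_expr :: "nat \<Rightarrow> (nat \<Rightarrow> functional) \<Rightarrow> (real \<Rightarrow> complex) \<Rightarrow> functional" where
  "diff_expr m \<tau> y = (\<lambda>z.
     (ddiff ^^ (2*m+1)) (reg y) z
     + (\<Sum>k\<le>m. (-1) ^ k *
          (ddiff ^^ k) (dmul (sing_order m (2*k)) (\<tau> (2*k)) (wderiv k y)) z)
     + (\<Sum>k<m. (-1) ^ (k+1) *
          ((ddiff ^^ (k+1)) (dmul (sing_order m (2*k+1)) (\<tau> (2*k+1)) (wderiv k y)) z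
           + (ddiff ^^ k) (dmul (sing_order m (2*k+1)) (\<tau> (2*k+1)) (wderiv (k+1) y)) z)))"

text \<open>Matrix functions are indexed by row and column, both running through \<open>{1..n}\<close>; entries
  outside this range are irrelevant.\<close>

type_synonym matrix_function = "nat \<Rightarrow> nat \<Rightarrow> real \<Rightarrow> complex"

definition matrix_ae_eq :: "nat \<Rightarrow> matrix_function \<Rightarrow> matrix_function \<Rightarrow> bool" where
  "matrix_ae_eq n F G \<longleftrightarrow>
     (\<forall>k\<in>{1..n}. \<forall>j\<in>{1..n}. AE x in lebesgue_on {0..1}. F k j x = G k j x)"

definition matrix_class :: "nat \<Rightarrow> matrix_function set" where
  "matrix_class m = {F.
     (\<forall>k\<in>{m+1..2*m+1}. \<forall>j\<in>{1..m+1}. F k j \<in> L1) \<and>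
     (\<forall>k\<in>{1..2*m+1}. \<forall>j\<in>{1..2*m+1}. k < m+1 \<or> j > m+1 \<longrightarrow>
        (AE x in lebesgue_on {0..1}. F k j x = 0))}"

fun quasi_deriv :: "matrix_function \<Rightarrow> (real \<Rightarrow> complex) \<Rightarrow> nat \<Rightarrow> real \<Rightarrow> complex" where
  "quasi_deriv F y 0 = y"
| "quasi_deriv F y (Suc k) = (\<lambda>x. wderiv 1 (quasi_deriv F y k) x
     - (\<Sum>j=1..Suc k. F (Suc k) j x * quasi_deriv F y (j - 1) x))"

definition quasi_domain :: "nat \<Rightarrow> matrix_function \<Rightarrow> (real \<Rightarrow> complex) set" where
  "quasi_domain n F = {y. \<forall>k<n. quasi_deriv F y k \<in> W1 1}"

definition associated_matrices :: "nat \<Rightarrow> (nat \<Rightarrow> functional) \<Rightarrow> matrix_function set" where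
  "associated_matrices m \<tau> = {F \<in> matrix_class m.
     \<forall>y\<in>quasi_domain (2*m+1) F. diff_expr m \<tau> y = reg (quasi_deriv F y (2*m+1))}"

definition chi :: "nat \<Rightarrow> nat \<Rightarrow> nat \<Rightarrow> nat \<Rightarrow> complex" where
  "chi \<nu> i r s = (let k = \<nu> div 2 in
     if even \<nu>
     then (\<Sum>p\<le>i. if r = p + k \<and> s = i - p + k then of_nat (i choose p) else 0)
     else (\<Sum>p\<le>i+1. if r = p + k \<and> s = i + 1 - p + k
             then of_nat ((i + 1) choose p)
                  - 2 * (if p = 0 then 0 else of_nat (i choose (p - 1)))
             else 0))"

text \<open>The argument of \<open>S_map\<close> is indexed by \<open>{0..m}\<close>.\<close>

definition S_map :: "nat \<Rightarrow> matrix_function \<Rightarrow> matrix_function" where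
  "S_map m Q = (\<lambda>k j x.
     if k \<in> {m+1..2*m+1} \<and> j \<in> {1..m+1} then (-1) ^ k * Q (j - 1) (2*m+1-k) x else 0)"

text \<open>The distribution \<open>\<tau>\<^sub>\<nu>\<^sub>,\<^sub>i\<close> with \<open>i = i\<^sub>\<nu>\<close>, built from the antiderivative choice \<open>A\<close>, the functions
  \<open>t \<nu> i\<close> and the constants \<open>c \<nu> i\<close>, where \<open>i < i\<^sub>\<nu>\<close>.\<close>

definition top_coeff ::
  "nat \<Rightarrow> (nat \<Rightarrow> functional \<Rightarrow> functional) \<Rightarrow> (nat \<Rightarrow> functional) \<Rightarrow>
   (nat \<Rightarrow> nat \<Rightarrow> real \<Rightarrow> complex) \<Rightarrow> (nat \<Rightarrow> nat \<Rightarrow> complex) \<Rightarrow> nat \<Rightarrow> functional" where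
  "top_coeff m A \<tau> t c \<nu> = (let d = sing_order m \<nu> in
     (\<lambda>z. (-1) ^ d *
            A d (\<lambda>w. \<tau> \<nu> w - (\<Sum>i<d. (-1) ^ i * (ddiff ^^ i) (reg (t \<nu> i)) w)) z
          + reg (\<lambda>x. \<Sum>i<d. c \<nu> i * of_real x ^ i) z))"

definition script_F ::
  "nat \<Rightarrow> (nat \<Rightarrow> functional \<Rightarrow> functional) \<Rightarrow> (nat \<Rightarrow> functional) \<Rightarrow>
   (nat \<Rightarrow> nat \<Rightarrow> real \<Rightarrow> complex) \<Rightarrow> (nat \<Rightarrow> nat \<Rightarrow> complex) \<Rightarrow> matrix_function" where
  "script_F m A \<tau> t c = S_map m (\<lambda>r s x.
     \<Sum>\<nu><2*m+1. \<Sum>i\<le>sing_order m \<nu>.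
       (if i < sing_order m \<nu> then t \<nu> i x else density (top_coeff m A \<tau> t c \<nu>) x)
         * chi \<nu> i r s)"

end

theory Submission
  imports Defs
begin

text \<open>Tested on \<open>z\<close>, both expressions become \<open>(y\<^sup>(\<^sup>n\<^sup>), z) + \<integral> \<Sum>\<^sub>r\<^sub>,\<^sub>s q\<^sub>r\<^sub>s y\<^sup>(\<^sup>r\<^sup>) z\<^sup>(\<^sup>s\<^sup>)\<close>:
  for \<open>y\<^sup>[\<^sup>n\<^sup>]\<close> the \<open>q\<^sub>r\<^sub>s\<close> are the entries of \<open>F\<close> up to sign, and for \<open>\<ell>\<^sub>n\<close> with
  \<open>\<tau>\<^sub>\<nu> = \<Sum>\<^sub>i (-1)\<^sup>i \<tau>\<^sub>\<nu>\<^sub>,\<^sub>i\<^sup>(\<^sup>i\<^sup>)\<close> the Leibniz rule gives \<open>Q = \<Sum> \<tau>\<^sub>\<nu>\<^sub>,\<^sub>i \<chi>\<^sub>\<nu>\<^sub>,\<^sub>i\<close>. So every matrix of the stated form is associated.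
  Conversely the \<open>\<chi>\<^sub>\<nu>\<^sub>,\<^sub>i\<close> span all matrices, hence \<open>F\<close> is associated with some \<open>\<T>'\<close>, and it remains to see that
  \<open>\<T>' = \<T>\<close>. The domain of the quasi-derivatives is dense in \<open>C\<^sup>m[0,1]\<close> (solve a linear Volterra system whose forcing
  term is approximated in \<open>L\<^sub>1\<close> by test functions), so the forms of \<open>\<T>\<close> and \<open>\<T>'\<close> agree for \<open>y = e\<^sup>c\<^sup>x\<close> and
  \<open>z = e\<^sup>-\<^sup>c\<^sup>x \<phi>\<close>; comparing the powers of \<open>c\<close> from the top yields \<open>\<tau>\<^sub>\<nu> = \<tau>'\<^sub>\<nu>\<close> for all \<open>\<nu>\<close>.\<close>

section \<open>Smooth functions and test functions\<close>

text \<open>The obstacle is that the domain belonging to \<open>F\<close> need not contain a given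
  smooth function: the entries of \<open>F\<close> are merely integrable, so y^[m+1] of a smooth
  \<open>y\<close> may fail to be weakly differentiable. Exponentials therefore cannot be inserted
  directly. Both forms, however, contain y^(r) for r \<le> m only, and uniform approximation of
  these derivatives is enough. A smooth \<open>w\<close> satisfies the first m equations of the
  first-order system exactly, and an integrable defect appears in the next one. Exchanging the
  defect for a nearby test function costs little, because the solutions of the Volterra system are
  bounded uniformly in the forcing. A smooth forcing is harmless: the rows of \<open>F\<close> read
  only the components up to m, so the later components can absorb it by a shift. The free constants
  \<open>c \<nu> i\<close> make up for the polynomials by which antiderivatives of the same order
  differ, which is why one fixed choice of antiderivatives reaches every associated matrix.\<close>

lemma leibniz_step:
  fixes a b :: "nat \<Rightarrow> 'a::comm_ring_1"
  shows "(\<Sum>i\<le>k. of_nat (k choose i) * (a (Suc i) * b (k - i) + a i * b (Suc (k - i)))) =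
         (\<Sum>i\<le>Suc k. of_nat (Suc k choose i) * (a i * b (Suc k - i)))"
proof -
  have 1: "(\<Sum>i\<le>Suc k. of_nat (Suc k choose i) * (a i * b (Suc k - i)))
     = a 0 * b (Suc k) + (\<Sum>i\<le>k. of_nat (k choose i) * (a (Suc i) * b (k - i)))
        + (\<Sum>i\<le>k. of_nat (k choose (Suc i)) * (a (Suc i) * b (k - i)))"
    by (subst sum.atMost_Suc_shift) (simp add: sum.distrib algebra_simps)
  have 2: "(\<Sum>i\<le>Suc k. of_nat (k choose i) * (a i * b (Suc k - i)))
     = a 0 * b (Suc k) + (\<Sum>i\<le>k. of_nat (k choose (Suc i)) * (a (Suc i) * b (k - i)))"
    by (subst sum.atMost_Suc_shift) simp
  have 3: "(\<Sum>i\<le>Suc k. of_nat (k choose i) * (a i * b (Suc k - i)))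
     = (\<Sum>i\<le>k. of_nat (k choose i) * (a i * b (Suc (k - i))))"
    by (simp add: Suc_diff_le binomial_eq_0)
  show ?thesis
    using 1 2 3 by (simp add: sum.distrib algebra_simps binomial_eq_0)
qed

definition smooth :: "(real \<Rightarrow> complex) \<Rightarrow> bool" where
  "smooth f \<longleftrightarrow> (\<forall>k x. (vderiv ^^ k) f differentiable (at x))"

lemma smooth_has_vderiv:
  "smooth f \<Longrightarrow> ((vderiv ^^ k) f has_vector_derivative (vderiv ^^ Suc k) f x) (at x)"
  by (simp add: smooth_def vderiv_def vector_derivative_works)

text \<open>Naming all derivatives at once as a sequence \<open>D\<close> replaces the evaluation of
  the iterates of \<open>vderiv\<close> by one induction; the smoothness proofs below supply such a
  \<open>D\<close>.\<close>

lemma smooth_seq: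
  assumes "D 0 = f" and D: "\<And>k x. (D k has_vector_derivative D (Suc k) x) (at x)"
  shows smooth_seqI: "smooth f" and vderiv_seq: "(vderiv ^^ k) f = D k"
proof -
  have eq: "(vderiv ^^ k) f = D k" for k
  proof (induction k)
    case (Suc k)
    then show ?case using vector_derivative_at[OF D[of k]] by (auto simp: vderiv_def)
  qed (simp add: assms)
  show "smooth f" unfolding smooth_def eq using D by (auto intro: differentiableI_vector)
  show "(vderiv ^^ k) f = D k" by (rule eq)
qed

lemma smooth_vderiv: "smooth f \<Longrightarrow> smooth ((vderiv ^^ j) f)"
  by (rule smooth_seqI[where D="\<lambda>k. (vderiv ^^ (k + j)) f"]) (auto simp: smooth_has_vderiv[simplified])

lemma vderiv_funpow_commute: "(vderiv ^^ k) (vderiv f) = vderiv ((vderiv ^^ k) f)"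
  by (metis funpow_swap1)

lemma smooth_vderiv1: "smooth f \<Longrightarrow> smooth (vderiv f)"
  using smooth_vderiv[of f 1] by simp

lemma smooth_has_vderiv1: "smooth f \<Longrightarrow> (f has_vector_derivative vderiv f x) (at x)"
  using smooth_has_vderiv[of f 0] by simp

lemma smooth_continuous: "smooth f \<Longrightarrow> continuous_on S f"
  by (meson continuous_at_imp_continuous_on smooth_has_vderiv1 has_vector_derivative_continuous)

lemma smooth_add:
  assumes "smooth f" "smooth g"
  shows "smooth (\<lambda>x. f x + g x)"
    and "(vderiv ^^ k) (\<lambda>x. f x + g x) = (\<lambda>x. (vderiv ^^ k) f x + (vderiv ^^ k) g x)"
  using smooth_seq[of "\<lambda>k x. (vderiv ^^ k) f x + (vderiv ^^ k) g x" "\<lambda>x. f x + g x"]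
    has_vector_derivative_add[OF smooth_has_vderiv smooth_has_vderiv, OF assms] by auto

lemma smooth_mult:
  assumes "smooth f" "smooth g"
  shows "smooth (\<lambda>x. f x * g x)"
    and "(vderiv ^^ k) (\<lambda>x. f x * g x) =
      (\<lambda>x. \<Sum>i\<le>k. of_nat (k choose i) * ((vderiv ^^ i) f x * (vderiv ^^ (k - i)) g x))"
proof -
  define D where "D = (\<lambda>k x. \<Sum>i\<le>k. of_nat (k choose i) * ((vderiv ^^ i) f x * (vderiv ^^ (k - i)) g x))"
  have 0: "D 0 = (\<lambda>x. f x * g x)" by (simp add: D_def)
  have 1: "(D k has_vector_derivative D (Suc k) x) (at x)" for k x
  proof -
    have "(D k has_vector_derivative (\<Sum>i\<le>k. of_nat (k choose i) *
        ((vderiv ^^ i) f x * (vderiv ^^ Suc (k - i)) g x + (vderiv ^^ Suc i) f x * (vderiv ^^ (k - i)) g x))) (at x)"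
      unfolding D_def
      by (intro derivative_intros has_vector_derivative_mult_right has_vector_derivative_mult
          smooth_has_vderiv assms)
    then show ?thesis unfolding D_def
      using leibniz_step[of k "\<lambda>i. (vderiv ^^ i) f x" "\<lambda>i. (vderiv ^^ i) g x"]
      by (simp only: add.commute)
  qed
  show "smooth (\<lambda>x. f x * g x)" using smooth_seqI[of D, OF 0 1] .
  show "(vderiv ^^ k) (\<lambda>x. f x * g x) =
      (\<lambda>x. \<Sum>i\<le>k. of_nat (k choose i) * ((vderiv ^^ i) f x * (vderiv ^^ (k - i)) g x))"
    using vderiv_seq[of D, OF 0 1] by (simp add: D_def)
qed

lemma smooth_const: "smooth (\<lambda>x. c)"
  by (rule smooth_seqI[where D="\<lambda>k x. if k = 0 then c else 0"]) auto

lemma smooth_cmult: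
  assumes "smooth f"
  shows "smooth (\<lambda>x. c * f x)"
    and "(vderiv ^^ k) (\<lambda>x. c * f x) = (\<lambda>x. c * (vderiv ^^ k) f x)"
  using smooth_seq[of "\<lambda>k x. c * (vderiv ^^ k) f x" "\<lambda>x. c * f x"]
    has_vector_derivative_mult_right[OF smooth_has_vderiv, OF assms] by auto

lemma smooth_exp:
  shows "smooth (\<lambda>x. exp (c * of_real x))"
    and "(vderiv ^^ k) (\<lambda>x. exp (c * of_real x)) = (\<lambda>x. c ^ k * exp (c * of_real x))"
proof -
  have "((\<lambda>x. c ^ k * exp (c * of_real x)) has_vector_derivative c ^ Suc k * exp (c * of_real x)) (at x)" for k x
  proof -
    have "((\<lambda>x. c ^ k * exp (c * x)) has_field_derivative c ^ Suc k * exp (c * of_real x)) (at (of_real x))"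
      by (auto intro!: derivative_eq_intros)
    from has_vector_derivative_real_field[OF this] show ?thesis by simp
  qed
  then show "smooth (\<lambda>x. exp (c * of_real x))"
    and "(vderiv ^^ k) (\<lambda>x. exp (c * of_real x)) = (\<lambda>x. c ^ k * exp (c * of_real x))"
    using smooth_seq[of "\<lambda>k x. c ^ k * exp (c * of_real x)" "\<lambda>x. exp (c * of_real x)"] by auto
qed

lemma smooth_exp_compose:
  assumes p: "smooth p"
  shows "smooth (\<lambda>x. exp (p x))"
proof -
  \<comment> \<open>The k-th derivative of e^p is \<open>P k\<close> times e^p, so the recursion is
    the product rule.\<close>
  define P where "P = rec_nat (\<lambda>x::real. 1::complex) (\<lambda>k f x. vderiv f x + vderiv p x * f x)"
  have P0: "P 0 = (\<lambda>x. 1)" and PS: "P (Suc k) = (\<lambda>x. vderiv (P k) x + vderiv p x * P k x)" for k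
    by (auto simp: P_def)
  have sm: "smooth (P k)" for k
    by (induction k) (auto simp: P0 PS intro!: smooth_const smooth_add smooth_mult smooth_vderiv1 p)
  have e: "((\<lambda>x. exp (p x)) has_vector_derivative vderiv p x * exp (p x)) (at x)" for x
    using field_vector_diff_chain_at[OF smooth_has_vderiv1[OF p] DERIV_exp, of x] by (simp add: o_def)
  show ?thesis
    by (rule smooth_seqI[where D="\<lambda>k x. P k x * exp (p x)"])
      (auto simp: P0 PS algebra_simps intro!: has_vector_derivative_eq_rhs[OF
         has_vector_derivative_mult[OF smooth_has_vderiv1[OF sm] e]])
qed

text \<open>After u = 1/x this is the decay of u^i e^-u at infinity. It forces all derivatives of
  \<open>flat_exp\<close> to vanish at 0.\<close>

lemma poly_mult_exp_minus_tendsto_0: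
  "((\<lambda>x::real. poly q (inverse x) * exp (- inverse x)) \<longlongrightarrow> 0) (at_right 0)"
proof -
  have m: "((\<lambda>u::real. u ^ i * exp (- u)) \<longlongrightarrow> 0) at_top" for i
    using tendsto_power_div_exp_0[of i] by (simp add: exp_minus field_simps)
  have "((\<lambda>u::real. \<Sum>i\<le>degree q. coeff q i * (u ^ i * exp (- u))) \<longlongrightarrow> (\<Sum>i\<le>degree q. coeff q i * 0)) at_top"
    by (intro tendsto_sum tendsto_mult tendsto_const m)
  then have "((\<lambda>u::real. poly q u * exp (- u)) \<longlongrightarrow> 0) at_top"
    by (simp add: poly_altdef sum_distrib_right mult.assoc)
  then show ?thesis
    by (rule filterlim_compose[OF _ filterlim_inverse_at_top_right])
qed

definition flat_exp :: "real \<Rightarrow> real" where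
  "flat_exp x = (if x > 0 then exp (- inverse x) else 0)"

lemma flat_exp_seq:
  obtains D :: "nat \<Rightarrow> real \<Rightarrow> real" where "D 0 = flat_exp"
    "\<And>k x. (D k has_real_derivative D (Suc k) x) (at x)"
proof -
  \<comment> \<open>In u = 1/x the derivative of p(u) e^-u is u^2 (p - p')(u) e^-u;
    \<open>[:0,0,1:]\<close> is u^2.\<close>
  define P where "P = rec_nat (1::real poly) (\<lambda>k p. [:0,0,1:] * (p - pderiv p))"
  have P0: "P 0 = 1" and PS: "P (Suc k) = [:0,0,1:] * (P k - pderiv (P k))" for k
    by (auto simp: P_def)
  define D where "D = (\<lambda>k (x::real). if x > 0 then poly (P k) (inverse x) * exp (- inverse x) else 0)"
  have "(D k has_real_derivative D (Suc k) x) (at x)" for k x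
  proof -
    consider "x > 0" | "x < 0" | "x = 0" by linarith
    then show ?thesis
    proof cases
      case 1
      have "((\<lambda>x. poly (P k) (inverse x) * exp (- inverse x)) has_real_derivative D (Suc k) x) (at x)"
        using 1 by (auto intro!: derivative_eq_intros DERIV_chain'[OF _ poly_DERIV] simp: D_def PS)
          (simp add: field_simps power2_eq_square)
      then show ?thesis
        by (rule has_field_derivative_transform_within_open[of _ _ _ "{0<..}"])
          (use 1 in \<open>auto simp: D_def\<close>)
    next
      case 2
      have "((\<lambda>x. 0) has_real_derivative D (Suc k) x) (at x)" using 2 by (simp add: D_def)
      then show ?thesis
        by (rule has_field_derivative_transform_within_open[of _ _ _ "{..<0}"])
          (use 2 in \<open>auto simp: D_def\<close>)
    next
      case 3
      \<comment> \<open>The difference quotient at 0 has an extra factor 1/y, which is the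
        polynomial \<open>[:0,1:]\<close> in 1/y.\<close>
      have r: "((\<lambda>y. D k y / y) \<longlongrightarrow> 0) (at_right 0)"
        by (rule Lim_transform_eventually[OF poly_mult_exp_minus_tendsto_0[of "[:0,1:] * P k"]])
          (auto simp: D_def eventually_at_filter field_simps)
      have l: "((\<lambda>y. D k y / y) \<longlongrightarrow> 0) (at_left 0)"
        by (rule Lim_transform_eventually[OF tendsto_const])
          (auto simp: D_def eventually_at_filter)
      show ?thesis using filterlim_split_at[OF l r] 3
        by (simp add: has_field_derivative_iff) (simp add: D_def)
    qed
  qed
  moreover have "D 0 = flat_exp" by (auto simp: D_def flat_exp_def P0)
  ultimately show ?thesis using that by blast
qed

lemma smooth_flat_exp:
  assumes "c = 1 \<or> c = -1"
  shows "smooth (\<lambda>x. of_real (flat_exp (c * x + a)))"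
proof -
  obtain D where D0: "D 0 = flat_exp" and D: "\<And>k x. (D k has_real_derivative D (Suc k) x) (at x)"
    using flat_exp_seq by metis
  have D': "((\<lambda>x. c ^ k * D k (c * x + a)) has_real_derivative c ^ Suc k * D (Suc k) (c * x + a)) (at x)" for k x
    by (rule derivative_eq_intros DERIV_chain'[OF _ D] refl)+ simp
  show ?thesis
    by (rule smooth_seqI[where D="\<lambda>k x. of_real (c ^ k * D k (c * x + a))"])
      (simp add: D0, rule has_vector_derivative_of_real, rule D')
qed

text \<open>The closure of the support is compact, so it has a least and a greatest point inside
  (0,1). An explicit enclosing interval is what integration by parts works with later.\<close>

lemma test_functions_iff:
  "z \<in> test_functions \<longleftrightarrow>
     smooth z \<and> (\<exists>a b. 0 < a \<and> a < b \<and> b < 1 \<and> (\<forall>x. x \<notin> {a<..<b} \<longrightarrow> z x = 0))"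
proof -
  have "(closure S \<subseteq> {0<..<1}) \<longleftrightarrow> (\<exists>a b. 0 < a \<and> a < b \<and> b < 1 \<and> S \<subseteq> {a<..<b})" for S :: "real set"
  proof
    assume S: "closure S \<subseteq> {0<..<1}"
    show "\<exists>a b. 0 < a \<and> a < b \<and> b < 1 \<and> S \<subseteq> {a<..<b}"
    proof (cases "S = {}")
      case True
      then show ?thesis by (intro exI[of _ "1/3"] exI[of _ "2/3"]) simp
    next
      case False
      have "bounded (closure S)" using S
        by (intro bounded_subset[OF compact_imp_bounded[OF compact_Icc[of 0 1]]]) fastforce
      then have c: "compact (closure S)" by (simp add: compact_eq_bounded_closed)
      obtain a where a: "a \<in> closure S" "\<forall>x\<in>closure S. a \<le> x"
        using compact_attains_inf[OF c] False by auto
      obtain b where b: "b \<in> closure S" "\<forall>x\<in>closure S. x \<le> b"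
        using compact_attains_sup[OF c] False by auto
      have "0 < a" "b < 1" "a \<le> b" using a b S by auto
      moreover have "x \<in> S \<Longrightarrow> a \<le> x \<and> x \<le> b" for x using a(2) b(2) closure_subset by auto
      \<comment> \<open>Moving halfway to 0 and to 1 leaves a nonempty open interval even if a =
        b.\<close>
      ultimately show ?thesis
        by (intro exI[of _ "a/2"] exI[of _ "(b+1)/2"]) fastforce
    qed
  next
    assume "\<exists>a b. 0 < a \<and> a < b \<and> b < 1 \<and> S \<subseteq> {a<..<b}"
    then obtain a b where "0 < a" "a < b" "b < 1" "S \<subseteq> {a..b}" by fastforce
    then show "closure S \<subseteq> {0<..<1}"
      using closure_minimal[of S "{a..b}"] by fastforce
  qed
  from this[of "{x. z x \<noteq> 0}"]
  have "(closure {x. z x \<noteq> 0} \<subseteq> {0<..<1}) \<longleftrightarrow>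
      (\<exists>a b. 0 < a \<and> a < b \<and> b < 1 \<and> (\<forall>x. x \<notin> {a<..<b} \<longrightarrow> z x = 0))"
    by (simp only: subset_iff mem_Collect_eq) metis
  then show ?thesis
    by (simp only: test_functions_def smooth_def mem_Collect_eq)
qed

lemma test_smooth: "z \<in> test_functions \<Longrightarrow> smooth z"
  by (simp add: test_functions_iff)

text \<open>Off the closed interval the function vanishes near x, so all derivatives do. At a and b
  the derivative is continuous and its limit from the outer side is 0.\<close>

lemma vderiv_eq_0_outside:
  assumes "\<And>x. x \<notin> {a<..<b} \<Longrightarrow> z x = 0" "smooth z" "x \<notin> {a<..<b}"
  shows "(vderiv ^^ k) z x = 0"
proof (cases k)
  case (Suc k')
  have "(vderiv ^^ k) z x = 0" if "x \<notin> {a..b}" for k x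
    using that
  proof (induction k arbitrary: x)
    case (Suc k)
    have "((\<lambda>x. 0) has_vector_derivative 0) (at x)" by simp
    then have "((vderiv ^^ k) z has_vector_derivative 0) (at x)"
      by (rule has_vector_derivative_transform_within_open[of _ _ _ "- {a..b}"]) (use Suc in auto)
    then show ?case by (simp add: vderiv_def[of "(vderiv ^^ k) z"] vector_derivative_at)
  qed (use assms in auto)
  note out = this
  show ?thesis
  proof (cases "x \<in> {a..b}")
    case True
    have "isCont ((vderiv ^^ k) z) x"
      using assms(2) smooth_has_vderiv has_vector_derivative_continuous by blast
    then have c: "((vderiv ^^ k) z \<longlongrightarrow> (vderiv ^^ k) z x) (at x)" by (simp add: isCont_def)
    consider "x = a" | "x = b" using True assms(3) by fastforce
    then show ?thesis
    proof cases
      case 1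
      have "((vderiv ^^ k) z \<longlongrightarrow> (vderiv ^^ k) z x) (at_left x)"
        using c by (simp add: filterlim_at_split)
      moreover have "((vderiv ^^ k) z \<longlongrightarrow> 0) (at_left x)"
        by (rule Lim_transform_eventually[OF tendsto_const])
          (use out 1 in \<open>auto simp: eventually_at_filter\<close>)
      ultimately show ?thesis using tendsto_unique trivial_limit_at_left_real by blast
    next
      case 2
      have "((vderiv ^^ k) z \<longlongrightarrow> (vderiv ^^ k) z x) (at_right x)"
        using c by (simp add: filterlim_at_split)
      moreover have "((vderiv ^^ k) z \<longlongrightarrow> 0) (at_right x)"
        by (rule Lim_transform_eventually[OF tendsto_const])
          (use out 2 in \<open>auto simp: eventually_at_filter\<close>)
      ultimately show ?thesis using tendsto_unique trivial_limit_at_right_real by blast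
    qed
  qed (use out in auto)
qed (use assms in auto)

lemma test_support:
  assumes "z \<in> test_functions"
  obtains a b where "0 < a" "a < b" "b < 1" "\<And>k x. x \<notin> {a<..<b} \<Longrightarrow> (vderiv ^^ k) z x = 0"
proof -
  obtain a b where "0 < a" "a < b" "b < 1" "\<forall>x. x \<notin> {a<..<b} \<longrightarrow> z x = 0"
    using assms by (auto simp: test_functions_iff)
  with that vderiv_eq_0_outside[of a b z] test_smooth[OF assms] show ?thesis by metis
qed

lemma test_vderiv: "z \<in> test_functions \<Longrightarrow> (vderiv ^^ k) z \<in> test_functions"
  unfolding test_functions_iff[of "(vderiv ^^ k) z"]
  by (metis smooth_vderiv test_smooth test_support)

lemma test_vderiv1: "z \<in> test_functions \<Longrightarrow> vderiv z \<in> test_functions"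
  using test_vderiv[of z 1] by simp

lemma smooth_mult_test: "\<lbrakk>smooth w; z \<in> test_functions\<rbrakk> \<Longrightarrow> (\<lambda>x. w x * z x) \<in> test_functions"
  by (auto simp: test_functions_iff intro!: smooth_mult)

lemma test_cmult: "z \<in> test_functions \<Longrightarrow> (\<lambda>x. c * z x) \<in> test_functions"
  by (rule smooth_mult_test[OF smooth_const])

lemma test_add:
  assumes "z \<in> test_functions" "w \<in> test_functions"
  shows "(\<lambda>x. z x + w x) \<in> test_functions"
proof -
  obtain a b where 1: "0 < a" "a < b" "b < 1" "\<forall>x. x \<notin> {a<..<b} \<longrightarrow> z x = 0"
    using assms by (auto simp: test_functions_iff)
  obtain c d where 2: "0 < c" "c < d" "d < 1" "\<forall>x. x \<notin> {c<..<d} \<longrightarrow> w x = 0"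
    using assms by (auto simp: test_functions_iff)
  have "z x + w x = 0" if "x \<notin> {min a c<..<max b d}" for x
  proof -
    have "x \<notin> {a<..<b}" "x \<notin> {c<..<d}" using that by auto
    then show ?thesis using 1 2 by simp
  qed
  moreover have "0 < min a c" "min a c < max b d" "max b d < 1" using 1 2 by auto
  ultimately show ?thesis unfolding test_functions_iff using smooth_add assms test_smooth by blast
qed

lemma test_0: "(\<lambda>x. 0) \<in> test_functions"
  unfolding test_functions_iff using smooth_const
  by (intro conjI exI[of _ "1/3"] exI[of _ "2/3"]) auto

lemma test_sum:
  "(\<And>i. i \<in> I \<Longrightarrow> z i \<in> test_functions) \<Longrightarrow> (\<lambda>x. \<Sum>i\<in>I. z i x) \<in> test_functions"
  by (induction I rule: infinite_finite_induct) (auto intro: test_add test_0)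

lemma test_diff:
  "z \<in> test_functions \<Longrightarrow> w \<in> test_functions \<Longrightarrow> (\<lambda>x. z x - w x) \<in> test_functions"
  using test_add[OF _ test_cmult[of w "-1"]] by simp

section \<open>Bump functions exhausting an interval\<close>

lemma flat_exp_nonneg: "flat_exp x \<ge> 0"
  by (simp add: flat_exp_def)

lemma flat_exp_mono: "x \<le> y \<Longrightarrow> flat_exp x \<le> flat_exp y"
  by (auto simp: flat_exp_def le_imp_inverse_le)

text \<open>The function 1 - exp(-k \<psi>) vanishes with \<psi>, stays in [0,1) and tends to 1 as
  long as \<psi> remains bounded below; so no plateau function has to be built.\<close>

lemma interval_bump:
  fixes a b :: real
  assumes "0 \<le> a" "a < b" "b \<le> 1"
  obtains u :: "nat \<Rightarrow> real \<Rightarrow> complex" where "\<And>k. u k \<in> test_functions"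
    "\<And>k x. norm (u k x) \<le> 1" "\<And>x. (\<lambda>k. u k x) \<longlonglongrightarrow> indicator {a<..<b} x"
proof -
  \<comment> \<open>The margin \<delta> keeps the support compactly inside (0,1) when a = 0 or b =
    1; the summand 3 gives a + \<delta> < b - \<delta> already for k = 0.\<close>
  define \<delta> where "\<delta> k = (b - a) / (real k + 3)" for k :: nat
  define \<psi> where "\<psi> k x = flat_exp (x - (a + \<delta> k)) * flat_exp ((b - \<delta> k) - x)" for k :: nat and x
  have \<delta>_pos: "\<delta> k > 0" for k using assms by (simp add: \<delta>_def)
  have "a + \<delta> k < b - \<delta> k" for k
  proof -
    have "\<delta> k \<le> (b - a) / 3" unfolding \<delta>_def using assms by (intro divide_left_mono) auto
    then show ?thesis using assms by (simp add: field_simps)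
  qed
  note \<delta> = \<delta>_pos this
  have s: "smooth (\<lambda>x. of_real (\<psi> k x))" for k
    using smooth_mult(1)[OF smooth_flat_exp[of 1 "- (a + \<delta> k)"] smooth_flat_exp[of "-1" "b - \<delta> k"]]
    by (simp add: \<psi>_def algebra_simps)
  have nonneg: "\<psi> k x \<ge> 0" for k x by (simp add: \<psi>_def flat_exp_nonneg)
  have zero: "\<psi> k x = 0" if "x \<notin> {a + \<delta> k<..<b - \<delta> k}" for k x
    using that by (auto simp: \<psi>_def flat_exp_def)
  define u where "u k x = (of_real (1 - exp (- real k * \<psi> k x)) :: complex)" for k :: nat and x
  have "smooth (u k)" for k
  proof -
    have "smooth (\<lambda>x. 1 + (-1) * exp ((- of_nat k) * of_real (\<psi> k x)))"
      by (intro smooth_add smooth_const smooth_cmult smooth_exp_compose s)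
    also have "(\<lambda>x. 1 + (-1) * exp ((- of_nat k) * of_real (\<psi> k x))) = u k"
      by (auto simp: u_def exp_of_real[symmetric])
    finally show ?thesis .
  qed
  moreover have "u k x = 0" if "x \<notin> {a + \<delta> k<..<b - \<delta> k}" for k x
    using zero[OF that] by (simp add: u_def)
  moreover have "0 < a + \<delta> k" "b - \<delta> k < 1" for k using \<delta>(1)[of k] assms by linarith+
  ultimately have "u k \<in> test_functions" for k
    unfolding test_functions_iff using \<delta>(2) by blast
  moreover have "norm (u k x) \<le> 1" for k x
  proof -
    have "exp (- real k * \<psi> k x) \<le> 1" using nonneg[of k x] by simp
    moreover have "exp (- real k * \<psi> k x) > 0" by simp
    ultimately show ?thesis unfolding u_def norm_of_real by linarith
  qed
  moreover have "(\<lambda>k. u k x) \<longlonglongrightarrow> indicator {a<..<b} x" for x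
  proof (cases "x \<in> {a<..<b}")
    case True
    have "(\<lambda>k. (b - a) / of_nat (k + 3)) \<longlonglongrightarrow> 0"
      by (rule LIMSEQ_ignore_initial_segment[OF lim_const_over_n])
    then have "\<delta> \<longlonglongrightarrow> 0" by (simp add: \<delta>_def[abs_def])
    then have "\<forall>\<^sub>F k in sequentially. \<delta> k < min (x - a) (b - x)"
      using True by (intro order_tendstoD) auto
    then obtain K where K: "\<delta> K < min (x - a) (b - x)"
      by (meson eventually_happens sequentially_bot)
    \<comment> \<open>As \<delta> shrinks, \<open>\<psi> k x\<close> grows with k, so from
      \<open>K\<close> on a geometric sequence of ratio \<open>exp (- \<psi> K x)\<close>
      dominates.\<close>
    have pos: "\<psi> K x > 0" using K by (auto simp: \<psi>_def flat_exp_def)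
    have le: "\<psi> K x \<le> \<psi> k x" if "K \<le> k" for k
    proof -
      have "\<delta> k \<le> \<delta> K" unfolding \<delta>_def using that assms by (intro divide_left_mono) auto
      then show ?thesis unfolding \<psi>_def
        by (intro mult_mono flat_exp_mono flat_exp_nonneg) auto
    qed
    have lim: "(\<lambda>k. exp (- \<psi> K x) ^ k) \<longlonglongrightarrow> 0" using pos by (intro LIMSEQ_power_zero) auto
    have "exp (- real k * \<psi> k x) \<le> exp (- \<psi> K x) ^ k" if "K \<le> k" for k
      using le[OF that] by (simp add: exp_of_nat_mult[symmetric] mult_left_mono)
    then have "\<forall>\<^sub>F k in sequentially. exp (- real k * \<psi> k x) \<le> exp (- \<psi> K x) ^ k"
      by (auto simp: eventually_sequentially)
    then have "(\<lambda>k. exp (- real k * \<psi> k x)) \<longlonglongrightarrow> 0"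
      by (intro tendsto_sandwich[OF _ _ tendsto_const lim]) auto
    then have "(\<lambda>k. of_real (1 - exp (- real k * \<psi> k x))) \<longlonglongrightarrow> (of_real (1 - 0) :: complex)"
      by (intro tendsto_of_real tendsto_diff tendsto_const)
    then show ?thesis using True by (simp add: u_def)
  next
    case False
    then have "u k x = 0" for k using zero[of x k] \<delta>(1)[of k] by (force simp: u_def)
    then show ?thesis using False by simp
  qed
  ultimately show ?thesis using that by blast
qed

section \<open>The indefinite integral on the unit interval\<close>

abbreviation leb01 :: "real measure" where "leb01 \<equiv> lebesgue_on {0..1}"

abbreviation int01 :: "(real \<Rightarrow> 'a) \<Rightarrow> 'a::{banach, second_countable_topology}" where
  "int01 \<equiv> integral\<^sup>L leb01"

interpretation leb01: finite_measure leb01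
  by (rule finite_measure_lebesgue_on) simp

text \<open>Lebesgue measure is complete, so \<open>g\<close> inherits measurability. Later a.e.
  replacements under the integral take the measurability of the new integrand from here.\<close>

lemma L1_AE_cong:
  assumes "f \<in> L1" "AE x in leb01. f x = g x"
  shows "g \<in> L1"
proof -
  obtain N where N: "N \<in> null_sets leb01" "\<And>x. x \<in> space leb01 - N \<Longrightarrow> f x = g x"
    using AE_E3[OF assms(2)] by metis
  then have neg: "negligible N"
    by (simp add: null_sets_restrict_space negligible_iff_null_sets)
  have "f absolutely_integrable_on {0..1}"
    using assms(1) by (simp add: L1_def integrable_restrict_space set_integrable_def)
  then have "g absolutely_integrable_on {0..1}"
    by (rule absolutely_integrable_spike[OF _ neg]) (use N in auto)
  then show ?thesis by (simp add: L1_def integrable_restrict_space set_integrable_def)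
qed

lemma L1_integrable: "f \<in> L1 \<Longrightarrow> integrable leb01 f"
  by (simp add: L1_def)

lemma L1_measurable: "f \<in> L1 \<Longrightarrow> f \<in> borel_measurable leb01"
  by (auto simp: L1_def)

lemma L1_add: "f \<in> L1 \<Longrightarrow> g \<in> L1 \<Longrightarrow> (\<lambda>x. f x + g x) \<in> L1"
  and L1_diff: "f \<in> L1 \<Longrightarrow> g \<in> L1 \<Longrightarrow> (\<lambda>x. f x - g x) \<in> L1"
  and L1_cmult: "f \<in> L1 \<Longrightarrow> (\<lambda>x. c * f x) \<in> L1"
  and L1_mult_const: "f \<in> L1 \<Longrightarrow> (\<lambda>x. f x * c) \<in> L1"
  and L1_const: "(\<lambda>x. c) \<in> L1"
  by (auto simp: L1_def)

lemma L1_sum: "(\<And>i. i \<in> I \<Longrightarrow> f i \<in> L1) \<Longrightarrow> (\<lambda>x. \<Sum>i\<in>I. f i x) \<in> L1"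
  by (auto simp: L1_def)

lemma L1_mult_bounded:
  assumes "f \<in> L1" "g \<in> borel_measurable leb01" "AE x in leb01. norm (g x) \<le> C"
  shows "(\<lambda>x. f x * g x) \<in> L1"
proof -
  have "integrable leb01 (\<lambda>x. f x * g x)"
  proof (rule Bochner_Integration.integrable_bound)
    show "integrable leb01 (\<lambda>x. C * norm (f x))" using assms(1) by (simp add: L1_def)
    show "(\<lambda>x. f x * g x) \<in> borel_measurable leb01"
      using assms(1,2) L1_measurable by (intro borel_measurable_times) auto
    show "AE x in leb01. norm (f x * g x) \<le> norm (C * norm (f x))"
      using assms(3)
    proof eventually_elim
      case (elim x)
      have "norm (f x * g x) \<le> norm (f x) * C"
        unfolding norm_mult using elim by (rule mult_left_mono) simp
      also have "\<dots> \<le> norm (C * norm (f x))" by (simp add: mult.commute)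
      finally show ?case .
    qed
  qed
  then show ?thesis by (simp add: L1_def)
qed

lemma smooth_measurable: "smooth w \<Longrightarrow> w \<in> borel_measurable leb01"
  by (intro measurable_restrict_space1 measurable_completion)
    (simp add: borel_measurable_continuous_onI smooth_continuous)

lemma smooth_bounded:
  assumes "smooth w"
  obtains C where "\<And>x. x \<in> {0..1} \<Longrightarrow> norm (w x) \<le> C"
proof -
  have "bounded (w ` {0..1})"
    using assms by (intro compact_imp_bounded compact_continuous_image smooth_continuous) auto
  then obtain C where "\<And>y. y \<in> w ` {0..1} \<Longrightarrow> norm y \<le> C" by (auto simp: bounded_iff)
  then show ?thesis by (intro that[of C]) blast
qed

lemma L1_mult_smooth:
  assumes "f \<in> L1" "smooth w" shows "(\<lambda>x. f x * w x) \<in> L1"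
proof -
  obtain C where "\<And>x. x \<in> {0..1} \<Longrightarrow> norm (w x) \<le> C"
    using smooth_bounded[OF assms(2)] by metis
  then show ?thesis
    by (intro L1_mult_bounded[where C=C] smooth_measurable AE_I2 assms) simp
qed

lemma smooth_L1: "smooth w \<Longrightarrow> w \<in> L1"
  using L1_mult_smooth[OF L1_const[of 1]] by simp

text \<open>The integral from 0 to x, cut off by an indicator instead of a varying domain: it makes
  sense for every real x, being constant on either side of [0,1], and Fubini applies on a fixed
  product measure.\<close>

definition prim :: "(real \<Rightarrow> complex) \<Rightarrow> real \<Rightarrow> complex" where
  "prim f x = int01 (\<lambda>t. indicator {..x} t * f t)"

lemma indicator_L1: "f \<in> L1 \<Longrightarrow> A \<in> sets leb01 \<Longrightarrow> (\<lambda>t. indicator A t * f t) \<in> L1"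
  using L1_mult_bounded[of f "indicator A" 1]
  by (auto simp: indicator_def mult.commute)

text \<open>A half-line is not a subset of [0,1], hence not in \<open>sets leb01\<close>;
  \<open>prim\<close> calls for this version rather than \<open>indicator_L1\<close>.\<close>

lemma borel_indicator_L1:
  assumes "f \<in> L1" "A \<in> sets borel" shows "(\<lambda>t. indicator A t * f t) \<in> L1"
proof -
  have "(indicator A :: real \<Rightarrow> complex) \<in> borel_measurable leb01"
    using assms by (intro measurable_restrict_space1 measurable_completion) simp
  then show ?thesis
    using L1_mult_bounded[of f "indicator A" 1] assms(1)
    by (auto simp: indicator_def mult.commute)
qed

lemma prim_norm_le:
  assumes "f \<in> L1" shows "norm (prim f x) \<le> int01 (\<lambda>t. norm (f t))"
proof -
  have "norm (prim f x) \<le> int01 (\<lambda>t. norm (indicator {..x} t * f t))"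
    unfolding prim_def by (rule integral_norm_bound)
  also have "\<dots> \<le> int01 (\<lambda>t. norm (f t))"
    using assms borel_indicator_L1[OF assms, of "{..x}"]
    by (intro integral_mono integrable_norm L1_integrable) (auto simp: indicator_def norm_mult)
  finally show ?thesis .
qed

lemma pair_indicator_measurable:
  "(\<lambda>(x, t). indicator {..x} t :: complex) \<in> borel_measurable (leb01 \<Otimes>\<^sub>M leb01)"
proof -
  have i: "(\<lambda>x. x) \<in> borel_measurable leb01"
    using id_borel_measurable_lebesgue_on[of "{0..1}"] by (simp add: id_def)
  have "fst \<in> borel_measurable (leb01 \<Otimes>\<^sub>M leb01)" "snd \<in> borel_measurable (leb01 \<Otimes>\<^sub>M leb01)"
    using measurable_compose[OF measurable_fst i] measurable_compose[OF measurable_snd i] by auto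
  then have "{p \<in> space (leb01 \<Otimes>\<^sub>M leb01). snd p \<le> fst p} \<in> sets (leb01 \<Otimes>\<^sub>M leb01)"
    by (intro borel_measurable_le) auto
  then have "(\<lambda>p. if snd p \<le> fst p then 1 else 0 :: complex) \<in> borel_measurable (leb01 \<Otimes>\<^sub>M leb01)"
    by (intro measurable_If) auto
  also have "(\<lambda>p. if snd p \<le> fst p then 1 else 0) = (\<lambda>(x, t). indicator {..x} t :: complex)"
    by (auto simp: indicator_def fun_eq_iff)
  finally show ?thesis .
qed

lemma prim_measurable:
  assumes "f \<in> L1" shows "prim f \<in> borel_measurable leb01"
proof -
  have "(\<lambda>p. case p of (x, t) \<Rightarrow> indicator {..x} t * f t) \<in> borel_measurable (leb01 \<Otimes>\<^sub>M leb01)"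
    using borel_measurable_times[OF pair_indicator_measurable
        measurable_compose[OF measurable_snd L1_measurable[OF assms]]]
    by (simp add: case_prod_unfold)
  then show ?thesis unfolding prim_def
    by (intro leb01.borel_measurable_lebesgue_integral) (simp add: case_prod_unfold)
qed

lemma prim_L1: "f \<in> L1 \<Longrightarrow> prim f \<in> L1"
  using L1_mult_bounded[OF L1_const[of 1] prim_measurable AE_I2[OF prim_norm_le]] by simp

lemma L1_mult_prim: "f \<in> L1 \<Longrightarrow> g \<in> L1 \<Longrightarrow> (\<lambda>x. f x * prim g x) \<in> L1"
  by (rule L1_mult_bounded[OF _ prim_measurable AE_I2[OF prim_norm_le]])

lemma singleton_null_leb01: "AE x in leb01. x \<noteq> c"
  using AE_completion[OF AE_lborel_singleton[of c]]
  by (subst AE_restrict_space_iff) auto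

lemma prim_add: "f \<in> L1 \<Longrightarrow> g \<in> L1 \<Longrightarrow> prim (\<lambda>x. f x + g x) x = prim f x + prim g x"
  using borel_indicator_L1[of f "{..x}"] borel_indicator_L1[of g "{..x}"]
  by (simp add: prim_def ring_distribs L1_def)

lemma prim_cmult: "prim (\<lambda>x. c * f x) x = c * prim f x"
  unfolding prim_def by (simp add: mult.left_commute[of _ c])

text \<open>Exchanging the integrations over the triangle t \<le> x leaves the integral of
  \<open>g\<close> over x \<ge> t, that is, its total minus \<open>prim g t\<close>.\<close>

lemma prim_fubini:
  assumes f: "f \<in> L1" and g: "g \<in> L1"
  shows "int01 (\<lambda>x. prim f x * g x) =
         int01 (\<lambda>t. f t * (int01 g - prim g t))"
proof -
  interpret pair_sigma_finite leb01 leb01 ..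
  define h where "h x t = indicator {..x} t * f t * g x" for x t :: real
  have hm: "case_prod h \<in> borel_measurable (leb01 \<Otimes>\<^sub>M leb01)"
    using borel_measurable_times[OF borel_measurable_times[OF pair_indicator_measurable
        measurable_compose[OF measurable_snd L1_measurable[OF f]]]
        measurable_compose[OF measurable_fst L1_measurable[OF g]]]
    by (simp add: case_prod_unfold h_def)
  have in1: "(\<lambda>t. h x t) \<in> L1" for x
    unfolding h_def by (intro L1_mult_const borel_indicator_L1 f) simp
  have m: "(\<lambda>x. int01 (\<lambda>t. norm (h x t))) \<in> borel_measurable leb01"
    using hm by (intro leb01.borel_measurable_lebesgue_integral) (simp add: case_prod_unfold)
  have "integrable leb01 (\<lambda>x. int01 (\<lambda>t. norm (h x t)))"
  proof (rule Bochner_Integration.integrable_bound[OF _ m])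
    show "integrable leb01 (\<lambda>x. int01 (\<lambda>t. norm (f t)) * norm (g x))"
      using g by (simp add: L1_def)
    show "AE x in leb01. norm (int01 (\<lambda>t. norm (h x t)))
       \<le> norm (int01 (\<lambda>t. norm (f t)) * norm (g x))"
    proof (rule AE_I2)
      fix x
      have "int01 (\<lambda>t. norm (h x t)) \<le> int01 (\<lambda>t. norm (f t) * norm (g x))"
        using in1[of x] f by (intro integral_mono integrable_mult_left integrable_norm L1_integrable)
          (auto simp: h_def norm_mult indicator_def)
      then show "norm (int01 (\<lambda>t. norm (h x t)))
         \<le> norm (int01 (\<lambda>t. norm (f t)) * norm (g x))"
        by (simp add: integral_nonneg_AE)
    qed
  qed
  then have hi: "integrable (leb01 \<Otimes>\<^sub>M leb01) (case_prod h)"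
    using in1 by (intro Fubini_integrable hm) (auto simp: L1_def)
  have eq: "int01 (\<lambda>x. h x t) = f t * (int01 g - prim g t)" for t
  proof -
    have "int01 (\<lambda>x. h x t) = int01 (\<lambda>x. f t * (g x - indicator {..t} x * g x))"
    proof (rule integral_cong_AE)
      show "(\<lambda>x. h x t) \<in> borel_measurable leb01"
      proof -
        have "(\<lambda>x. f t * (indicator {t..} x * g x)) \<in> L1"
          by (intro L1_cmult borel_indicator_L1 g) simp
        then show ?thesis by (intro L1_measurable)
          (auto simp: h_def indicator_def if_distrib cong: if_cong elim!: back_subst[of "\<lambda>f. f \<in> L1"])
      qed
      show "(\<lambda>x. f t * (g x - indicator {..t} x * g x)) \<in> borel_measurable leb01"
        by (intro L1_measurable L1_cmult L1_diff borel_indicator_L1 g) simp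
      \<comment> \<open>The conditions t \<le> x and x \<le> t overlap only at x = t, a null
        set.\<close>
      show "AE x in leb01. h x t = f t * (g x - indicator {..t} x * g x)"
        using singleton_null_leb01[of t] by eventually_elim (auto simp: h_def indicator_def)
    qed
    also have "\<dots> = f t * (int01 g - prim g t)"
      using borel_indicator_L1[OF g, of "{..t}"] g by (simp add: prim_def L1_def)
    finally show ?thesis .
  qed
  have "int01 (\<lambda>x. prim f x * g x) = int01 (\<lambda>x. int01 (\<lambda>t. h x t))"
    by (simp add: prim_def h_def)
  also have "\<dots> = int01 (\<lambda>t. int01 (\<lambda>x. h x t))"
    using Fubini_integral[OF hi] by simp
  finally show ?thesis by (simp add: eq)
qed

text \<open>Cutting both functions off at x turns \<open>prim f x\<close> and
  \<open>prim g x\<close> into total integrals; \<open>prim_fubini\<close> for the truncated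
  functions is then the product rule.\<close>

lemma prim_mult:
  assumes f: "f \<in> L1" and g: "g \<in> L1"
  shows "prim f x * prim g x = prim (\<lambda>t. f t * prim g t + prim f t * g t) x"
proof -
  define F G where "F t = indicator {..x} t * f t" and "G t = indicator {..x} t * g t" for t
  have FG: "F \<in> L1" "G \<in> L1" unfolding F_def G_def by (intro borel_indicator_L1 f g; simp)+
  have p: "prim F t = prim f t" "prim G t = prim g t" if "t \<le> x" for t
    using that by (auto simp: prim_def F_def G_def indicator_def intro!: Bochner_Integration.integral_cong)
  have tot: "int01 F = prim f x" "int01 G = prim g x"
    by (simp_all add: prim_def F_def[abs_def] G_def[abs_def])
  have "prim (\<lambda>t. f t * prim g t + prim f t * g t) x
      = int01 (\<lambda>t. F t * prim G t + prim F t * G t)"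
    unfolding prim_def[of "\<lambda>t. f t * prim g t + prim f t * g t"]
    by (intro Bochner_Integration.integral_cong refl) (auto simp: p F_def G_def indicator_def)
  also have "\<dots> = int01 (\<lambda>t. F t * prim G t) + int01 (\<lambda>t. prim F t * G t)"
    using L1_mult_prim[OF FG] L1_mult_prim[OF FG(2,1)]
    by (intro Bochner_Integration.integral_add) (auto simp: L1_def mult.commute)
  also have "\<dots> = int01 (\<lambda>t. F t * prim G t)
      + int01 (\<lambda>t. F t * int01 G - F t * prim G t)"
    using prim_fubini[OF FG] by (simp add: right_diff_distrib)
  also have "\<dots> = int01 F * int01 G"
    using L1_mult_prim[OF FG] FG by (simp add: L1_def)
  finally show ?thesis by (simp only: tot)
qed

lemma prim_eq_integral: "1 \<le> x \<Longrightarrow> prim f x = int01 f"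
  unfolding prim_def by (intro Bochner_Integration.integral_cong) auto

lemma prim_vderiv:
  assumes w: "smooth w" and x: "x \<in> {0..1}"
  shows "prim (vderiv w) x = w x - w 0"
proof -
  have L: "(\<lambda>t. indicator {..x} t * vderiv w t) \<in> L1"
    by (intro borel_indicator_L1 smooth_L1 smooth_vderiv1 w) simp
  have "prim (vderiv w) x = integral {0..1} (\<lambda>t. indicator {..x} t * vderiv w t)"
    unfolding prim_def using L by (intro lebesgue_integral_eq_integral) (auto simp: L1_def)
  also have "\<dots> = integral {0..1} (\<lambda>t. if t \<in> {..x} then vderiv w t else 0)"
    by (intro integral_cong) (auto simp: indicator_def)
  also have "\<dots> = integral ({..x} \<inter> {0..1}) (vderiv w)"
    by (rule integral_restrict_Int)
  also have "{..x} \<inter> {0..1} = {0..x}" using x by auto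
  also have "integral {0..x} (vderiv w) = w x - w 0"
    using x smooth_has_vderiv1[OF w]
    by (intro integral_unique fundamental_theorem_of_calculus)
      (auto intro: has_vector_derivative_at_within)
  finally show ?thesis .
qed

section \<open>Regular distributions\<close>

text \<open>Bump functions reach only open subintervals of [0,1]. Closure under a.e. equality
  carries a property from these to closed intervals, where Borel induction starts, and finally to
  Lebesgue sets, which are Borel up to a null set.\<close>

lemma lebesgue_unit_induct:
  assumes A: "A \<in> sets leb01"
    and interval: "\<And>a b. 0 \<le> a \<Longrightarrow> a < b \<Longrightarrow> b \<le> 1 \<Longrightarrow> P {a<..<b}"
    and AE_eq: "\<And>A B. A \<in> sets leb01 \<Longrightarrow> B \<in> sets leb01 \<Longrightarrow> P A \<Longrightarrow>
      (AE x in leb01. x \<in> A \<longleftrightarrow> x \<in> B) \<Longrightarrow> P B"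
    and compl: "\<And>A. A \<in> sets leb01 \<Longrightarrow> P A \<Longrightarrow> P ({0..1} - A)"
    and union: "\<And>A :: nat \<Rightarrow> real set. disjoint_family A \<Longrightarrow> range A \<subseteq> sets leb01 \<Longrightarrow>
      (\<And>i. P (A i)) \<Longrightarrow> P (\<Union>i. A i)"
  shows "P A"
proof -
  have sets: "S \<inter> {0..1} \<in> sets leb01" if "S \<in> sets borel" for S
    using that by (auto simp: sets_restrict_space intro!: image_eqI[of _ _ S])
  have ivl: "P ({a..b} \<inter> {0..1})" if ab: "max a 0 < min b 1" for a b
  proof (rule AE_eq[of "{max a 0<..<min b 1}"])
    show "P {max a 0<..<min b 1}" using ab by (intro interval) auto
    have "{max a 0<..<min b 1} = {max a 0<..<min b 1} \<inter> {0..1}" by auto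
    then show "{max a 0<..<min b 1} \<in> sets leb01" using sets by (metis borel_open open_greaterThanLessThan)
    show "{a..b} \<inter> {0..1} \<in> sets leb01" by (rule sets) simp
    show "AE x in leb01. (x \<in> {max a 0<..<min b 1}) = (x \<in> {a..b} \<inter> {0..1})"
      using singleton_null_leb01[of 0] singleton_null_leb01[of 1]
        singleton_null_leb01[of a] singleton_null_leb01[of b] AE_space
      by eventually_elim auto
  qed
  have full: "P {0..1}" using ivl[of 0 1] by simp
  have empty: "P {}" using compl[OF _ full] by simp
  have null: "P B" if "B \<in> sets leb01" "AE x in leb01. x \<notin> B" for B
    by (rule AE_eq[OF _ that(1) empty]) (use that in auto)
  have borel: "P (S \<inter> {0..1})" if "S \<in> sets borel" for S
    using that
  proof (induction rule: borel_set_induct)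
    case empty
    then show ?case using \<open>P {}\<close> by simp
  next
    case (interval a b)
    show ?case
    proof (cases "max a 0 < min b 1")
      case True
      then show ?thesis by (rule ivl)
    next
      case False
      have "AE x in leb01. x \<notin> {a..b} \<inter> {0..1}"
        using singleton_null_leb01[of 0] singleton_null_leb01[of 1]
          singleton_null_leb01[of a] singleton_null_leb01[of b]
        by eventually_elim (use False in auto)
      then show ?thesis by (intro null sets) auto
    qed
  next
    case (compl S)
    have "P ({0..1} - (S \<inter> {0..1}))" using compl by (intro assms(4) sets) auto
    also have "{0..1} - (S \<inter> {0..1}) = - S \<inter> {0..1}" by auto
    finally show ?case by simp
  next
    case (union f)
    have "P (\<Union>i. f i \<inter> {0..1})"
      using union sets by (intro assms(5)) (auto simp: disjoint_family_on_def)
    then show ?case by simp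
  qed
  obtain S where S: "S \<in> sets lebesgue" "A = {0..1} \<inter> S"
    using A by (auto simp: sets_restrict_space)
  obtain B N where BN: "B \<in> sets borel" "negligible N" "B \<union> N = S"
    using sets_lebesgue_almost_borel[OF S(1)] by metis
  have "AE x in lebesgue. x \<notin> N"
    using BN(2) AE_not_in negligible_iff_null_sets by blast
  then have "AE x in leb01. x \<notin> N" by (simp add: AE_restrict_space_iff eventually_mono)
  then have "AE x in leb01. (x \<in> B \<inter> {0..1}) = (x \<in> A)"
    using AE_space by eventually_elim (use S BN in auto)
  then show ?thesis using sets[OF BN(1)] A borel[OF BN(1)] AE_eq by metis
qed

lemma integral_bump_tendsto:
  assumes f: "f \<in> L1" and u: "\<And>k. u k \<in> test_functions" "\<And>k x. norm (u k x) \<le> 1"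
    "\<And>x. (\<lambda>k. u k x) \<longlonglongrightarrow> indicator A x"
  shows "(\<lambda>k. int01 (\<lambda>x. f x * u k x)) \<longlonglongrightarrow> int01 (\<lambda>x. f x * indicator A x)"
proof (rule integral_dominated_convergence[where w="\<lambda>x. norm (f x)"])
  have m: "(\<lambda>x. f x * u k x) \<in> borel_measurable leb01" for k
    by (intro L1_measurable L1_mult_smooth f test_smooth u)
  then show "(\<lambda>x. f x * u k x) \<in> borel_measurable leb01" for k .
  have lim: "(\<lambda>k. f x * u k x) \<longlonglongrightarrow> f x * indicator A x" for x by (intro tendsto_intros u)
  then show "AE x in leb01. (\<lambda>k. f x * u k x) \<longlonglongrightarrow> f x * indicator A x" by simp
  show "(\<lambda>x. f x * indicator A x) \<in> borel_measurable leb01"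
    by (rule borel_measurable_LIMSEQ_metric[OF m lim])
  show "integrable leb01 (\<lambda>x. norm (f x))" using f by (simp add: L1_def)
  show "AE x in leb01. norm (f x * u k x) \<le> norm (f x)" for k
    using u(2)[of k] by (simp add: norm_mult mult_left_le)
qed

text \<open>Bump functions make the integral of \<open>f\<close> over every open interval vanish,
  the set induction extends this to every measurable set, and densities are unique.\<close>

lemma fundamental_lemma_zero:
  assumes f: "f \<in> L1" and 0: "\<And>z. z \<in> test_functions \<Longrightarrow> int01 (\<lambda>x. f x * z x) = 0"
  shows "AE x in leb01. f x = 0"
proof (rule leb01.density_unique_banach)
  show "integrable leb01 f" "integrable leb01 (\<lambda>x. 0 :: complex)" using f by (auto simp: L1_def)
  define P where "P A \<longleftrightarrow> set_lebesgue_integral leb01 A f = 0" for A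
  have si: "set_integrable leb01 A f" if "A \<in> sets leb01" for A
    unfolding set_integrable_def using that f by (intro integrable_mult_indicator L1_integrable)
  have "P A" if "A \<in> sets leb01" for A
    using that
  proof (rule lebesgue_unit_induct)
    fix a b :: real assume ab: "0 \<le> a" "a < b" "b \<le> 1"
    obtain u where u: "\<And>k. u k \<in> test_functions" "\<And>k x. norm (u k x) \<le> 1"
      "\<And>x. (\<lambda>k. u k x) \<longlonglongrightarrow> indicator {a<..<b} x"
      using interval_bump[OF ab] by metis
    from integral_bump_tendsto[OF f u] have "int01 (\<lambda>x. f x * indicator {a<..<b} x) = 0"
      by (simp add: 0 u LIMSEQ_const_iff)
    then show "P {a<..<b}"
      unfolding P_def set_lebesgue_integral_def
      by (subst (asm) Bochner_Integration.integral_cong[where g="\<lambda>x. indicator {a<..<b} x *\<^sub>R f x"])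
        (auto simp: indicator_def)
  next
    fix A B assume AB: "A \<in> sets leb01" "B \<in> sets leb01" "P A" "AE x in leb01. x \<in> A \<longleftrightarrow> x \<in> B"
    have "set_lebesgue_integral leb01 B f = set_lebesgue_integral leb01 A f"
      unfolding set_lebesgue_integral_def
      using si[OF AB(1)] si[OF AB(2)] AB(4)
      by (intro integral_cong_AE) (auto simp: set_integrable_def indicator_def elim: eventually_mono)
    then show "P B" using AB by (simp add: P_def)
  next
    \<comment> \<open>Complements require the total integral of \<open>f\<close> to vanish; this is
      the interval (0,1) up to its two endpoints.\<close>
    obtain u where u: "\<And>k. u k \<in> test_functions" "\<And>k x. norm (u k x) \<le> 1"
      "\<And>x. (\<lambda>k. u k x) \<longlonglongrightarrow> indicator {0<..<1::real} x"
      using interval_bump[of 0 1] by auto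
    from integral_bump_tendsto[OF f u] have "int01 (\<lambda>x. f x * indicator {0<..<1} x) = 0"
      by (simp add: 0 u LIMSEQ_const_iff)
    moreover have ae: "AE x in leb01. f x = f x * indicator {0<..<1} x"
      using singleton_null_leb01[of 0] singleton_null_leb01[of 1] AE_space
      by eventually_elim (auto simp: indicator_def)
    moreover have "int01 f = int01 (\<lambda>x. f x * indicator {0<..<1} x)"
      using L1_measurable[OF f] L1_measurable[OF L1_AE_cong[OF f ae]] ae by (intro integral_cong_AE)
    ultimately have I: "int01 f = 0" by simp
    fix A assume A: "A \<in> sets leb01" "P A"
    have "set_lebesgue_integral leb01 ({0..1} - A) f = int01 (\<lambda>x. f x - indicator A x *\<^sub>R f x)"
      unfolding set_lebesgue_integral_def
      by (intro Bochner_Integration.integral_cong) (auto simp: indicator_def)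
    also have "\<dots> = 0"
      using si[OF A(1)] A(2) f I
      by (simp add: P_def set_integrable_def set_lebesgue_integral_def L1_def)
    finally show "P ({0..1} - A)" by (simp add: P_def)
  next
    fix A :: "nat \<Rightarrow> real set"
    assume A: "disjoint_family A" "range A \<subseteq> sets leb01" "\<And>i. P (A i)"
    have "set_lebesgue_integral leb01 (\<Union>i. A i) f = (\<Sum>i. set_lebesgue_integral leb01 (A i) f)"
      using A by (intro lebesgue_integral_countable_add si) (auto simp: disjoint_family_on_def)
    then show "P (\<Union>i. A i)" using A by (simp add: P_def)
  qed
  then show "set_lebesgue_integral leb01 A f = set_lebesgue_integral leb01 A (\<lambda>x. 0)"
    if "A \<in> sets leb01" for A
    using that by (simp add: P_def set_lebesgue_integral_def)
qed

section \<open>Integrable functions as distributions, and their representatives\<close>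

lemma reg_apply: "z \<in> test_functions \<Longrightarrow> reg f z = int01 (\<lambda>x. f x * z x)"
  by (simp add: reg_def)

lemma reg_outside: "z \<notin> test_functions \<Longrightarrow> reg f z = 0"
  by (simp add: reg_def)

lemma L1_mult_test: "f \<in> L1 \<Longrightarrow> z \<in> test_functions \<Longrightarrow> (\<lambda>x. f x * z x) \<in> L1"
  by (intro L1_mult_smooth test_smooth)

lemma integrable_mult_test: "f \<in> L1 \<Longrightarrow> z \<in> test_functions \<Longrightarrow> integrable leb01 (\<lambda>x. f x * z x)"
  by (intro L1_integrable L1_mult_test)

lemma reg_AE_cong:
  assumes "f \<in> L1" "AE x in leb01. f x = g x"
  shows "reg f = reg g"
proof
  fix z show "reg f z = reg g z"
  proof (cases "z \<in> test_functions")
    case True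
    show ?thesis unfolding reg_apply[OF True]
      using assms(2) L1_measurable[OF L1_mult_test[OF _ True]] L1_AE_cong[OF assms] assms(1)
      by (intro integral_cong_AE) (auto elim: eventually_mono)
  qed (simp add: reg_outside)
qed

lemma fundamental_lemma:
  assumes f: "f \<in> L1" and g: "g \<in> L1" and eq: "reg f = reg g"
  shows "AE x in leb01. f x = g x"
proof -
  have "AE x in leb01. f x - g x = 0"
  proof (rule fundamental_lemma_zero)
    fix z assume z: "z \<in> test_functions"
    show "int01 (\<lambda>x. (f x - g x) * z x) = 0"
      using fun_cong[OF eq, of z] integrable_mult_test[OF f z] integrable_mult_test[OF g z] z
      by (simp add: reg_apply left_diff_distrib)
  qed (intro L1_diff f g)
  then show ?thesis by simp
qed

text \<open>\<open>density\<close> is a choice; the fundamental lemma determines its value up to a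
  null set.\<close>

lemma density_reg:
  assumes "f \<in> L1"
  shows "density (reg f) \<in> L1" and "reg (density (reg f)) = reg f"
    and "AE x in leb01. density (reg f) x = f x"
proof -
  have "density (reg f) \<in> L1 \<and> reg f = reg (density (reg f))"
    unfolding density_def using someI[of "\<lambda>g. g \<in> L1 \<and> reg f = reg g" f] assms by blast
  then show "density (reg f) \<in> L1" "reg (density (reg f)) = reg f" by auto
  then show "AE x in leb01. density (reg f) x = f x" by (rule fundamental_lemma[OF _ assms])
qed

text \<open>The algebraic half of membership in \<open>distributions\<close>, separated because it
  passes through \<open>ddiff\<close>, sums and multiples by direct computation.\<close>

definition test_linear :: "functional \<Rightarrow> bool" where
  "test_linear u \<longleftrightarrow>
     (\<forall>z. z \<notin> test_functions \<longrightarrow> u z = 0) \<and>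
     (\<forall>z\<in>test_functions. \<forall>w\<in>test_functions. u (\<lambda>x. z x + w x) = u z + u w) \<and>
     (\<forall>a. \<forall>z\<in>test_functions. u (\<lambda>x. a * z x) = a * u z)"

lemma distributions_test_linear: "u \<in> distributions \<Longrightarrow> test_linear u"
  by (simp add: distributions_def test_linear_def)

lemma test_linearD:
  assumes "test_linear u"
  shows "z \<notin> test_functions \<Longrightarrow> u z = 0"
    and "z \<in> test_functions \<Longrightarrow> w \<in> test_functions \<Longrightarrow> u (\<lambda>x. z x + w x) = u z + u w"
    and "z \<in> test_functions \<Longrightarrow> u (\<lambda>x. a * z x) = a * u z"
  using assms by (auto simp: test_linear_def)

lemma test_linear_0: "test_linear u \<Longrightarrow> u (\<lambda>x. 0) = 0"
  using test_linearD(3)[of u "\<lambda>x. 0" 0] test_0 by simp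

lemma test_linear_diff:
  "test_linear u \<Longrightarrow> z \<in> test_functions \<Longrightarrow> w \<in> test_functions \<Longrightarrow> u (\<lambda>x. z x - w x) = u z - u w"
  using test_linearD(2)[of u z "\<lambda>x. (-1) * w x"] test_linearD(3)[of u w "-1"] test_cmult[of w "-1"]
  by simp

lemma test_linear_sum:
  "test_linear u \<Longrightarrow> (\<And>i. i \<in> I \<Longrightarrow> z i \<in> test_functions) \<Longrightarrow>
     u (\<lambda>x. \<Sum>i\<in>I. z i x) = (\<Sum>i\<in>I. u (z i))"
proof (induction I rule: infinite_finite_induct)
  case (insert i I)
  then have "u (\<lambda>x. z i x + (\<Sum>i\<in>I. z i x)) = u (z i) + u (\<lambda>x. \<Sum>i\<in>I. z i x)"
    by (intro test_linearD(2) test_sum) auto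
  with insert show ?case by simp
qed (auto simp: test_linear_0)

lemma test_linear_reg: "f \<in> L1 \<Longrightarrow> test_linear (reg f)"
  using integrable_mult_test[of f]
  by (auto simp: test_linear_def reg_apply reg_outside test_add test_cmult ring_distribs mult.left_commute)

lemma ddiff_apply: "z \<in> test_functions \<Longrightarrow> ddiff u z = - u (vderiv z)"
  by (simp add: ddiff_def)

lemma vderiv_test_add:
  "z \<in> test_functions \<Longrightarrow> w \<in> test_functions \<Longrightarrow>
     (vderiv ^^ k) (\<lambda>x. z x + w x) = (\<lambda>x. (vderiv ^^ k) z x + (vderiv ^^ k) w x)"
  using smooth_add(2) test_smooth by blast

lemma test_linear_ddiff:
  assumes "test_linear u" shows "test_linear (ddiff u)"
proof -
  have "vderiv (\<lambda>x. z x + w x) = (\<lambda>x. vderiv z x + vderiv w x)"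
    if "z \<in> test_functions" "w \<in> test_functions" for z w
    using vderiv_test_add[OF that, of 1] by simp
  moreover have "vderiv (\<lambda>x. a * z x) = (\<lambda>x. a * vderiv z x)" if "z \<in> test_functions" for a z
    using smooth_cmult(2)[OF test_smooth[OF that], of 1] by simp
  ultimately show ?thesis using assms
    by (auto simp: test_linear_def ddiff_def test_add test_cmult test_vderiv1)
qed

lemma test_linear_ddiff_funpow: "test_linear u \<Longrightarrow> test_linear ((ddiff ^^ k) u)"
  by (induction k) (auto intro: test_linear_ddiff)

lemma test_linear_add: "test_linear u \<Longrightarrow> test_linear v \<Longrightarrow> test_linear (\<lambda>z. u z + v z)"
  and test_linear_sub: "test_linear u \<Longrightarrow> test_linear v \<Longrightarrow> test_linear (\<lambda>z. u z - v z)"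
  and test_linear_cmult: "test_linear u \<Longrightarrow> test_linear (\<lambda>z. c * u z)"
  by (auto simp: test_linear_def algebra_simps)

lemma test_linear_zero: "test_linear (\<lambda>z. 0)"
  by (simp add: test_linear_def)

lemma test_linear_setsum:
  "(\<And>i. i \<in> I \<Longrightarrow> test_linear (u i)) \<Longrightarrow> test_linear (\<lambda>z. \<Sum>i\<in>I. u i z)"
  by (induction I rule: infinite_finite_induct) (auto intro: test_linear_add test_linear_zero)

lemma test_linear_eqI:
  "test_linear u \<Longrightarrow> test_linear v \<Longrightarrow> (\<And>z. z \<in> test_functions \<Longrightarrow> u z = v z) \<Longrightarrow> u = v"
  by (rule ext) (metis test_linearD(1))

lemma ddiff_funpow_apply:
  "z \<in> test_functions \<Longrightarrow> (ddiff ^^ k) u z = (-1) ^ k * u ((vderiv ^^ k) z)"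
proof (induction k arbitrary: z)
  case (Suc k)
  then show ?case using Suc.IH[OF test_vderiv1[OF Suc.prems]]
    by (simp add: ddiff_apply vderiv_funpow_commute)
qed simp

lemma ddiff_funpow_reg_apply:
  "z \<in> test_functions \<Longrightarrow>
     (ddiff ^^ k) (reg f) z = (-1) ^ k * int01 (\<lambda>x. f x * (vderiv ^^ k) z x)"
  by (simp add: ddiff_funpow_apply reg_apply test_vderiv)

text \<open>The integral from the left is constant to the right of the support, and the zero mean
  makes this constant 0.\<close>

lemma test_antiderivative:
  assumes z: "z \<in> test_functions" and 0: "int01 z = 0"
  obtains w where "w \<in> test_functions" "vderiv w = z"
proof -
  obtain a b where ab: "0 < a" "a < b" "b < 1" and out: "\<And>x. x \<notin> {a<..<b} \<Longrightarrow> z x = 0"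
    using z by (auto simp: test_functions_iff)
  define w where "w x = integral {-1..x} z" for x
  have restr: "integral S z = integral {a..b} z" if "{a..b} \<subseteq> S" for S
  proof -
    have "integral S z = integral S (\<lambda>t. if t \<in> {a..b} then z t else 0)"
      using out by (intro integral_cong) auto
    also have "\<dots> = integral ({a..b} \<inter> S) z" by (rule integral_restrict_Int)
    finally show ?thesis using that by (simp add: Int_absorb2)
  qed
  have "int01 z = integral {0..1} z"
    using smooth_L1[OF test_smooth[OF z]] by (intro lebesgue_integral_eq_integral) (auto simp: L1_def)
  then have I: "integral {a..b} z = 0" using 0 restr[of "{0..1}"] ab by simp
  have hi: "w x = 0" if "b \<le> x" for x
    using restr[of "{-1..x}"] that ab I by (simp add: w_def)
  have lo: "w x = 0" if "x \<le> a" for x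
  proof -
    have "integral {-1..x} z = integral {-1..x} (\<lambda>x. 0)"
      using out that by (intro integral_cong) auto
    then show ?thesis by (simp add: w_def)
  qed
  have d: "(w has_vector_derivative z x) (at x)" for x
  proof (cases "x < a")
    case True
    have "((\<lambda>x. 0) has_vector_derivative 0) (at x)" by simp
    then have "(w has_vector_derivative 0) (at x)"
      by (rule has_vector_derivative_transform_within_open[of _ _ _ "{..<a}"]) (use True lo in auto)
    then show ?thesis using out True by simp
  next
    case False
    have "((\<lambda>u. integral {-1..u} z) has_vector_derivative z x) (at x within {-1..x+1})"
      using False ab smooth_continuous[OF test_smooth[OF z]]
      by (intro integral_has_vector_derivative) auto
    then show ?thesis
      using False ab by (simp add: w_def[abs_def] at_within_Icc_at)
  qed
  have "smooth w"
    by (rule smooth_seqI[where D="\<lambda>k. case k of 0 \<Rightarrow> w | Suc k \<Rightarrow> (vderiv ^^ k) z"])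
      (use d smooth_has_vderiv[OF test_smooth[OF z]] in \<open>auto split: nat.splits\<close>)
  moreover have "w x = 0" if "x \<notin> {a<..<b}" for x using that hi lo by (cases "x \<le> a") auto
  ultimately have "w \<in> test_functions" unfolding test_functions_iff using ab by blast
  moreover have "vderiv w = z" using d by (auto simp: vderiv_def vector_derivative_at)
  ultimately show ?thesis using that by blast
qed

lemma unit_mass_test:
  obtains \<phi> where "\<phi> \<in> test_functions" "int01 \<phi> = 1"
proof -
  obtain u where u: "\<And>k. u k \<in> test_functions" "\<And>k x. norm (u k x) \<le> 1"
    "\<And>x. (\<lambda>k. u k x) \<longlonglongrightarrow> indicator {0<..<1::real} x"
    using interval_bump[of 0 1] by auto
  have "\<exists>k. int01 (u k) \<noteq> 0"
  proof (rule ccontr)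
    assume "\<not> ?thesis"
    then have z: "int01 (u k) = 0" for k by simp
    from integral_bump_tendsto[OF L1_const[of 1] u]
    have "int01 (\<lambda>x. indicator {0<..<1} x :: complex) = 0"
      by (simp add: z LIMSEQ_const_iff)
    moreover have "int01 (\<lambda>x. indicator {0<..<1} x :: complex) = 1"
    proof -
      have "(\<lambda>x. indicator {0<..<1::real} x :: complex) = (\<lambda>x. of_real (indicator {0<..<1} x))"
        by (auto simp: indicator_def)
      then have "int01 (\<lambda>x. indicator {0<..<1} x :: complex) = of_real (measure leb01 {0<..<1})"
        by (simp add: Int_absorb2 subset_eq del: of_real_indicator)
      also have "measure leb01 {0<..<1} = 1" by (subst measure_restrict_space) auto
      finally show ?thesis by simp
    qed
    ultimately show False by simp
  qed
  then obtain k where k: "int01 (u k) \<noteq> 0" by blast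
  show ?thesis
    by (rule that[of "\<lambda>x. inverse (int01 (u k)) * u k x"])
      (use k u in \<open>auto intro: test_cmult\<close>)
qed

text \<open>Subtracting its mass times a fixed \<phi> of mass 1 turns any test function into one of
  mean 0, hence into a derivative, on which \<open>u\<close> vanishes. The constant is
  \<open>u \<phi>\<close>.\<close>

lemma ddiff_eq_0_const:
  assumes u: "test_linear u" and 0: "\<And>z. z \<in> test_functions \<Longrightarrow> u (vderiv z) = 0"
  obtains c where "u = reg (\<lambda>x. c)"
proof -
  obtain \<phi> where \<phi>: "\<phi> \<in> test_functions" "int01 \<phi> = 1" by (rule unit_mass_test)
  have "u z = reg (\<lambda>x. u \<phi>) z" if z: "z \<in> test_functions" for z
  proof -
    define I where "I = int01 z"
    have t: "(\<lambda>x. z x - I * \<phi> x) \<in> test_functions" by (intro test_diff test_cmult z \<phi>)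
    have "int01 (\<lambda>x. z x - I * \<phi> x) = 0"
      using smooth_L1[OF test_smooth[OF z]] smooth_L1[OF test_smooth[OF \<phi>(1)]] \<phi>(2)
      by (simp add: L1_def I_def)
    from test_antiderivative[OF t this] obtain w where "w \<in> test_functions" "vderiv w = (\<lambda>x. z x - I * \<phi> x)"
      by metis
    with 0 have "u (\<lambda>x. z x - I * \<phi> x) = 0" by metis
    then have "u z = I * u \<phi>"
      using test_linear_diff[OF u z test_cmult[OF \<phi>(1)]] test_linearD(3)[OF u \<phi>(1)] by simp
    then show ?thesis using z by (simp add: reg_apply I_def)
  qed
  then have "u = reg (\<lambda>x. u \<phi>)" by (intro test_linear_eqI u test_linear_reg L1_const)
  then show ?thesis by (rule that)
qed

section \<open>Weak derivatives\<close>

text \<open>Representations as primitives hold only a.e.; this provides a point at which one can be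
  evaluated outside a given support.\<close>

lemma AE_leb01_ex:
  assumes "AE x in leb01. P x" "0 \<le> p" "p < q" "q \<le> 1"
  obtains x where "p < x" "x < q" "P x"
proof -
  have "\<exists>x. p < x \<and> x < q \<and> P x"
  proof (rule ccontr)
    assume "\<not> ?thesis"
    then have "AE x in leb01. x \<notin> {p<..<q}" using assms(1) by (auto elim: eventually_mono)
    moreover have s: "{p<..<q} \<in> sets leb01"
      using assms by (auto simp: sets_restrict_space intro!: image_eqI[of _ _ "{p<..<q}"])
    ultimately have "emeasure leb01 {p<..<q} = 0"
      using AE_iff_measurable[OF s, of "\<lambda>x. x \<notin> {p<..<q}"] assms by force
    moreover have "emeasure leb01 {p<..<q} = ennreal (q - p)"
      using assms by (subst emeasure_restrict_space) auto
    ultimately show False using assms by simp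
  qed
  then show ?thesis using that by blast
qed

text \<open>A relation between explicit functions, unlike \<open>wderiv\<close>, whose value is a
  choice: chains of derivatives can be written down and altered on null sets.\<close>

definition weak_deriv :: "(real \<Rightarrow> complex) \<Rightarrow> (real \<Rightarrow> complex) \<Rightarrow> bool" where
  "weak_deriv f g \<longleftrightarrow> f \<in> L1 \<and> g \<in> L1 \<and> ddiff (reg f) = reg g"

lemma weak_derivD:
  "weak_deriv f g \<Longrightarrow> f \<in> L1" "weak_deriv f g \<Longrightarrow> g \<in> L1" "weak_deriv f g \<Longrightarrow> ddiff (reg f) = reg g"
  by (auto simp: weak_deriv_def)

lemma weak_deriv_AE_cong:
  assumes "weak_deriv f g" "AE x in leb01. f x = f' x" "AE x in leb01. g x = g' x"
  shows "weak_deriv f' g'"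
  using assms reg_AE_cong[of f f'] reg_AE_cong[of g g'] L1_AE_cong
  by (auto simp: weak_deriv_def)

lemma weak_derivI:
  assumes "f \<in> L1" "g \<in> L1"
    "\<And>z. z \<in> test_functions \<Longrightarrow>
      int01 (\<lambda>x. f x * vderiv z x) = - int01 (\<lambda>x. g x * z x)"
  shows "weak_deriv f g"
  unfolding weak_deriv_def
  using assms by (auto intro!: test_linear_eqI test_linear_ddiff test_linear_reg
      simp: ddiff_apply reg_apply test_vderiv1)

lemma weak_deriv_apply:
  assumes "weak_deriv f g" and z: "z \<in> test_functions"
  shows "int01 (\<lambda>x. f x * vderiv z x) = - int01 (\<lambda>x. g x * z x)"
proof -
  have "- reg f (vderiv z) = reg g z"
    using fun_cong[OF weak_derivD(3)[OF assms(1)], of z] by (simp only: ddiff_apply[OF z])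
  then have "reg f (vderiv z) = - reg g z" by (rule minus_equation_iff[THEN iffD1, symmetric])
  then show ?thesis by (simp only: reg_apply z test_vderiv1)
qed

lemma test_endpoints: "z \<in> test_functions \<Longrightarrow> z 0 = 0 \<and> z 1 = 0"
  by (force simp: test_functions_iff)

lemma integral_vderiv_test: "z \<in> test_functions \<Longrightarrow> int01 (vderiv z) = 0"
  using prim_vderiv[of z 1] prim_eq_integral[of 1 "vderiv z"] test_endpoints[of z] test_smooth[of z]
  by simp

text \<open>\<open>prim_fubini\<close> moves the integration from \<open>f\<close> to
  \<open>vderiv z\<close>, whose primitive is \<open>z\<close> again; the constant drops out because
  \<open>vderiv z\<close> has mean 0.\<close>

lemma weak_deriv_prim:
  assumes f: "f \<in> L1"
  shows "weak_deriv (\<lambda>x. c + prim f x) f"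
proof (rule weak_derivI)
  fix z assume z: "z \<in> test_functions"
  have z': "vderiv z \<in> L1" by (intro smooth_L1 smooth_vderiv1 test_smooth z)
  have "int01 (\<lambda>x. (c + prim f x) * vderiv z x)
      = c * int01 (vderiv z) + int01 (\<lambda>x. prim f x * vderiv z x)"
    using z' L1_mult_prim[OF z' f] by (simp add: ring_distribs L1_def mult.commute)
  also have "\<dots> = int01 (\<lambda>t. f t * (0 - prim (vderiv z) t))"
    using prim_fubini[OF f z'] z by (simp add: integral_vderiv_test)
  also have "\<dots> = int01 (\<lambda>t. - (f t * z t))"
    using prim_vderiv[OF test_smooth[OF z]] test_endpoints[OF z]
    by (intro Bochner_Integration.integral_cong) auto
  finally show "int01 (\<lambda>x. (c + prim f x) * vderiv z x) = - int01 (\<lambda>x. f x * z x)"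
    by simp
qed (intro L1_add L1_const prim_L1 f)+

lemma weak_deriv_prim0: "f \<in> L1 \<Longrightarrow> weak_deriv (prim f) f"
  using weak_deriv_prim[of f 0] by simp

text \<open>\<open>f\<close> minus \<open>prim g\<close> has derivative 0 and is therefore constant.
  Being a.e. a primitive, \<open>f\<close> is essentially bounded, which is why its products with
  \<open>L1\<close> coefficients are integrable.\<close>

lemma weak_deriv_imp_prim:
  assumes "weak_deriv f g"
  obtains c where "AE x in leb01. f x = c + prim g x"
proof -
  note L = weak_derivD[OF assms]
  have P: "ddiff (reg (prim g)) = reg g" using weak_deriv_prim0[OF L(2)] by (simp add: weak_deriv_def)
  have "reg f (vderiv z) = reg (prim g) (vderiv z)" if "z \<in> test_functions" for z
    using fun_cong[OF L(3), of z] fun_cong[OF P, of z] that by (simp add: ddiff_apply) (metis minus_minus)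
  then obtain c where c: "(\<lambda>z. reg f z - reg (prim g) z) = reg (\<lambda>x. c)"
    using ddiff_eq_0_const[of "\<lambda>z. reg f z - reg (prim g) z"] L
    by (metis eq_iff_diff_eq_0 prim_L1 test_linear_reg test_linear_sub)
  have "reg f z = reg (\<lambda>x. c + prim g x) z" for z
    using fun_cong[OF c, of z] integrable_mult_test[OF prim_L1[OF L(2)], of z]
      integrable_mult_test[OF L1_const, of z c]
    by (cases "z \<in> test_functions") (auto simp: reg_apply reg_outside ring_distribs diff_eq_eq)
  then have "reg f = reg (\<lambda>x. c + prim g x)" by blast
  then have "AE x in leb01. f x = c + prim g x"
    by (intro fundamental_lemma L L1_add L1_const prim_L1)
  then show ?thesis by (rule that)
qed

lemma weak_deriv_bounded:
  assumes "weak_deriv f g"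
  obtains C where "AE x in leb01. norm (f x) \<le> C"
proof -
  obtain c where c: "AE x in leb01. f x = c + prim g x" by (rule weak_deriv_imp_prim[OF assms])
  have "AE x in leb01. norm (f x) \<le> norm c + int01 (\<lambda>t. norm (g t))"
    using c
  proof eventually_elim
    case (elim x)
    then show ?case using prim_norm_le[OF weak_derivD(2)[OF assms], of x] norm_triangle_ineq[of c "prim g x"]
      by simp
  qed
  then show ?thesis by (rule that)
qed

lemma L1_mult_weak:
  assumes "f \<in> L1" "weak_deriv g g'" shows "(\<lambda>x. f x * g x) \<in> L1"
proof -
  obtain C where "AE x in leb01. norm (g x) \<le> C" by (rule weak_deriv_bounded[OF assms(2)])
  then show ?thesis by (intro L1_mult_bounded assms L1_measurable weak_derivD(1)[OF assms(2)])
qed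

lemma weak_deriv_smooth:
  assumes "smooth w" shows "weak_deriv w (vderiv w)"
proof -
  have L: "vderiv w \<in> L1" by (intro smooth_L1 smooth_vderiv1 assms)
  have "AE x in leb01. w 0 + prim (vderiv w) x = w x"
    using prim_vderiv[OF assms] by (intro AE_I2) auto
  then show ?thesis by (rule weak_deriv_AE_cong[OF weak_deriv_prim[OF L]]) simp
qed

lemma weak_deriv_mult_smooth:
  assumes f: "weak_deriv f g" and w: "smooth w"
  shows "weak_deriv (\<lambda>x. f x * w x) (\<lambda>x. g x * w x + f x * vderiv w x)"
proof (rule weak_derivI)
  note L = weak_derivD[OF f]
  show "(\<lambda>x. f x * w x) \<in> L1" "(\<lambda>x. g x * w x + f x * vderiv w x) \<in> L1"
    by (intro L1_add L1_mult_smooth L w smooth_vderiv1)+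
  fix z assume z: "z \<in> test_functions"
  have wz: "vderiv (\<lambda>x. w x * z x) = (\<lambda>x. w x * vderiv z x + vderiv w x * z x)"
    using smooth_mult(2)[OF w test_smooth[OF z], of 1] by simp
  have i: "(\<lambda>x. f x * w x * vderiv z x) \<in> L1" "(\<lambda>x. f x * vderiv w x * z x) \<in> L1"
    "(\<lambda>x. g x * w x * z x) \<in> L1"
    by (intro L1_mult_smooth L w smooth_vderiv1 test_smooth z)+
  have "int01 (\<lambda>x. f x * vderiv (\<lambda>x. w x * z x) x) = - int01 (\<lambda>x. g x * (w x * z x))"
    by (rule weak_deriv_apply[OF f smooth_mult_test[OF w z]])
  then have "int01 (\<lambda>x. f x * w x * vderiv z x) + int01 (\<lambda>x. f x * vderiv w x * z x)
      = - int01 (\<lambda>x. g x * w x * z x)"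
    unfolding wz using Bochner_Integration.integral_add[OF i(1,2)[THEN L1_integrable]]
    by (simp add: distrib_left mult.assoc)
  moreover have "int01 (\<lambda>x. (g x * w x + f x * vderiv w x) * z x)
      = int01 (\<lambda>x. g x * w x * z x) + int01 (\<lambda>x. f x * vderiv w x * z x)"
    using Bochner_Integration.integral_add[OF i(3,2)[THEN L1_integrable]]
    by (simp add: distrib_right)
  ultimately show "int01 (\<lambda>x. f x * w x * vderiv z x) =
      - int01 (\<lambda>x. (g x * w x + f x * vderiv w x) * z x)"
    by (simp only: eq_diff_eq[symmetric]) simp
qed

lemma weak_deriv_add:
  assumes "weak_deriv f g" "weak_deriv f' g'"
  shows "weak_deriv (\<lambda>x. f x + f' x) (\<lambda>x. g x + g' x)"
proof (rule weak_derivI)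
  fix z assume z: "z \<in> test_functions"
  note L = weak_derivD(1,2)[OF assms(1)] weak_derivD(1,2)[OF assms(2)]
  show "int01 (\<lambda>x. (f x + f' x) * vderiv z x) = - int01 (\<lambda>x. (g x + g' x) * z x)"
    using L[THEN integrable_mult_test] weak_deriv_apply[OF assms(1) z] weak_deriv_apply[OF assms(2) z] z test_vderiv1[OF z]
    by (simp add: ring_distribs)
qed (intro L1_add weak_derivD(1,2)[OF assms(1)] weak_derivD(1,2)[OF assms(2)])+

lemma weak_deriv_cmult: "weak_deriv f g \<Longrightarrow> weak_deriv (\<lambda>x. c * f x) (\<lambda>x. c * g x)"
  by (rule weak_derivI) (auto simp: weak_deriv_apply mult.assoc intro!: L1_cmult dest: weak_derivD)

lemma weak_deriv_sum:
  "(\<And>i. i \<in> I \<Longrightarrow> weak_deriv (f i) (g i)) \<Longrightarrow> weak_deriv (\<lambda>x. \<Sum>i\<in>I. f i x) (\<lambda>x. \<Sum>i\<in>I. g i x)"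
proof (induction I rule: infinite_finite_induct)
  case (insert i I)
  then have "weak_deriv (\<lambda>x. f i x + (\<Sum>i\<in>I. f i x)) (\<lambda>x. g i x + (\<Sum>i\<in>I. g i x))"
    by (intro weak_deriv_add) auto
  with insert show ?case by simp
qed (use weak_deriv_smooth[OF smooth_const[of 0]] in \<open>auto simp: vderiv_def\<close>)

text \<open>With both functions written as primitives this is \<open>prim_fubini\<close>; the
  compact support of \<open>h\<close> removes the boundary terms.\<close>

lemma weak_integration_by_parts:
  assumes s: "weak_deriv s s'" and h: "weak_deriv h h'"
    and ab: "0 < a" "a < b" "b < 1"
    and out: "\<And>x. x \<notin> {a<..<b} \<Longrightarrow> h x = 0" "\<And>x. x \<notin> {a<..<b} \<Longrightarrow> h' x = 0"
  shows "int01 (\<lambda>x. s x * h' x) = - int01 (\<lambda>x. s' x * h x)"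
proof -
  note Ls = weak_derivD[OF s] and Lh = weak_derivD[OF h]
  obtain c where c: "AE x in leb01. s x = c + prim s' x" by (rule weak_deriv_imp_prim[OF s])
  obtain d where d: "AE x in leb01. h x = d + prim h' x" by (rule weak_deriv_imp_prim[OF h])
  \<comment> \<open>Evaluating \<open>h\<close> left of its support shows that its constant is 0,
    evaluating it right of the support that \<open>h'\<close> has integral 0.\<close>
  obtain x where x: "x < a" "h x = d + prim h' x" using AE_leb01_ex[OF d, of 0 a] ab by force
  have "prim h' x = int01 (\<lambda>t. 0)"
    unfolding prim_def using out(2) x(1) ab
    by (intro Bochner_Integration.integral_cong refl) (auto simp: indicator_def)
  then have d0: "d = 0" using x out(1)[of x] by simp
  obtain y where y: "b < y" "h y = d + prim h' y" using AE_leb01_ex[OF d, of b 1] ab by force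
  have "prim h' y = int01 h'"
    unfolding prim_def using out(2) y(1) ab
    by (intro Bochner_Integration.integral_cong refl) (auto simp: indicator_def)
  then have tot: "int01 h' = 0" using y out(1)[of y] d0 by simp
  have sh: "(\<lambda>x. s x * h' x) \<in> L1" using L1_mult_weak[OF Lh(2) s] by (simp add: mult.commute)
  have ae: "AE x in leb01. s x * h' x = c * h' x + prim s' x * h' x"
    using c by eventually_elim (simp add: ring_distribs)
  have "int01 (\<lambda>x. s x * h' x) = int01 (\<lambda>x. c * h' x + prim s' x * h' x)"
    using L1_measurable[OF sh] L1_measurable[OF L1_AE_cong[OF sh ae]] ae by (intro integral_cong_AE)
  also have "\<dots> = int01 (\<lambda>x. prim s' x * h' x)"
    using Lh(2) L1_mult_prim[OF Lh(2) Ls(2)] tot by (simp add: L1_def mult.commute)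
  also have "\<dots> = int01 (\<lambda>t. s' t * (0 - prim h' t))"
    using prim_fubini[OF Ls(2) Lh(2)] tot by simp
  also have "\<dots> = int01 (\<lambda>t. - (s' t * h t))"
  proof (rule integral_cong_AE)
    show "(\<lambda>t. s' t * (0 - prim h' t)) \<in> borel_measurable leb01"
      using L1_measurable[OF L1_cmult[OF L1_mult_prim[OF Ls(2) Lh(2)], of "-1"]] by simp
    show "(\<lambda>t. - (s' t * h t)) \<in> borel_measurable leb01"
      using L1_measurable[OF L1_cmult[OF L1_mult_weak[OF Ls(2) h], of "-1"]] by simp
    show "AE t in leb01. s' t * (0 - prim h' t) = - (s' t * h t)"
      using d by eventually_elim (simp add: d0)
  qed
  finally show ?thesis by simp
qed

lemma ddiff_funpow_chain:
  assumes "\<And>j. j < d \<Longrightarrow> weak_deriv (G j) (G (Suc j))" "j \<le> d"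
  shows "(ddiff ^^ j) (reg (G 0)) = reg (G j)"
  using assms(2)
proof (induction j)
  case (Suc j)
  then show ?case using weak_derivD(3)[OF assms(1)[of j]] by simp
qed simp

text \<open>If \<open>G\<close> lists successive derivatives of \<open>G 0\<close>, this is the j-th
  derivative of \<open>G 0 * z\<close> as an explicit function. Unlike \<open>wderiv\<close> it
  vanishes at every point where all derivatives of \<open>z\<close> do, and integration by parts
  relies on that.\<close>

definition leibniz :: "(nat \<Rightarrow> real \<Rightarrow> complex) \<Rightarrow> (real \<Rightarrow> complex) \<Rightarrow> nat \<Rightarrow> real \<Rightarrow> complex" where
  "leibniz G z j = (\<lambda>x. \<Sum>p\<le>j. of_nat (j choose p) * (G p x * (vderiv ^^ (j - p)) z x))"

lemma weak_deriv_leibniz: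
  assumes "\<And>p. p \<le> j \<Longrightarrow> weak_deriv (G p) (G (Suc p))" "smooth z"
  shows "weak_deriv (leibniz G z j) (leibniz G z (Suc j))"
proof -
  have "weak_deriv (leibniz G z j) (\<lambda>x. \<Sum>p\<le>j. of_nat (j choose p) *
      (G (Suc p) x * (vderiv ^^ (j - p)) z x + G p x * (vderiv ^^ (Suc (j - p))) z x))"
    unfolding leibniz_def
  proof (intro weak_deriv_sum weak_deriv_cmult)
    fix p assume "p \<in> {..j}"
    then show "weak_deriv (\<lambda>x. G p x * (vderiv ^^ (j - p)) z x)
      (\<lambda>x. G (Suc p) x * (vderiv ^^ (j - p)) z x + G p x * (vderiv ^^ (Suc (j - p))) z x)"
      using weak_deriv_mult_smooth[OF assms(1) smooth_vderiv[OF assms(2)], of p "j - p"] by simp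
  qed
  then show ?thesis
    using leibniz_step[of j "\<lambda>p. G p x" "\<lambda>p. (vderiv ^^ p) z x" for x]
    by (simp only: leibniz_def[of G z "Suc j"])
qed

lemma weak_integration_by_parts_iter:
  assumes S: "\<And>j. j < d \<Longrightarrow> weak_deriv (S j) (S (Suc j))"
    and H: "\<And>j. j < d \<Longrightarrow> weak_deriv (H j) (H (Suc j))"
    and ab: "0 < a" "a < b" "b < 1"
    and out: "\<And>j x. j \<le> d \<Longrightarrow> x \<notin> {a<..<b} \<Longrightarrow> H j x = 0"
  shows "int01 (\<lambda>x. S 0 x * H d x) = (-1) ^ d * int01 (\<lambda>x. S d x * H 0 x)"
proof -
  have "int01 (\<lambda>x. S 0 x * H d x) = (-1) ^ i * int01 (\<lambda>x. S i x * H (d - i) x)"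
    if "i \<le> d" for i
    using that
  proof (induction i)
    case (Suc i)
    have e: "d - i = Suc (d - Suc i)" using Suc.prems by simp
    have "int01 (\<lambda>x. S i x * H (d - i) x) = - int01 (\<lambda>x. S (Suc i) x * H (d - Suc i) x)"
      unfolding e using Suc.prems
      by (intro weak_integration_by_parts[OF S H ab]) (auto intro!: out)
    then show ?case using Suc by simp
  qed simp
  from this[of d] show ?thesis by simp
qed

section \<open>Distributions with vanishing d-th derivative\<close>

lemma poly_seq:
  "((\<lambda>x. poly ((pderiv ^^ k) p) (of_real x :: complex)) has_vector_derivative
     poly ((pderiv ^^ Suc k) p) (of_real x)) (at x)"
  using has_vector_derivative_real_field[OF poly_DERIV[of "(pderiv ^^ k) p" "of_real x :: complex"]] by simp

lemma smooth_poly: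
  shows "smooth (\<lambda>x. poly p (of_real x))"
    and "(vderiv ^^ k) (\<lambda>x. poly p (of_real x)) = (\<lambda>x. poly ((pderiv ^^ k) p) (of_real x))"
  using smooth_seq[of "\<lambda>k x. poly ((pderiv ^^ k) p) (of_real x)" "\<lambda>x. poly p (of_real x)", OF _ poly_seq]
  by auto

lemma pderiv_funpow_eq_0:
  fixes p :: "complex poly"
  assumes "\<And>i. d \<le> i \<Longrightarrow> coeff p i = 0"
  shows "(pderiv ^^ d) p = 0"
  using assms
proof (induction d arbitrary: p)
  case 0
  then show ?case by (simp add: poly_eq_iff)
next
  case (Suc d)
  have "(pderiv ^^ d) (pderiv p) = 0" by (rule Suc.IH) (simp add: coeff_pderiv Suc.prems)
  then show ?case by (simp only: funpow_Suc_right o_apply)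
qed

text \<open>Induction on d: the derivative of \<open>u\<close> is a polynomial \<open>p\<close>, and
  \<open>u\<close> differs by a constant from an antiderivative of \<open>p\<close>. The degree
  bound is put through coefficients so that d = 0 means the zero polynomial.\<close>

lemma ddiff_funpow_eq_0_poly:
  assumes "test_linear u" "(ddiff ^^ d) u = (\<lambda>z. 0)"
  obtains p where "\<And>i. d \<le> i \<Longrightarrow> coeff p i = 0" "u = reg (\<lambda>x. poly p (of_real x))"
proof -
  have "\<exists>p. (\<forall>i\<ge>d. coeff p i = 0) \<and> u = reg (\<lambda>x. poly p (of_real x))"
    using assms
  proof (induction d arbitrary: u)
    case 0
    then show ?case by (intro exI[of _ 0]) (auto simp: reg_def)
  next
    case (Suc d)
    have "(ddiff ^^ d) (ddiff u) = (\<lambda>z. 0)" using Suc.prems(2) by (simp only: funpow_Suc_right o_apply)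
    from Suc.IH[OF test_linear_ddiff[OF Suc.prems(1)] this] obtain p where
      p: "\<And>i. i \<ge> d \<Longrightarrow> coeff p i = 0" "ddiff u = reg (\<lambda>x. poly p (of_real x))" by blast
    define q where "q = (\<Sum>i<d. monom (coeff p i / of_nat (Suc i)) (Suc i))"
    have pq: "pderiv q = p"
    proof (rule poly_eqI)
      fix i
      have "coeff (pderiv q) i = of_nat (Suc i) * (\<Sum>j<d. if j = i then coeff p j / of_nat (Suc j) else 0)"
        by (simp add: q_def coeff_pderiv coeff_sum del: of_nat_Suc)
      also have "\<dots> = coeff p i" using p(1)[of i] by (simp del: of_nat_Suc)
      finally show "coeff (pderiv q) i = coeff p i" .
    qed
    have q': "weak_deriv (\<lambda>x. poly q (of_real x)) (\<lambda>x. poly p (of_real x))"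
      using weak_deriv_smooth[OF smooth_poly(1)[of q]] smooth_poly(2)[of 1 q] by (simp add: pq)
    have qL: "(\<lambda>x. poly q (of_real x)) \<in> L1" by (rule smooth_L1[OF smooth_poly(1)])
    have "u (vderiv z) - reg (\<lambda>x. poly q (of_real x)) (vderiv z) = 0" if z: "z \<in> test_functions" for z
      using fun_cong[OF p(2), of z] fun_cong[OF weak_derivD(3)[OF q'], of z] z
      by (simp add: ddiff_apply) (metis minus_minus)
    then obtain c where c: "(\<lambda>z. u z - reg (\<lambda>x. poly q (of_real x)) z) = reg (\<lambda>x. c)"
      using ddiff_eq_0_const[of "\<lambda>z. u z - reg (\<lambda>x. poly q (of_real x)) z"]
      by (metis Suc.prems(1) qL test_linear_reg test_linear_sub)
    have "u z = reg (\<lambda>x. poly (q + [:c:]) (of_real x)) z" for z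
      using fun_cong[OF c, of z] integrable_mult_test[OF qL, of z]
        integrable_mult_test[OF L1_const, of z c]
        test_linearD(1)[OF Suc.prems(1), of z]
      by (cases "z \<in> test_functions") (auto simp: reg_apply reg_outside ring_distribs diff_eq_eq)
    moreover have "coeff (q + [:c:]) i = 0" if "i \<ge> Suc d" for i
      using that by (cases i) (auto simp: q_def coeff_sum)
    ultimately show ?case by blast
  qed
  then show ?thesis using that by blast
qed

section \<open>Distributions as sums of derivatives, and density of the test functions\<close>

lemma W1_wderiv:
  assumes "f \<in> W1 i" "j \<le> i"
  shows "wderiv j f \<in> L1" and "reg (wderiv j f) = (ddiff ^^ j) (reg f)"
proof -
  obtain g where "g \<in> L1" "(ddiff ^^ j) (reg f) = reg g" using assms by (auto simp: W1_def)
  then show "wderiv j f \<in> L1" and "reg (wderiv j f) = (ddiff ^^ j) (reg f)"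
    using density_reg[of g] by (simp_all add: wderiv_def)
qed

lemma W1_weak_deriv:
  assumes "f \<in> W1 i" "j < i"
  shows "weak_deriv (wderiv j f) (wderiv (Suc j) f)"
  unfolding weak_deriv_def using W1_wderiv[OF assms(1), of j] W1_wderiv[OF assms(1), of "Suc j"] assms(2)
  by auto

text \<open>The values of \<open>wderiv\<close> are chosen; an explicit chain of weak derivatives
  determines them a.e.\<close>

lemma chain_W1:
  assumes G: "\<And>j. j < d \<Longrightarrow> weak_deriv (G j) (G (Suc j))" and L: "G 0 \<in> L1"
  shows "G 0 \<in> W1 d" and "j \<le> d \<Longrightarrow> AE x in leb01. wderiv j (G 0) x = G j x"
proof -
  have L': "G j \<in> L1" if "j \<le> d" for j
    using that L weak_derivD(2)[OF G[of "j - 1"]] by (cases j) auto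
  show "G 0 \<in> W1 d"
    using L L' ddiff_funpow_chain[of d G, OF G] by (auto simp: W1_def intro!: imageI)
  show "AE x in leb01. wderiv j (G 0) x = G j x" if "j \<le> d"
    unfolding wderiv_def using ddiff_funpow_chain[of d G, OF G that] density_reg(3)[OF L'[OF that]] by simp
qed

lemma prim_funpow_L1: "f \<in> L1 \<Longrightarrow> (prim ^^ k) f \<in> L1"
  by (induction k) (auto intro: prim_L1)

lemma weak_deriv_prim_funpow: "f \<in> L1 \<Longrightarrow> weak_deriv ((prim ^^ Suc k) f) ((prim ^^ k) f)"
  by (simp add: weak_deriv_prim0 prim_funpow_L1)

text \<open>The form in which the parameters of the theorem represent a coefficient. The signs
  cancel those of \<open>ddiff\<close>, so that the value at \<open>z\<close> is the sum of the
  integrals of \<open>t i\<close> times the i-th derivative of \<open>z\<close>.\<close>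

definition dsum :: "nat \<Rightarrow> (nat \<Rightarrow> real \<Rightarrow> complex) \<Rightarrow> functional" where
  "dsum d t = (\<lambda>z. \<Sum>i\<le>d. (-1) ^ i * (ddiff ^^ i) (reg (t i)) z)"

text \<open>An integrable d-th antiderivative of \<open>dsum d t\<close>: the i-th term already
  carries i derivatives, so it is integrated d - i times.\<close>

definition dsum_primitive :: "nat \<Rightarrow> (nat \<Rightarrow> real \<Rightarrow> complex) \<Rightarrow> real \<Rightarrow> complex" where
  "dsum_primitive d t = (\<lambda>x. \<Sum>i\<le>d. (-1) ^ i * (prim ^^ (d - i)) (t i) x)"

lemma minus_one_power_mult_self: "(-1) ^ k * ((-1) ^ k * (a::complex)) = a"
  by (simp add: mult.assoc[symmetric] power_add[symmetric])

lemma dsum_apply: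
  "z \<in> test_functions \<Longrightarrow> dsum d t z = (\<Sum>i\<le>d. int01 (\<lambda>x. t i x * (vderiv ^^ i) z x))"
  by (simp add: dsum_def ddiff_funpow_reg_apply minus_one_power_mult_self)

lemma test_linear_dsum:
  "(\<And>i. i \<le> d \<Longrightarrow> t i \<in> L1) \<Longrightarrow> test_linear (dsum d t)"
  unfolding dsum_def by (intro test_linear_setsum test_linear_cmult test_linear_ddiff_funpow test_linear_reg) auto

lemma dsum_primitive_L1:
  "(\<And>i. i \<le> d \<Longrightarrow> t i \<in> L1) \<Longrightarrow> dsum_primitive d t \<in> L1"
  unfolding dsum_primitive_def by (intro L1_sum L1_cmult prim_funpow_L1) auto

lemma minus_one_power_diff: "i \<le> d \<Longrightarrow> (-1) ^ (d - i) = (-1) ^ d * (-1 :: complex) ^ i"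
  by (metis le_add_diff_inverse minus_one_power_mult_self mult.commute power_add)

text \<open>Each integration by parts removes one \<open>prim\<close> from \<open>t\<close> and goes
  one step down the chain \<open>H\<close>.\<close>

lemma integral_prim_funpow_chain:
  assumes t: "t \<in> L1" and i: "i \<le> d"
    and H: "\<And>j. j < d \<Longrightarrow> weak_deriv (H j) (H (Suc j))"
    and ab: "0 < a" "a < b" "b < 1"
    and out: "\<And>j x. j \<le> d \<Longrightarrow> x \<notin> {a<..<b} \<Longrightarrow> H j x = 0"
  shows "int01 (\<lambda>x. (prim ^^ (d - i)) t x * H d x)
       = (-1) ^ (d - i) * int01 (\<lambda>x. t x * H i x)"
proof -
  have "int01 (\<lambda>x. (prim ^^ (d - i - 0)) t x * H (i + (d - i)) x)
     = (-1) ^ (d - i) * int01 (\<lambda>x. (prim ^^ (d - i - (d - i))) t x * H (i + 0) x)"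
  proof (rule weak_integration_by_parts_iter[where S="\<lambda>j. (prim ^^ (d - i - j)) t" and H="\<lambda>j. H (i + j)"])
    show "weak_deriv ((prim ^^ (d - i - j)) t) ((prim ^^ (d - i - Suc j)) t)" if "j < d - i" for j
      using weak_deriv_prim_funpow[OF t, of "d - i - Suc j"] that by (simp add: Suc_diff_Suc)
  qed (use H out i ab in auto)
  then show ?thesis using i by simp
qed

lemma L1_mult_chain:
  assumes t: "t \<in> L1" and G: "\<And>p. p \<le> j \<Longrightarrow> weak_deriv (G p) (G (Suc p))" and z: "smooth z"
  shows "(\<lambda>x. t x * leibniz G z j x) \<in> L1"
  by (rule L1_mult_weak[OF t weak_deriv_leibniz[where G=G and j=j and z=z]]) (use G z in auto)

text \<open>The i-th term takes d - i integrations by parts, and the signs (-1)^d, (-1)^i and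
  (-1)^(d-i) multiply to 1.\<close>

lemma dsum_eq_ddiff:
  assumes t: "\<And>i. i \<le> d \<Longrightarrow> t i \<in> L1"
  shows "dsum d t = (ddiff ^^ d) (reg (dsum_primitive d t))"
proof (rule test_linear_eqI)
  show "test_linear (dsum d t)" by (rule test_linear_dsum[OF t])
  show "test_linear ((ddiff ^^ d) (reg (dsum_primitive d t)))"
    by (intro test_linear_ddiff_funpow test_linear_reg dsum_primitive_L1 t)
  fix z assume z: "z \<in> test_functions"
  obtain a b where ab: "0 < a" "a < b" "b < 1" "\<And>k x. x \<notin> {a<..<b} \<Longrightarrow> (vderiv ^^ k) z x = 0"
    using test_support[OF z] by metis
  have i: "(\<lambda>x. (prim ^^ (d - i)) (t i) x * (vderiv ^^ d) z x) \<in> L1" if "i \<le> d" for i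
    by (intro L1_mult_test prim_funpow_L1 t that test_vderiv z)
  have "(ddiff ^^ d) (reg (dsum_primitive d t)) z
      = (-1) ^ d * int01 (\<lambda>x. \<Sum>i\<le>d. (-1) ^ i * ((prim ^^ (d - i)) (t i) x * (vderiv ^^ d) z x))"
    using z by (simp add: ddiff_funpow_reg_apply dsum_primitive_def sum_distrib_right mult.assoc)
  also have "\<dots> = (-1) ^ d * (\<Sum>i\<le>d. (-1) ^ i * int01 (\<lambda>x. (prim ^^ (d - i)) (t i) x * (vderiv ^^ d) z x))"
    using i by (subst Bochner_Integration.integral_sum) (auto simp: L1_def)
  also have "\<dots> = (\<Sum>i\<le>d. int01 (\<lambda>x. t i x * (vderiv ^^ i) z x))"
    unfolding sum_distrib_left
  proof (intro sum.cong refl)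
    fix i assume "i \<in> {..d}"
    then have id: "i \<le> d" by simp
    have "int01 (\<lambda>x. (prim ^^ (d - i)) (t i) x * (vderiv ^^ d) z x)
       = (-1) ^ (d - i) * int01 (\<lambda>x. t i x * (vderiv ^^ i) z x)"
      using id weak_deriv_smooth[OF smooth_vderiv[OF test_smooth[OF z]]]
      by (intro integral_prim_funpow_chain[where H="\<lambda>j. (vderiv ^^ j) z", OF t id _ ab]) auto
    then show "(-1) ^ d * ((-1) ^ i * int01 (\<lambda>x. (prim ^^ (d - i)) (t i) x * (vderiv ^^ d) z x))
      = int01 (\<lambda>x. t i x * (vderiv ^^ i) z x)"
      by (simp add: minus_one_power_diff[OF id] mult.assoc mult.left_commute[of "(-1) ^ i" "(-1) ^ d"]
          minus_one_power_mult_self)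
  qed
  finally show "dsum d t z = (ddiff ^^ d) (reg (dsum_primitive d t)) z"
    using z by (simp add: dsum_apply)
qed

lemma ddiff_funpow_diff:
  assumes "test_linear u" "test_linear v"
  shows "(ddiff ^^ k) (\<lambda>z. u z - v z) = (\<lambda>z. (ddiff ^^ k) u z - (ddiff ^^ k) v z)"
  using assms by (intro test_linear_eqI test_linear_ddiff_funpow test_linear_sub)
    (auto simp: ddiff_funpow_apply right_diff_distrib)

lemma equal_primitives_poly:
  assumes u: "test_linear u" and v: "test_linear v" and eq: "(ddiff ^^ d) u = (ddiff ^^ d) v"
  obtains p where "\<And>i. d \<le> i \<Longrightarrow> coeff p i = 0" "u = (\<lambda>z. v z + reg (\<lambda>x. poly p (of_real x)) z)"
proof -
  have "(ddiff ^^ d) (\<lambda>z. u z - v z) = (\<lambda>z. 0)" using ddiff_funpow_diff[OF u v, of d] eq by simp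
  from ddiff_funpow_eq_0_poly[OF test_linear_sub[OF u v] this]
  obtain p where p: "\<And>i. d \<le> i \<Longrightarrow> coeff p i = 0" "(\<lambda>z. u z - v z) = reg (\<lambda>x. poly p (of_real x))"
    by metis
  have "u z = v z + reg (\<lambda>x. poly p (of_real x)) z" for z
    using fun_cong[OF p(2), of z] by (simp only: diff_eq_eq add.commute)
  then have "u = (\<lambda>z. v z + reg (\<lambda>x. poly p (of_real x)) z)" by blast
  with p(1) show ?thesis by (rule that)
qed

text \<open>\<open>dmul\<close> works with an unknown \<sigma>, which differs from
  \<open>dsum_primitive d t\<close> by a polynomial of degree below d. Against the d-th derivative
  of a compactly supported function this polynomial contributes nothing, and the rest is integrated
  by parts term by term.\<close>

lemma dmul_dsum:
  assumes t: "\<And>i. i \<le> d \<Longrightarrow> t i \<in> L1"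
    and G: "\<And>j. j \<le> d \<Longrightarrow> weak_deriv (G j) (G (Suc j))"
    and z: "z \<in> test_functions"
  shows "dmul d (dsum d t) (G 0) z = (\<Sum>i\<le>d. int01 (\<lambda>x. t i x * leibniz G z i x))"
proof -
  define \<sigma>0 where "\<sigma>0 = dsum_primitive d t"
  have \<sigma>0: "\<sigma>0 \<in> L1" "dsum d t = (ddiff ^^ d) (reg \<sigma>0)"
    using dsum_primitive_L1[OF t] dsum_eq_ddiff[OF t] by (auto simp: \<sigma>0_def)
  define \<sigma> where "\<sigma> = (SOME \<sigma>. \<sigma> \<in> L1 \<and> dsum d t = (ddiff ^^ d) (reg \<sigma>))"
  have \<sigma>: "\<sigma> \<in> L1" "dsum d t = (ddiff ^^ d) (reg \<sigma>)"
    using someI[of "\<lambda>\<sigma>. \<sigma> \<in> L1 \<and> dsum d t = (ddiff ^^ d) (reg \<sigma>)" \<sigma>0] \<sigma>0 by (auto simp: \<sigma>_def)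
  obtain p where p: "\<And>i. d \<le> i \<Longrightarrow> coeff p i = 0"
    "reg \<sigma> = (\<lambda>z. reg \<sigma>0 z + reg (\<lambda>x. poly p (of_real x)) z)"
    using equal_primitives_poly[OF test_linear_reg[OF \<sigma>(1)] test_linear_reg[OF \<sigma>0(1)], of d] \<sigma> \<sigma>0 by metis
  have pL: "(\<lambda>x. poly p (of_real x)) \<in> L1" by (rule smooth_L1[OF smooth_poly(1)])
  have "reg \<sigma> = reg (\<lambda>x. \<sigma>0 x + poly p (of_real x))"
  proof
    fix z show "reg \<sigma> z = reg (\<lambda>x. \<sigma>0 x + poly p (of_real x)) z"
      using fun_cong[OF p(2), of z] integrable_mult_test[OF \<sigma>0(1)] integrable_mult_test[OF pL]
      by (cases "z \<in> test_functions") (auto simp: reg_apply reg_outside ring_distribs)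
  qed
  then have \<sigma>_eq: "AE x in leb01. \<sigma> x = \<sigma>0 x + poly p (of_real x)"
    by (intro fundamental_lemma \<sigma> L1_add \<sigma>0 pL)
  define H where "H = leibniz G z"
  have H: "weak_deriv (H j) (H (Suc j))" if "j \<le> d" for j
    unfolding H_def using that by (intro weak_deriv_leibniz G test_smooth z) auto
  have H0: "H 0 = (\<lambda>t. G 0 t * z t)" by (simp add: H_def leibniz_def)
  obtain a b where ab: "0 < a" "a < b" "b < 1" "\<And>k x. x \<notin> {a<..<b} \<Longrightarrow> (vderiv ^^ k) z x = 0"
    using test_support[OF z] by metis
  have out: "H j x = 0" if "x \<notin> {a<..<b}" for j x
    using ab(4)[OF that] by (simp add: H_def leibniz_def)
  have wd: "AE x in leb01. wderiv d (\<lambda>t. G 0 t * z t) x = H d x"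
    using chain_W1(2)[of d H d] H weak_derivD(1)[OF H[of 0]] by (simp add: H0)
  have tH: "(\<lambda>x. f x * H d x) \<in> L1" if "f \<in> L1" for f
    using L1_mult_weak[OF that H[of d]] by simp
  have iH: "(\<lambda>x. (prim ^^ (d - i)) (t i) x * H d x) \<in> L1" if "i \<le> d" for i
    by (intro tH prim_funpow_L1 t that)
  have ae: "AE x in leb01. \<sigma>0 x * H d x + poly p (of_real x) * H d x = \<sigma> x * wderiv d (\<lambda>t. G 0 t * z t) x"
    using wd \<sigma>_eq by eventually_elim (simp add: ring_distribs)
  have L: "(\<lambda>x. \<sigma>0 x * H d x + poly p (of_real x) * H d x) \<in> L1"
    by (intro L1_add tH \<sigma>0 pL)
  have "int01 (\<lambda>x. \<sigma> x * wderiv d (\<lambda>t. G 0 t * z t) x)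
     = int01 (\<lambda>x. \<sigma>0 x * H d x + poly p (of_real x) * H d x)"
    using L1_measurable[OF L] L1_measurable[OF L1_AE_cong[OF L ae]] ae
    by (intro integral_cong_AE) (auto elim: eventually_mono)
  also have "\<dots> = int01 (\<lambda>x. \<sigma>0 x * H d x) + int01 (\<lambda>x. poly p (of_real x) * H d x)"
    by (intro Bochner_Integration.integral_add L1_integrable tH \<sigma>0 pL)
  \<comment> \<open>All d derivatives move onto a polynomial of degree below d.\<close>
  also have "int01 (\<lambda>x. poly p (of_real x) * H d x) = 0"
  proof -
    have "int01 (\<lambda>x. poly ((pderiv ^^ 0) p) (of_real x) * H d x)
        = (-1) ^ d * int01 (\<lambda>x. poly ((pderiv ^^ d) p) (of_real x) * H 0 x)"
      using weak_deriv_smooth[OF smooth_poly(1)] smooth_poly(2)[of 1] H out ab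
      by (intro weak_integration_by_parts_iter[where S="\<lambda>k x. poly ((pderiv ^^ k) p) (of_real x)"]) auto
    also have "(pderiv ^^ d) p = 0" by (rule pderiv_funpow_eq_0[OF p(1)])
    finally show ?thesis by simp
  qed
  also have "int01 (\<lambda>x. \<sigma>0 x * H d x)
     = int01 (\<lambda>x. \<Sum>i\<le>d. (-1) ^ i * ((prim ^^ (d - i)) (t i) x * H d x))"
    by (simp add: \<sigma>0_def dsum_primitive_def sum_distrib_right mult.assoc)
  also have "\<dots> = (\<Sum>i\<le>d. (-1) ^ i * int01 (\<lambda>x. (prim ^^ (d - i)) (t i) x * H d x))"
    using iH by (subst Bochner_Integration.integral_sum) (auto simp: L1_def)
  also have "\<dots> = (\<Sum>i\<le>d. (-1) ^ d * int01 (\<lambda>x. t i x * H i x))"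
  proof (intro sum.cong refl)
    fix i assume "i \<in> {..d}"
    then have id: "i \<le> d" by simp
    have "int01 (\<lambda>x. (prim ^^ (d - i)) (t i) x * H d x)
       = (-1) ^ (d - i) * int01 (\<lambda>x. t i x * H i x)"
      using id H out by (intro integral_prim_funpow_chain[OF t id _ ab(1-3)]) auto
    then show "(-1) ^ i * int01 (\<lambda>x. (prim ^^ (d - i)) (t i) x * H d x)
      = (-1) ^ d * int01 (\<lambda>x. t i x * H i x)"
      by (simp add: minus_one_power_diff[OF id] mult.assoc mult.left_commute[of "(-1) ^ i" "(-1) ^ d"]
          minus_one_power_mult_self)
  qed
  finally show ?thesis
    using z by (simp add: dmul_def \<sigma>_def[symmetric] H_def sum_distrib_left[symmetric] minus_one_power_mult_self)
qed

section \<open>Density of the test functions in \<open>L1\<close>\<close>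

definition test_approximable :: "(real \<Rightarrow> complex) \<Rightarrow> bool" where
  "test_approximable f \<longleftrightarrow> f \<in> L1 \<and>
     (\<forall>\<epsilon>>0. \<exists>H\<in>test_functions. int01 (\<lambda>x. norm (f x - H x)) < \<epsilon>)"

lemma L1_norm_triangle:
  assumes "f \<in> L1" "g \<in> L1" "h \<in> L1"
  shows "int01 (\<lambda>x. norm (f x - h x))
    \<le> int01 (\<lambda>x. norm (f x - g x)) + int01 (\<lambda>x. norm (g x - h x))"
proof -
  have "int01 (\<lambda>x. norm (f x - h x))
    \<le> int01 (\<lambda>x. norm (f x - g x) + norm (g x - h x))"
    using assms norm_triangle_ineq[of "f x - g x" "g x - h x" for x]
    by (intro integral_mono) (auto simp: L1_def)
  then show ?thesis using assms by (simp add: L1_def)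
qed

lemma test_L1: "z \<in> test_functions \<Longrightarrow> z \<in> L1"
  by (intro smooth_L1 test_smooth)

lemma test_approximable_close:
  assumes "f \<in> L1" and close: "\<And>\<epsilon>. \<epsilon> > 0 \<Longrightarrow> \<exists>g. test_approximable g \<and> int01 (\<lambda>x. norm (f x - g x)) < \<epsilon>"
  shows "test_approximable f"
  unfolding test_approximable_def
proof (intro conjI allI impI)
  fix \<epsilon> :: real assume "\<epsilon> > 0"
  then obtain g where g: "test_approximable g" "int01 (\<lambda>x. norm (f x - g x)) < \<epsilon>/2"
    using close[of "\<epsilon>/2"] by auto
  then obtain H where H: "H \<in> test_functions" "int01 (\<lambda>x. norm (g x - H x)) < \<epsilon>/2"
    using \<open>\<epsilon> > 0\<close> unfolding test_approximable_def by (meson half_gt_zero)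
  have "int01 (\<lambda>x. norm (f x - H x)) < \<epsilon>"
    using L1_norm_triangle[OF assms(1) _ test_L1[OF H(1)], of g] g H by (auto simp: test_approximable_def)
  then show "\<exists>H\<in>test_functions. int01 (\<lambda>x. norm (f x - H x)) < \<epsilon>" using H by blast
qed (rule assms)

lemma test_approximable_lim:
  assumes s: "\<And>i. test_approximable (s i)" and f: "f \<in> L1"
    and w: "integrable leb01 w" "\<And>i. AE x in leb01. norm (s i x) \<le> w x"
    and lim: "AE x in leb01. (\<lambda>i. s i x) \<longlonglongrightarrow> f x"
  shows "test_approximable f"
proof (rule test_approximable_close[OF f])
  fix \<epsilon> :: real assume \<epsilon>: "\<epsilon> > 0"
  have sL: "s i \<in> L1" for i using s by (simp add: test_approximable_def)
  have "(\<lambda>i. int01 (\<lambda>x. norm (f x - s i x))) \<longlonglongrightarrow> int01 (\<lambda>x. 0)"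
  proof (rule integral_dominated_convergence[where w="\<lambda>x. norm (f x) + w x"])
    show "integrable leb01 (\<lambda>x. norm (f x) + w x)" using f w by (simp add: L1_def)
    show "(\<lambda>x. norm (f x - s i x)) \<in> borel_measurable leb01" for i
      using L1_measurable[OF f] L1_measurable[OF sL[of i]] by measurable
    show "AE x in leb01. (\<lambda>i. norm (f x - s i x)) \<longlonglongrightarrow> 0"
      using lim
    proof eventually_elim
      case (elim x)
      have "(\<lambda>i. norm (f x - s i x)) \<longlonglongrightarrow> norm (f x - f x)" by (intro tendsto_intros elim)
      then show ?case by simp
    qed
    show "AE x in leb01. norm (norm (f x - s i x)) \<le> norm (f x) + w x" for i
      using w(2)[of i]
    proof eventually_elim
      case (elim x)
      then show ?case using norm_triangle_ineq4[of "f x" "s i x"] by simp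
    qed
  qed simp
  then have "\<forall>\<^sub>F i in sequentially. int01 (\<lambda>x. norm (f x - s i x)) < \<epsilon>"
    using \<epsilon> by (intro order_tendstoD) auto
  then show "\<exists>g. test_approximable g \<and> int01 (\<lambda>x. norm (f x - g x)) < \<epsilon>"
    using s by (meson eventually_happens sequentially_bot)
qed

lemma test_approximable_add:
  assumes "test_approximable f" "test_approximable g"
  shows "test_approximable (\<lambda>x. f x + g x)"
  unfolding test_approximable_def
proof (intro conjI allI impI)
  have L: "f \<in> L1" "g \<in> L1" using assms by (auto simp: test_approximable_def)
  then show "(\<lambda>x. f x + g x) \<in> L1" by (intro L1_add)
  fix \<epsilon> :: real assume \<epsilon>: "\<epsilon> > 0"
  obtain F where F: "F \<in> test_functions" "int01 (\<lambda>x. norm (f x - F x)) < \<epsilon>/2"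
    using assms(1) \<epsilon> unfolding test_approximable_def by (meson half_gt_zero)
  obtain G where G: "G \<in> test_functions" "int01 (\<lambda>x. norm (g x - G x)) < \<epsilon>/2"
    using assms(2) \<epsilon> unfolding test_approximable_def by (meson half_gt_zero)
  have "int01 (\<lambda>x. norm (f x + g x - (F x + G x)))
     \<le> int01 (\<lambda>x. norm (f x - F x) + norm (g x - G x))"
  proof (rule integral_mono)
    show "norm (f x + g x - (F x + G x)) \<le> norm (f x - F x) + norm (g x - G x)" for x
      using norm_triangle_ineq[of "f x - F x" "g x - G x"] by (simp add: algebra_simps)
  qed (use L test_L1[OF F(1)] test_L1[OF G(1)] in \<open>auto simp: L1_def\<close>)
  also have "\<dots> < \<epsilon>" using F G L test_L1[OF F(1)] test_L1[OF G(1)] by (simp add: L1_def)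
  finally show "\<exists>H\<in>test_functions. int01 (\<lambda>x. norm (f x + g x - H x)) < \<epsilon>"
    using test_add[OF F(1) G(1)] by (intro bexI[of _ "\<lambda>x. F x + G x"])
qed

lemma test_approximable_cmult:
  assumes "test_approximable f" shows "test_approximable (\<lambda>x. c * f x)"
  unfolding test_approximable_def
proof (intro conjI allI impI)
  have L: "f \<in> L1" using assms by (auto simp: test_approximable_def)
  then show "(\<lambda>x. c * f x) \<in> L1" by (intro L1_cmult)
  fix \<epsilon> :: real assume \<epsilon>: "\<epsilon> > 0"
  \<comment> \<open>The added 1 covers c = 0.\<close>
  have n: "0 < norm c + 1" by (simp add: add_nonneg_pos)
  obtain F where F: "F \<in> test_functions" "int01 (\<lambda>x. norm (f x - F x)) < \<epsilon> / (norm c + 1)"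
    using assms \<epsilon> n unfolding test_approximable_def by (meson divide_pos_pos)
  have "int01 (\<lambda>x. norm (c * f x - c * F x)) = norm c * int01 (\<lambda>x. norm (f x - F x))"
    by (simp add: right_diff_distrib[symmetric] norm_mult)
  also have "\<dots> \<le> (norm c + 1) * int01 (\<lambda>x. norm (f x - F x))"
    by (intro mult_right_mono) auto
  also have "\<dots> < \<epsilon>" using F(2) n by (simp add: field_simps)
  finally show "\<exists>H\<in>test_functions. int01 (\<lambda>x. norm (c * f x - H x)) < \<epsilon>"
    using test_cmult[OF F(1)] by (intro bexI[of _ "\<lambda>x. c * F x"])
qed

lemma test_approximable_test: "z \<in> test_functions \<Longrightarrow> test_approximable z"
  using test_L1 by (auto simp: test_approximable_def intro!: bexI[of _ z])

lemma test_approximable_sum: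
  "finite I \<Longrightarrow> (\<And>i. i \<in> I \<Longrightarrow> test_approximable (f i)) \<Longrightarrow> test_approximable (\<lambda>x. \<Sum>i\<in>I. f i x)"
  by (induction I rule: finite_induct) (auto intro: test_approximable_add test_approximable_test test_0)

lemma indicator_sets_L1: "A \<in> sets leb01 \<Longrightarrow> (indicator A :: real \<Rightarrow> complex) \<in> L1"
  using indicator_L1[OF L1_const[of 1], of A] by simp

text \<open>Open intervals are limits of bump functions, complements are differences from the
  constant 1, itself such a limit a.e., and disjoint unions are dominated limits of finite
  sums.\<close>

lemma test_approximable_indicator:
  assumes "A \<in> sets leb01"
  shows "test_approximable (indicator A)"
  using assms
proof (rule lebesgue_unit_induct)
  have ivl: "test_approximable (indicator {a<..<b})" if ab: "0 \<le> a" "a < b" "b \<le> 1" for a b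
  proof -
    obtain u where u: "\<And>k. u k \<in> test_functions" "\<And>k x. norm (u k x) \<le> 1"
      "\<And>x. (\<lambda>k. u k x) \<longlonglongrightarrow> indicator {a<..<b} x"
      using interval_bump[OF ab] by metis
    have "{a<..<b} \<in> sets leb01"
      using ab by (auto simp: sets_restrict_space intro!: image_eqI[of _ _ "{a<..<b}"])
    then have "(indicator {a<..<b} :: real \<Rightarrow> complex) \<in> L1" by (rule indicator_sets_L1)
    then show ?thesis
      by (rule test_approximable_lim[where s=u and w="\<lambda>_. 1", OF test_approximable_test[OF u(1)] _ _
          AE_I2[OF u(2)] AE_I2[OF u(3)]]) simp
  qed
  then show "test_approximable (indicator {a<..<b})" if "0 \<le> a" "a < b" "b \<le> 1" for a b using that .
  have AE_eq: "test_approximable g" if f: "test_approximable f" and ae: "AE x in leb01. f x = g x" for f g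
  proof (rule test_approximable_close)
    have L: "f \<in> L1" using f by (simp add: test_approximable_def)
    show Lg: "g \<in> L1" by (rule L1_AE_cong[OF L ae])
    have "int01 (\<lambda>x. norm (g x - f x)) = int01 (\<lambda>x. 0)"
      using L1_measurable[OF L1_diff[OF Lg L]] ae
      by (intro integral_cong_AE) (auto elim: eventually_mono)
    then show "\<exists>h. test_approximable h \<and> int01 (\<lambda>x. norm (g x - h x)) < \<epsilon>" if "\<epsilon> > 0" for \<epsilon>
      using that f by (intro exI[of _ f]) simp
  qed
  fix A B assume A: "test_approximable (indicator A)" and AB: "AE x in leb01. (x \<in> A) = (x \<in> B)"
  have "AE x in leb01. indicator A x = (indicator B x :: complex)"
    using AB by eventually_elim (simp add: indicator_def)
  then show "test_approximable (indicator B)" by (rule AE_eq[OF A])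
next
  have one: "test_approximable (\<lambda>x. 1)"
  proof -
    obtain u where u: "\<And>k. u k \<in> test_functions" "\<And>k x. norm (u k x) \<le> 1"
      "\<And>x. (\<lambda>k. u k x) \<longlonglongrightarrow> indicator {0<..<1::real} x"
      using interval_bump[of 0 1] by auto
    have "AE x in leb01. (\<lambda>k. u k x) \<longlonglongrightarrow> 1"
      using singleton_null_leb01[of 0] singleton_null_leb01[of 1] AE_space
    proof eventually_elim
      case (elim x)
      then show ?case using u(3)[of x] by auto
    qed
    from test_approximable_lim[where s=u and w="\<lambda>_. 1", OF test_approximable_test[OF u(1)] L1_const _
          AE_I2[OF u(2)] this]
    show ?thesis by simp
  qed
  fix A assume A: "A \<in> sets leb01" "test_approximable (indicator A)"
  have L: "{0..1} - A \<in> sets leb01" using sets.compl_sets[OF A(1)] by simp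
  have t: "test_approximable (\<lambda>x. 1 + (-1) * indicator A x)"
    by (intro test_approximable_add test_approximable_cmult one A)
  show "test_approximable (indicator ({0..1} - A))"
    by (rule test_approximable_lim[where s="\<lambda>_ x. 1 + (-1) * indicator A x" and w="\<lambda>_. 1", OF t])
      (use indicator_sets_L1[OF L] in \<open>auto simp: indicator_def\<close>)
next
  fix A :: "nat \<Rightarrow> real set"
  assume A: "disjoint_family A" "range A \<subseteq> sets leb01" "\<And>i. test_approximable (indicator (A i))"
  have sm: "(\<Sum>i<n. indicator (A i) x :: complex) = indicator (\<Union>i<n. A i) x" for n x
    using A(1) by (intro indicator_UN_disjoint[symmetric]) (auto simp: disjoint_family_on_def)
  show "test_approximable (indicator (\<Union>i. A i))"
  proof (rule test_approximable_lim[where s="\<lambda>n x. \<Sum>i<n. indicator (A i) x" and w="\<lambda>_. 1"])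
    show "test_approximable (\<lambda>x. \<Sum>i<n. indicator (A i) x)" for n
      by (intro test_approximable_sum A) auto
    show "indicator (\<Union>i. A i) \<in> L1" using A(2) by (intro indicator_sets_L1) auto
    have "(\<lambda>n. indicator (\<Union>i<n. A i) x :: complex) \<longlonglongrightarrow> indicator (\<Union>i. A i) x" for x
      by (rule LIMSEQ_indicator_UN)
    then show "AE x in leb01. (\<lambda>n. \<Sum>i<n. indicator (A i) x :: complex) \<longlonglongrightarrow> indicator (\<Union>i. A i) x"
      by (simp add: sm)
    show "AE x in leb01. norm (\<Sum>i<n. indicator (A i) x :: complex) \<le> 1" for n
      unfolding sm by (simp add: indicator_def)
  qed simp
qed

lemma test_functions_dense_L1:
  assumes "f \<in> L1" "\<epsilon> > 0"
  obtains H where "H \<in> test_functions" "int01 (\<lambda>x. norm (f x - H x)) < \<epsilon>"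
proof -
  have "integrable leb01 f" using assms by (simp add: L1_def)
  then have "test_approximable f"
  proof (induction rule: integrable_induct)
    case (base A c)
    have "test_approximable (\<lambda>x. c * indicator A x)"
      by (intro test_approximable_cmult test_approximable_indicator base)
    also have "(\<lambda>x. c * indicator A x) = (\<lambda>x. indicator A x *\<^sub>R c)"
      by (auto simp: indicator_def)
    finally show ?case .
  next
    case (add f g)
    then show ?case by (intro test_approximable_add)
  next
    case (lim f s)
    show ?case
    proof (rule test_approximable_lim[where s=s and w="\<lambda>x. 2 * norm (f x)"])
      show "test_approximable (s i)" for i by (rule lim)
      show "f \<in> L1" using lim by (simp add: L1_def)
      show "integrable leb01 (\<lambda>x. 2 * norm (f x))" using lim by simp
      show "AE x in leb01. norm (s i x) \<le> 2 * norm (f x)" for i by (intro AE_I2 lim)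
      show "AE x in leb01. (\<lambda>i. s i x) \<longlonglongrightarrow> f x" by (intro AE_I2 lim)
    qed
  qed
  then show ?thesis using assms that by (auto simp: test_approximable_def)
qed

section \<open>Linear integral equations\<close>

lemma prim_power_L1: "g \<in> L1 \<Longrightarrow> (\<lambda>t. g t * prim g t ^ q) \<in> L1"
proof (induction q)
  case (Suc q)
  from L1_mult_prim[OF Suc.IH[OF Suc.prems] Suc.prems] show ?case by (simp add: mult_ac)
qed simp

text \<open>Induction with the product rule \<open>prim_mult\<close>. It is the source of the
  factorials in the iteration for linear systems.\<close>

lemma prim_power:
  assumes g: "g \<in> L1"
  shows "prim g x ^ Suc q = of_nat (Suc q) * prim (\<lambda>t. g t * prim g t ^ q) x"
proof (induction q arbitrary: x)
  case (Suc q)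
  define h where "h t = of_nat (Suc q) * (g t * prim g t ^ q)" for t
  have h: "h \<in> L1" unfolding h_def by (intro L1_cmult prim_power_L1 g)
  have ph: "prim h y = prim g y ^ Suc q" for y
    using Suc.IH[of y] by (simp only: h_def[abs_def] prim_cmult)
  have "prim g x ^ Suc (Suc q) = prim g x * prim h x" by (simp add: ph)
  also have "\<dots> = prim (\<lambda>t. g t * prim h t + prim g t * h t) x" by (rule prim_mult[OF g h])
  also have "(\<lambda>t. g t * prim h t + prim g t * h t) = (\<lambda>t. of_nat (Suc (Suc q)) * (g t * prim g t ^ Suc q))"
    by (simp add: ph h_def algebra_simps)
  finally show ?case by (simp only: prim_cmult)
qed simp

lemma prim_of_real:
  "prim (\<lambda>t. of_real (g t)) x = of_real (int01 (\<lambda>t. indicator {..x} t * g t))"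
proof -
  have "(\<lambda>t. indicator {..x} t * of_real (g t) :: complex) = (\<lambda>t. of_real (indicator {..x} t * g t))"
    by (auto simp: indicator_def)
  then show ?thesis unfolding prim_def by (simp only: integral_complex_of_real)
qed

text \<open>Picard iteration for a Volterra system with integrable coefficients; starting from the
  primitives of \<open>b\<close>, the iterates decay factorially. \<open>C\<close> is chosen before
  \<open>b\<close>: the approximation of the domain rests on a bound uniform in the forcing.\<close>

lemma linear_system:
  fixes A :: "nat \<Rightarrow> nat \<Rightarrow> real \<Rightarrow> complex" and N :: nat
  assumes A: "\<And>k j. k < N \<Longrightarrow> j < N \<Longrightarrow> A k j \<in> L1"
  shows "\<exists>C>0. \<forall>b. (\<forall>k<N. b k \<in> L1) \<longrightarrow> (\<exists>V. \<forall>k<N.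
      (\<forall>x. norm (V k x) \<le> C * (\<Sum>k<N. int01 (\<lambda>t. norm (b k t)))) \<and>
      (\<lambda>t. (\<Sum>j<N. A k j t * V j t) + b k t) \<in> L1 \<and>
      (\<forall>x. V k x = prim (\<lambda>t. (\<Sum>j<N. A k j t * V j t) + b k t) x))"
proof -
  \<comment> \<open>One scalar majorant for all entries. Its primitive \<open>p\<close> takes the
    place of the independent variable in the estimates, and \<open>exp B\<close> becomes the
    constant.\<close>
  define g where "g t = (\<Sum>k<N. \<Sum>j<N. norm (A k j t))" for t
  have g_nonneg: "g t \<ge> 0" for t by (simp add: g_def sum_nonneg)
  have g_int: "integrable leb01 g" unfolding g_def
    by (intro Bochner_Integration.integrable_sum integrable_norm L1_integrable A) auto
  then have gL: "(\<lambda>t. of_real (g t)) \<in> L1" by (simp add: L1_def)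
  define p where "p x = int01 (\<lambda>t. indicator {..x} t * g t)" for x
  define B where "B = int01 g"
  have prim_g: "prim (\<lambda>t. of_real (g t)) x = of_real (p x)" for x
    by (simp only: prim_of_real p_def)
  have ind_int: "integrable leb01 (\<lambda>t. indicator {..x} t * f t)" if "integrable leb01 f" for f :: "real \<Rightarrow> real" and x
  proof -
    have "(\<lambda>t. indicator {..x} t * of_real (f t)) \<in> L1"
      using that by (intro borel_indicator_L1) (auto simp: L1_def)
    also have "(\<lambda>t. indicator {..x} t * of_real (f t)) = (\<lambda>t. complex_of_real (indicator {..x} t * f t))"
      by (auto simp: indicator_def)
    finally have "integrable leb01 (\<lambda>t. complex_of_real (indicator {..x} t * f t))"
      by (rule L1_integrable)
    then show ?thesis by (subst (asm) complex_of_real_integrable_eq)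
  qed
  have p_bounds: "0 \<le> p x" "p x \<le> B" for x
    unfolding p_def B_def using g_nonneg g_int ind_int[OF g_int]
    by (auto intro!: integral_nonneg_AE integral_mono AE_I2 simp: indicator_def)
  have gp_int: "integrable leb01 (\<lambda>t. g t * p t ^ q)" for q
  proof -
    have "integrable leb01 (\<lambda>t. complex_of_real (g t * p t ^ q))"
      using prim_power_L1[OF gL, of q] by (simp add: prim_g L1_def)
    then show ?thesis by (subst (asm) complex_of_real_integrable_eq)
  qed
  have p_power: "p x ^ Suc q = real (Suc q) * int01 (\<lambda>t. indicator {..x} t * (g t * p t ^ q))" for x q
  proof -
    have "complex_of_real (p x ^ Suc q) = of_nat (Suc q) * prim (\<lambda>t. of_real (g t * p t ^ q)) x"
      using prim_power[OF gL, of x q] by (simp only: prim_g of_real_power[symmetric] of_real_mult[symmetric])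
    also have "\<dots> = of_real (real (Suc q) * int01 (\<lambda>t. indicator {..x} t * (g t * p t ^ q)))"
      by (subst prim_of_real) simp
    finally show ?thesis by (simp only: of_real_eq_iff)
  qed
  show ?thesis
  proof (intro exI[of _ "exp B"] conjI allI impI)
    fix b :: "nat \<Rightarrow> real \<Rightarrow> complex" assume "\<forall>k<N. b k \<in> L1"
    then have b: "\<And>k. k < N \<Longrightarrow> b k \<in> L1" by blast
    define \<beta> where "\<beta> = (\<Sum>k<N. int01 (\<lambda>t. norm (b k t)))"
    \<comment> \<open>\<open>D q\<close> is the q-th term of the Neumann series, the integral
      operator applied q times to the primitives of \<open>b\<close>.\<close>
    define D where "D = rec_nat (\<lambda>k. prim (b k)) (\<lambda>q f k. prim (\<lambda>t. \<Sum>j<N. A k j t * f j t))"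
    have D0: "D 0 k = prim (b k)" and DS: "D (Suc q) k = prim (\<lambda>t. \<Sum>j<N. A k j t * D q j t)" for q k
      by (auto simp: D_def)
    have DL: "\<forall>k<N. D q k \<in> borel_measurable leb01 \<and> (\<forall>j<N. (\<lambda>t. A j k t * D q k t) \<in> L1)" for q
    proof (induction q)
      case 0
      then show ?case using b A by (auto simp: D0 intro!: prim_measurable L1_mult_prim)
    next
      case (Suc q)
      then show ?case using A by (auto simp: DS intro!: prim_measurable L1_mult_prim L1_sum)
    qed
    \<comment> \<open>Summed over the components, one application of the operator amounts to
      multiplying by \<open>g\<close> and integrating; as \<open>g\<close> is the derivative of
      \<open>p\<close>, this turns p^q / q! into p^(q+1) / (q+1)!.\<close>
    have bnd: "(\<Sum>k<N. norm (D q k x)) \<le> \<beta> * p x ^ q / fact q" for q x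
    proof (induction q arbitrary: x)
      case 0
      then show ?case using b prim_norm_le by (auto simp: D0 \<beta>_def intro!: sum_mono)
    next
      case (Suc q)
      have int: "integrable leb01 (\<lambda>t. (\<Sum>j<N. norm (A k j t)) * p t ^ q)" if that: "k < N" for k
      proof (rule Bochner_Integration.integrable_bound[OF gp_int[of q]])
        have "(\<lambda>t. complex_of_real (p t)) \<in> borel_measurable leb01"
          using prim_measurable[OF gL] unfolding ext[of "prim (\<lambda>t. of_real (g t))", OF prim_g] .
        then have "(\<lambda>t. Re (complex_of_real (p t))) \<in> borel_measurable leb01" by measurable
        then have "p \<in> borel_measurable leb01" by simp
        then show "(\<lambda>t. (\<Sum>j<N. norm (A k j t)) * p t ^ q) \<in> borel_measurable leb01"
          using A[OF that, THEN L1_measurable] by (intro borel_measurable_times borel_measurable_sum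
              borel_measurable_power borel_measurable_norm) auto
        have "(\<Sum>j<N. norm (A k j t)) \<le> g t" for t
          unfolding g_def using that by (intro member_le_sum[of k "{..<N}" "\<lambda>k. \<Sum>j<N. norm (A k j t)"])
            (auto intro: sum_nonneg)
        then show "AE t in leb01. norm ((\<Sum>j<N. norm (A k j t)) * p t ^ q) \<le> norm (g t * p t ^ q)"
          using p_bounds g_nonneg
          by (intro AE_I2) (auto simp: abs_mult sum_nonneg intro!: mult_right_mono)
      qed
      have k: "norm (D (Suc q) k x) \<le>
          int01 (\<lambda>t. indicator {..x} t * (\<beta> / fact q * ((\<Sum>j<N. norm (A k j t)) * p t ^ q)))"
        (is "_ \<le> int01 (?R k)") if "k < N" for k
      proof -
        have L: "(\<lambda>t. \<Sum>j<N. A k j t * D q j t) \<in> L1" using DL that by (intro L1_sum) auto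
        have "norm (D (Suc q) k x) \<le> int01 (\<lambda>t. norm (indicator {..x} t * (\<Sum>j<N. A k j t * D q j t)))"
          unfolding DS prim_def by (rule integral_norm_bound)
        also have "\<dots> \<le> int01 (?R k)"
        proof (rule integral_mono)
          show "integrable leb01 (\<lambda>t. norm (indicator {..x} t * (\<Sum>j<N. A k j t * D q j t)))"
            by (intro integrable_norm L1_integrable borel_indicator_L1 L) simp
          show "integrable leb01 (?R k)" by (intro ind_int integrable_mult_right int that)
          fix t
          have "norm (\<Sum>j<N. A k j t * D q j t) \<le> (\<Sum>j<N. norm (A k j t) * (\<beta> * p t ^ q / fact q))"
          proof (rule order_trans[OF norm_sum sum_mono])
            fix j assume "j \<in> {..<N}"
            then have "norm (D q j t) \<le> (\<Sum>k<N. norm (D q k t))"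
              by (intro member_le_sum) auto
            also note Suc.IH[of t]
            finally show "norm (A k j t * D q j t) \<le> norm (A k j t) * (\<beta> * p t ^ q / fact q)"
              unfolding norm_mult by (rule mult_left_mono) simp
          qed
          also have "\<dots> = \<beta> / fact q * ((\<Sum>j<N. norm (A k j t)) * p t ^ q)"
            by (simp add: sum_distrib_right sum_distrib_left field_simps)
          finally show "norm (indicator {..x} t * (\<Sum>j<N. A k j t * D q j t)) \<le> ?R k t"
            by (auto simp: indicator_def)
        qed
        finally show ?thesis .
      qed
      have Rint: "integrable leb01 (?R k)" if "k < N" for k
        by (intro ind_int integrable_mult_right int that)
      have "(\<Sum>k<N. norm (D (Suc q) k x)) \<le> (\<Sum>k<N. int01 (?R k))"
        using k by (intro sum_mono) auto
      also have "\<dots> = int01 (\<lambda>t. \<Sum>k<N. ?R k t)"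
        using Rint by (intro Bochner_Integration.integral_sum[symmetric]) auto
      also have "(\<lambda>t. \<Sum>k<N. ?R k t) = (\<lambda>t. \<beta> / fact q * (indicator {..x} t * (g t * p t ^ q)))"
        by (simp only: sum_distrib_left[symmetric] sum_distrib_right[symmetric] g_def
            mult.left_commute[of "indicator _ _"])
      also have "int01 \<dots> = \<beta> / fact q * int01 (\<lambda>t. indicator {..x} t * (g t * p t ^ q))"
        by (rule integral_mult_right_zero)
      also have "\<dots> = \<beta> * p x ^ Suc q / fact (Suc q)"
      proof -
        have "\<beta> / fact q * I = \<beta> * (real (Suc q) * I) / fact (Suc q)" for I :: real
          by (simp del: of_nat_Suc)
        then show ?thesis unfolding p_power .
      qed
      finally show ?case .
    qed
    have \<beta>_nonneg: "\<beta> \<ge> 0" by (auto simp: \<beta>_def intro!: sum_nonneg)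
    have Dle: "norm (D q k x) \<le> \<beta> * (B ^ q / fact q)" if "k < N" for q k x
    proof -
      have "norm (D q k x) \<le> (\<Sum>k<N. norm (D q k x))" using that by (intro member_le_sum) auto
      also have "\<dots> \<le> \<beta> * p x ^ q / fact q" by (rule bnd)
      also have "\<dots> \<le> \<beta> * (B ^ q / fact q)"
        using p_bounds[of x] \<beta>_nonneg
        by (auto intro!: mult_left_mono divide_right_mono power_mono simp flip: times_divide_eq_right)
      finally show ?thesis .
    qed
    have exp_sums: "(\<lambda>q. \<beta> * (B ^ q / fact q)) sums (\<beta> * exp B)"
      using exp_converges[of B] by (intro sums_mult) (simp add: field_simps)
    have summ: "summable (\<lambda>q. norm (D q k x))" if "k < N" for k x
      by (rule summable_comparison_test'[OF sums_summable[OF exp_sums], of 0]) (use Dle[OF that] in auto)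
    define V where "V k x = (\<Sum>q. D q k x)" for k x
    have Vm: "V k \<in> borel_measurable leb01" if "k < N" for k
      unfolding V_def[abs_def] using DL that by (intro borel_measurable_suminf) auto
    have Vb: "norm (V k x) \<le> exp B * \<beta>" if "k < N" for k x
    proof -
      have "norm (V k x) \<le> (\<Sum>q. norm (D q k x))" unfolding V_def by (rule summable_norm[OF summ[OF that]])
      also have "\<dots> \<le> (\<Sum>q. \<beta> * (B ^ q / fact q))"
        by (intro suminf_le summ that sums_summable[OF exp_sums] Dle)
      also have "\<dots> = exp B * \<beta>" using sums_unique[OF exp_sums] by (simp only: mult.commute)
      finally show ?thesis .
    qed
    have AV: "(\<lambda>t. A k j t * V j t) \<in> L1" if "k < N" "j < N" for k j
      using that Vb by (intro L1_mult_bounded[where C="exp B * \<beta>"] A Vm) auto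
    have L: "(\<lambda>t. \<Sum>j<N. A k j t * V j t) \<in> L1" if "k < N" for k
      using AV that by (intro L1_sum) auto
    have eq: "V k x = prim (\<lambda>t. (\<Sum>j<N. A k j t * V j t) + b k t) x" if k: "k < N" for k x
    proof -
      \<comment> \<open>The recursion for the terms adds up to the integral equation once series and
        integral are exchanged; the majorant is the norm of the k-th row times the exponential
        series.\<close>
      define T where "T q t = indicator {..x} t * (\<Sum>j<N. A k j t * D q j t)" for q t
      have TL: "T q \<in> L1" for q
        unfolding T_def using DL k by (intro borel_indicator_L1 L1_sum) auto
      have Tn: "norm (T q t) \<le> (\<Sum>j<N. norm (A k j t)) * (\<beta> * (B ^ q / fact q))" for q t
      proof -
        have "norm (T q t) \<le> norm (\<Sum>j<N. A k j t * D q j t)" by (simp add: T_def indicator_def)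
        also have "\<dots> \<le> (\<Sum>j<N. norm (A k j t) * (\<beta> * (B ^ q / fact q)))"
        proof (rule order_trans[OF norm_sum sum_mono])
          fix j assume "j \<in> {..<N}"
          then show "norm (A k j t * D q j t) \<le> norm (A k j t) * (\<beta> * (B ^ q / fact q))"
            unfolding norm_mult by (intro mult_left_mono Dle) auto
        qed
        finally show ?thesis by (simp only: sum_distrib_right)
      qed
      have Aint: "integrable leb01 (\<lambda>t. \<Sum>j<N. norm (A k j t))"
        by (intro Bochner_Integration.integrable_sum integrable_norm L1_integrable A k) auto
      have s1: "summable (\<lambda>q. norm (T q t))" for t
        by (rule summable_comparison_test'[OF summable_mult[OF sums_summable[OF exp_sums]], of 0 _ "\<Sum>j<N. norm (A k j t)"])
          (use Tn in auto)
      have s2: "summable (\<lambda>q. int01 (\<lambda>t. norm (T q t)))"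
      proof (rule summable_comparison_test'[OF summable_mult[OF sums_summable[OF exp_sums]], of 0 _
            "int01 (\<lambda>t. \<Sum>j<N. norm (A k j t))"])
        fix q
        have "int01 (\<lambda>t. norm (T q t))
          \<le> int01 (\<lambda>t. (\<Sum>j<N. norm (A k j t)) * (\<beta> * (B ^ q / fact q)))"
          by (intro integral_mono integrable_norm integrable_mult_left L1_integrable TL Aint Tn)
        also have "\<dots> = int01 (\<lambda>t. \<Sum>j<N. norm (A k j t)) * (\<beta> * (B ^ q / fact q))"
          by (rule integral_mult_left_zero)
        finally show "norm (int01 (\<lambda>t. norm (T q t)))
          \<le> int01 (\<lambda>t. \<Sum>j<N. norm (A k j t)) * (\<beta> * (B ^ q / fact q))"
          by (simp add: integral_nonneg_AE)
      qed
      have sumT: "(\<Sum>q. T q t) = indicator {..x} t * (\<Sum>j<N. A k j t * V j t)" for t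
      proof -
        have sD: "summable (\<lambda>q. D q j t)" if "j < N" for j by (rule summable_norm_cancel[OF summ[OF that]])
        have "(\<lambda>q. T q t) sums (indicator {..x} t * (\<Sum>j<N. A k j t * V j t))"
          unfolding T_def V_def using sD by (intro sums_mult sums_sum summable_sums) auto
        then show ?thesis by (rule sums_unique[symmetric])
      qed
      have "V k x = D 0 k x + (\<Sum>q. D (Suc q) k x)"
        unfolding V_def using suminf_split_head[OF summable_norm_cancel[OF summ[OF k, of x]]] by simp
      also have "(\<Sum>q. D (Suc q) k x) = (\<Sum>q. int01 (T q))"
        by (simp add: DS prim_def T_def[abs_def])
      also have "\<dots> = int01 (\<lambda>t. \<Sum>q. T q t)"
        using TL s1 s2 by (intro integral_suminf[symmetric]) (auto simp: L1_def)
      also have "\<dots> = prim (\<lambda>t. \<Sum>j<N. A k j t * V j t) x"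
        by (simp add: sumT prim_def)
      finally show ?thesis using prim_add[OF L[OF k] b[OF k], of x] by (simp add: D0)
    qed
    show "\<exists>V. \<forall>k<N.
      (\<forall>x. norm (V k x) \<le> exp B * (\<Sum>k<N. int01 (\<lambda>t. norm (b k t)))) \<and>
      (\<lambda>t. (\<Sum>j<N. A k j t * V j t) + b k t) \<in> L1 \<and>
      (\<forall>x. V k x = prim (\<lambda>t. (\<Sum>j<N. A k j t * V j t) + b k t) x)"
      using Vb eq L b by (intro exI[of _ V]) (auto simp: \<beta>_def intro: L1_add)
  qed simp
qed

section \<open>The domain of the quasi-derivatives\<close>

lemma wderiv_1:
  assumes "weak_deriv f g" shows "AE x in leb01. wderiv 1 f x = g x"
  using density_reg(3)[OF weak_derivD(2)[OF assms]] weak_derivD(3)[OF assms] by (simp add: wderiv_def)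

lemma W1_1_iff: "f \<in> W1 1 \<longleftrightarrow> (\<exists>g. weak_deriv f g)"
proof
  assume f: "f \<in> W1 1"
  have "(ddiff ^^ 1) (reg f) \<in> reg ` L1" using f unfolding W1_def by blast
  moreover have "f \<in> L1" using f unfolding W1_def by blast
  ultimately obtain g where "g \<in> L1" "ddiff (reg f) = reg g" "f \<in> L1" by auto
  then show "\<exists>g. weak_deriv f g" by (auto simp: weak_deriv_def)
next
  assume "\<exists>g. weak_deriv f g"
  then obtain g where "weak_deriv f g" by blast
  then show "f \<in> W1 1"
    using chain_W1(1)[of 1 "\<lambda>j. if j = 0 then f else g"] by (simp add: weak_derivD(1))
qed

text \<open>The rows up to m and the columns beyond m + 1 vanish only a.e., so the reduction is a.e.
  too. Rows and columns of \<open>F\<close> count from 1, components from 0, hence the shifts by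
  \<open>Suc\<close>.\<close>

lemma matrix_class_row_sum:
  assumes F: "F \<in> matrix_class m" and k: "k < 2 * m + 1"
  shows "AE x in leb01. (\<Sum>j=1..Suc k. F (Suc k) j x * q (j - 1) x) =
     (if m \<le> k then \<Sum>j\<le>m. F (Suc k) (Suc j) x * q j x else 0)"
proof -
  have z: "AE x in leb01. F (Suc k) j x = 0" if "j \<in> {1..2*m+1}" "k < m \<or> m + 1 < j" for j
  proof -
    have "\<forall>k\<in>{1..2*m+1}. \<forall>j\<in>{1..2*m+1}. k < m+1 \<or> j > m+1 \<longrightarrow> (AE x in leb01. F k j x = 0)"
      using F unfolding matrix_class_def by blast
    moreover have "Suc k \<in> {1..2*m+1}" "Suc k < m + 1 \<or> j > m + 1" using k that(2) by auto
    ultimately show ?thesis using that(1) by blast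
  qed
  have "AE x in leb01. \<forall>j\<in>{j \<in> {1..2*m+1}. k < m \<or> m + 1 < j}. F (Suc k) j x = 0"
    by (rule AE_finite_allI) (use z in auto)
  then show ?thesis
  proof eventually_elim
    case (elim x)
    show ?case
    proof (cases "m \<le> k")
      case True
      have "(\<Sum>j=1..Suc k. F (Suc k) j x * q (j - 1) x) = (\<Sum>j=1..Suc m. F (Suc k) j x * q (j - 1) x)"
        using True elim k by (intro sum.mono_neutral_right) auto
      also have "\<dots> = (\<Sum>j\<le>m. F (Suc k) (Suc j) x * q j x)"
        by (rule sum.reindex_bij_witness[of _ Suc "\<lambda>j. j - 1"]) auto
      finally show ?thesis using True by simp
    next
      case False
      then show ?thesis using elim k by (auto intro!: sum.neutral)
    qed
  qed
qed

lemma quasi_deriv_Suc_AE: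
  assumes F: "F \<in> matrix_class m" and k: "k < 2 * m + 1" and g: "weak_deriv (quasi_deriv F y k) g"
  shows "AE x in leb01. quasi_deriv F y (Suc k) x =
     g x - (if m \<le> k then \<Sum>j\<le>m. F (Suc k) (Suc j) x * quasi_deriv F y j x else 0)"
  using wderiv_1[OF g] matrix_class_row_sum[OF F k, of "quasi_deriv F y"]
  by eventually_elim simp

lemma matrix_class_L1: "F \<in> matrix_class m \<Longrightarrow> m \<le> k \<Longrightarrow> k \<le> 2 * m \<Longrightarrow> j \<le> m \<Longrightarrow> F (Suc k) (Suc j) \<in> L1"
  by (auto simp: matrix_class_def)

lemma quasi_domain_weak_deriv:
  assumes "y \<in> quasi_domain n F" "k < n"
  shows "weak_deriv (quasi_deriv F y k) (wderiv 1 (quasi_deriv F y k))"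
proof -
  obtain g where "weak_deriv (quasi_deriv F y k) g"
    using assms W1_1_iff by (auto simp: quasi_domain_def)
  from weak_deriv_AE_cong[OF this _ AE_symmetric[OF wderiv_1[OF this]]] show ?thesis by simp
qed

text \<open>The rows up to m of \<open>F\<close> vanish, so the quasi-derivatives up to order m are
  ordinary derivatives, and y^[m] has one more integrable derivative.\<close>

lemma quasi_domain_W1:
  assumes F: "F \<in> matrix_class m" and y: "y \<in> quasi_domain (2 * m + 1) F"
  shows "y \<in> W1 (m + 1)" and "k \<le> m \<Longrightarrow> AE x in leb01. wderiv k y x = quasi_deriv F y k x"
proof -
  define G where "G k = (if k \<le> m then quasi_deriv F y k else wderiv 1 (quasi_deriv F y m))" for k
  have w: "weak_deriv (quasi_deriv F y k) (wderiv 1 (quasi_deriv F y k))" if "k \<le> m" for k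
    using that by (intro quasi_domain_weak_deriv[OF y]) simp
  have G: "weak_deriv (G k) (G (Suc k))" if "k < m + 1" for k
  proof (cases "k = m")
    case True
    then show ?thesis using w[of m] by (simp add: G_def)
  next
    case False
    then have km: "k < m" using that by simp
    have "AE x in leb01. wderiv 1 (quasi_deriv F y k) x = quasi_deriv F y (Suc k) x"
      using quasi_deriv_Suc_AE[OF F _ w[of k]] km by (auto elim: eventually_mono)
    then show ?thesis using weak_deriv_AE_cong[OF w[of k]] km by (simp add: G_def)
  qed
  have G0: "G 0 = y" by (simp add: G_def)
  show "y \<in> W1 (m + 1)" using chain_W1(1)[of "m + 1" G, OF G] weak_derivD(1)[OF G[of 0]] by (simp add: G0)
  show "AE x in leb01. wderiv k y x = quasi_deriv F y k x" if "k \<le> m"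
    using chain_W1(2)[of "m + 1" G k, OF G] weak_derivD(1)[OF G[of 0]] that by (simp add: G0) (simp add: G_def)
qed

text \<open>A solution with a test function \<open>H\<close> as forcing is sought as
  \<open>U + V\<close>: \<open>U\<close> contains the derivatives of \<open>w\<close> and leaves a
  defect \<open>r\<close>, while \<open>V\<close> corrects for exchanging \<open>r\<close> by
  \<open>H\<close> and is controlled by their distance in \<open>L1\<close>.\<close>

lemma quasi_domain_dense:
  assumes F: "F \<in> matrix_class m" and w: "smooth w" and \<epsilon>: "\<epsilon> > 0"
  obtains y where "y \<in> quasi_domain (2 * m + 1) F"
    "\<And>k. k \<le> m \<Longrightarrow> AE x in leb01. norm (wderiv k y x - (vderiv ^^ k) w x) \<le> \<epsilon>"
proof -
  define N where "N = 2 * m + 1"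
  \<comment> \<open>\<open>A\<close> is the matrix of the system in which the derivative of
    component k is component k + 1 plus row k + 1 of \<open>F\<close> applied to the components up
    to m; \<open>R\<close> is the latter part.\<close>
  define A where "A k j x = (if j = Suc k then 1 else 0) + (if m \<le> k \<and> j \<le> m then F (Suc k) (Suc j) x else 0)"
    for k j x
  define R where "R k Z x = (if m \<le> k then \<Sum>j\<le>m. F (Suc k) (Suc j) x * Z j x else (0::complex))"
    for k and Z :: "nat \<Rightarrow> real \<Rightarrow> complex" and x
  have AL: "A k j \<in> L1" if "k < N" "j < N" for k j
  proof (cases "m \<le> k \<and> j \<le> m")
    case True
    then have "F (Suc k) (Suc j) \<in> L1" using that by (intro matrix_class_L1[OF F]) (auto simp: N_def)
    then show ?thesis using True unfolding A_def[abs_def] by (intro L1_add L1_const) simp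
  next
    case False
    then show ?thesis unfolding A_def[abs_def] by (auto intro: L1_const)
  qed
  have A_sum: "(\<Sum>j<N. A k j x * Z j x) = (if Suc k < N then Z (Suc k) x else 0) + R k Z x" for k x Z
  proof -
    have "(\<Sum>j<N. A k j x * Z j x) = (\<Sum>j<N. if j = Suc k then Z j x else 0) +
       (\<Sum>j<N. if m \<le> k \<and> j \<le> m then F (Suc k) (Suc j) x * Z j x else 0)"
      unfolding sum.distrib[symmetric] by (intro sum.cong) (auto simp: A_def distrib_right)
    also have "(\<Sum>j<N. if m \<le> k \<and> j \<le> m then F (Suc k) (Suc j) x * Z j x else 0) = R k Z x"
    proof (cases "m \<le> k")
      case True
      have "(\<Sum>j<N. if j \<le> m then F (Suc k) (Suc j) x * Z j x else 0) = (\<Sum>j\<le>m. F (Suc k) (Suc j) x * Z j x)"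
        by (rule sum.mono_neutral_cong_right) (auto simp: N_def)
      then show ?thesis using True by (simp add: R_def)
    qed (simp add: R_def)
    finally show ?thesis by simp
  qed
  obtain C where C: "C > 0" "\<And>b. \<forall>k<N. b k \<in> L1 \<Longrightarrow> \<exists>V. \<forall>k<N.
      (\<forall>x. norm (V k x) \<le> C * (\<Sum>k<N. int01 (\<lambda>t. norm (b k t)))) \<and>
      (\<lambda>t. (\<Sum>j<N. A k j t * V j t) + b k t) \<in> L1 \<and>
      (\<forall>x. V k x = prim (\<lambda>t. (\<Sum>j<N. A k j t * V j t) + b k t) x)"
    using linear_system[of N A, OF AL] by blast
  define W where "W k = (vderiv ^^ k) w" for k
  have W: "smooth (W k)" for k unfolding W_def by (rule smooth_vderiv[OF w])
  have RW: "R k W \<in> L1" if "k < N" for k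
  proof (cases "m \<le> k")
    case True
    then show ?thesis using that unfolding R_def[abs_def]
      by simp (intro L1_sum L1_mult_smooth W matrix_class_L1[OF F]; simp add: N_def)
  qed (auto simp: R_def[abs_def] L1_const)
  \<comment> \<open>Only the components above m remain to be found: their row sums involve the given
    derivatives of \<open>w\<close> alone and become a forcing term.\<close>
  define A' where "A' k j x = (if j = Suc k \<and> m < k then 1 else 0 :: complex)" for k j and x :: real
  define b' where "b' k = (if m < k then R k W else (\<lambda>x. 0))" for k
  have A'L: "A' k j \<in> L1" for k j unfolding A'_def[abs_def] by (rule L1_const)
  have b'L: "b' k \<in> L1" if "k < N" for k using RW[OF that] by (simp add: b'_def L1_const)
  obtain C' :: real where "\<forall>b. (\<forall>k<N. b k \<in> L1) \<longrightarrow> (\<exists>V. \<forall>k<N.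
      (\<forall>x. norm (V k x) \<le> C' * (\<Sum>k<N. int01 (\<lambda>t. norm (b k t)))) \<and>
      (\<lambda>t. (\<Sum>j<N. A' k j t * V j t) + b k t) \<in> L1 \<and>
      (\<forall>x. V k x = prim (\<lambda>t. (\<Sum>j<N. A' k j t * V j t) + b k t) x))"
    using linear_system[of N A', OF A'L] by blast
  from spec[OF this, of b'] obtain G where G: "\<And>k. k < N \<Longrightarrow> (\<lambda>t. (\<Sum>j<N. A' k j t * G j t) + b' k t) \<in> L1"
    "\<And>k x. k < N \<Longrightarrow> G k x = prim (\<lambda>t. (\<Sum>j<N. A' k j t * G j t) + b' k t) x"
    using b'L by blast
  \<comment> \<open>\<open>U\<close> extends the derivatives of \<open>w\<close> to a solution of the system up to an integrable defect \<open>r\<close> in row \<open>m\<close>.\<close>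
  define U where "U k = (if k \<le> m then W k else G k)" for k
  have RU: "R k U = R k W" for k by (auto simp: R_def U_def fun_eq_iff intro!: sum.cong)
  have G_sum: "(\<Sum>j<N. A' k j t * G j t) + b' k t = (\<Sum>j<N. A k j t * U j t)" if "m < k" for k t
  proof -
    have "(\<Sum>j<N. A' k j t * G j t) = (\<Sum>j<N. if j = Suc k then G j t else 0)"
      using that by (intro sum.cong) (auto simp: A'_def)
    then show ?thesis using that unfolding A_sum RU by (simp add: b'_def U_def)
  qed
  have UL: "U k \<in> L1" if "k < N" for k
  proof (cases "k \<le> m")
    case False
    then have "G k = prim (\<lambda>t. (\<Sum>j<N. A' k j t * G j t) + b' k t)" using G(2)[OF that] by blast
    then show ?thesis using prim_L1[OF G(1)[OF that]] False by (simp add: U_def)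
  qed (auto simp: U_def intro: smooth_L1 W)
  have AU: "(\<lambda>t. \<Sum>j<N. A k j t * U j t) \<in> L1" if "k < N" for k
    unfolding A_sum RU using UL[of "Suc k"] RW[OF that]
    by (intro L1_add) (cases "Suc k < N"; simp add: L1_const)+
  define r where "r t = W (Suc m) t - (\<Sum>j<N. A m j t * U j t)" for t
  have rL: "r \<in> L1" unfolding r_def[abs_def] by (intro L1_diff smooth_L1 W AU) (simp add: N_def)
  have U_eq: "\<exists>c. \<forall>x\<in>{0..1}. U k x = c + prim (\<lambda>t. (\<Sum>j<N. A k j t * U j t) + (if k = m then r t else 0)) x"
    if k: "k < N" for k
  proof (cases "k \<le> m")
    case True
    have "(\<Sum>j<N. A k j t * U j t) + (if k = m then r t else 0) = W (Suc k) t" for t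
    proof (cases "k = m")
      case False
      then show ?thesis using True unfolding A_sum by (simp add: R_def U_def N_def)
    qed (simp add: r_def)
    then show ?thesis using prim_vderiv[OF W[of k]] True
      by (intro exI[of _ "W k 0"]) (simp add: U_def W_def)
  next
    case False
    then show ?thesis using G(2)[OF k] by (intro exI[of _ 0]) (simp add: U_def G_sum)
  qed
  obtain H where H: "H \<in> test_functions" "int01 (\<lambda>x. norm (r x - H x)) < \<epsilon> / C"
    using test_functions_dense_L1[OF rL, of "\<epsilon> / C"] \<epsilon> C(1) by auto
  \<comment> \<open>The solution for the forcing H - r turns the defect \<open>r\<close> of
    \<open>U\<close> into \<open>H\<close> and is bounded by \<epsilon> in every component.\<close>
  define b where "b k x = (if k = m then H x - r x else 0)" for k x
  have bL: "b k \<in> L1" for k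
    unfolding b_def[abs_def] using L1_diff[OF test_L1[OF H(1)] rL] by (cases "k = m"; simp add: L1_const)
  obtain V where V: "\<And>k x. k < N \<Longrightarrow> norm (V k x) \<le> C * (\<Sum>k<N. int01 (\<lambda>t. norm (b k t)))"
    "\<And>k. k < N \<Longrightarrow> (\<lambda>t. (\<Sum>j<N. A k j t * V j t) + b k t) \<in> L1"
    "\<And>k x. k < N \<Longrightarrow> V k x = prim (\<lambda>t. (\<Sum>j<N. A k j t * V j t) + b k t) x"
    using C(2)[of b] bL by blast
  have "(\<Sum>k<N. int01 (\<lambda>t. norm (b k t))) = (\<Sum>k<N. if k = m then int01 (\<lambda>x. norm (r x - H x)) else 0)"
    by (intro sum.cong) (auto simp: b_def norm_minus_commute)
  also have "\<dots> < \<epsilon> / C" using H(2) by (simp add: N_def)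
  finally have "C * (\<Sum>k<N. int01 (\<lambda>t. norm (b k t))) < \<epsilon>"
    using C(1) by (simp add: field_simps)
  with V(1) have Ve: "norm (V k x) \<le> \<epsilon>" if "k < N" for k x using that by (meson less_imp_le order_trans)
  define Y where "Y k x = U k x + V k x" for k x
  have Y: "weak_deriv (Y k) (\<lambda>t. (\<Sum>j<N. A k j t * Y j t) + (if k = m then H t else 0))" if k: "k < N" for k
  proof -
    obtain c where c: "\<And>x. x \<in> {0..1} \<Longrightarrow>
        U k x = c + prim (\<lambda>t. (\<Sum>j<N. A k j t * U j t) + (if k = m then r t else 0)) x"
      using U_eq[OF k] by blast
    have L1: "(\<lambda>t. (\<Sum>j<N. A k j t * U j t) + (if k = m then r t else 0)) \<in> L1"
      using rL by (intro L1_add AU k) (cases "k = m"; simp add: L1_const)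
    define S where "S t = ((\<Sum>j<N. A k j t * U j t) + (if k = m then r t else 0)) +
        ((\<Sum>j<N. A k j t * V j t) + b k t)" for t
    have S: "S \<in> L1" unfolding S_def[abs_def] by (intro L1_add L1 V(2) k)
    have S_eq: "S = (\<lambda>t. (\<Sum>j<N. A k j t * Y j t) + (if k = m then H t else 0))"
      by (auto simp: S_def Y_def b_def fun_eq_iff distrib_left sum.distrib)
    have "AE x in leb01. c + prim S x = Y k x"
      using c V(3)[OF k] prim_add[OF L1 V(2)[OF k]] by (intro AE_I2) (simp add: Y_def S_def[abs_def])
    from weak_deriv_AE_cong[OF weak_deriv_prim[OF S] this] show ?thesis by (simp add: S_eq)
  qed
  \<comment> \<open>The smooth forcing term in row \<open>m\<close> is absorbed by shifting the later components by its derivatives.\<close>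
  define Z where "Z k x = Y k x + (if m < k then (vderiv ^^ (k - m - 1)) H x else 0)" for k x
  \<comment> \<open>\<open>R\<close> reads the components up to m only, and the shift leaves these
    alone.\<close>
  have RZ: "R k Z = R k Y" for k by (auto simp: R_def Z_def fun_eq_iff intro!: sum.cong)
  \<comment> \<open>For the last component the domain asks just for an integrable derivative, so the
    equation is claimed under \<open>Suc k < N\<close>.\<close>
  have Z': "\<exists>g. weak_deriv (Z k) g \<and> (Suc k < N \<longrightarrow> g = (\<lambda>x. Z (Suc k) x + R k Z x))" if k: "k < N" for k
  proof (cases "m < k")
    case True
    have "weak_deriv (Z k) (\<lambda>x. ((\<Sum>j<N. A k j x * Y j x) + (if k = m then H x else 0)) + (vderiv ^^ (k - m)) H x)"
    proof -
      have "k - m = Suc (k - m - 1)" using True by simp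
      then have "weak_deriv ((vderiv ^^ (k - m - 1)) H) ((vderiv ^^ (k - m)) H)"
        using weak_deriv_smooth[OF smooth_vderiv[OF test_smooth[OF H(1)]], of "k - m - 1"]
        by (metis comp_apply funpow.simps(2))
      from weak_deriv_add[OF Y[OF k] this] show ?thesis using True by (simp add: Z_def[abs_def])
    qed
    moreover have "(\<lambda>x. ((\<Sum>j<N. A k j x * Y j x) + (if k = m then H x else 0)) + (vderiv ^^ (k - m)) H x) = (\<lambda>x. Z (Suc k) x + R k Z x)"
      if "Suc k < N"
      using that True unfolding A_sum RZ by (auto simp: Z_def fun_eq_iff R_def)
    ultimately show ?thesis by blast
  next
    case False
    have "weak_deriv (Z k) (\<lambda>x. (\<Sum>j<N. A k j x * Y j x) + (if k = m then H x else 0))"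
      using Y[OF k] False by (simp add: Z_def[abs_def])
    moreover have "(\<lambda>x. (\<Sum>j<N. A k j x * Y j x) + (if k = m then H x else 0)) = (\<lambda>x. Z (Suc k) x + R k Z x)"
      if "Suc k < N"
      using that False unfolding A_sum RZ by (auto simp: Z_def fun_eq_iff R_def)
    ultimately show ?thesis by blast
  qed
  have qd: "AE x in leb01. quasi_deriv F (Z 0) k x = Z k x" if "k < N" for k
    using that
  proof (induction k rule: less_induct)
    case (less k)
    show ?case
    proof (cases k)
      case (Suc l)
      then have l: "l < N" "Suc l < N" using less.prems by auto
      obtain g where g: "weak_deriv (Z l) g" "g = (\<lambda>x. Z (Suc l) x + R l Z x)" using Z'[OF l(1)] l(2) by blast
      have q: "AE x in leb01. quasi_deriv F (Z 0) l x = Z l x" using less.IH[of l] l Suc by simp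
      have g': "weak_deriv (quasi_deriv F (Z 0) l) g"
        using weak_deriv_AE_cong[OF g(1)] q by (simp add: eq_commute)
      have "AE x in leb01. \<forall>j\<in>{j. j \<le> m \<and> j \<le> l}. quasi_deriv F (Z 0) j x = Z j x"
        using less.IH l Suc by (intro AE_finite_allI) auto
      moreover have "AE x in leb01. quasi_deriv F (Z 0) (Suc l) x =
          g x - (if m \<le> l then \<Sum>j\<le>m. F (Suc l) (Suc j) x * quasi_deriv F (Z 0) j x else 0)"
        using l by (intro quasi_deriv_Suc_AE[OF F _ g']) (simp add: N_def)
      ultimately have "AE x in leb01. quasi_deriv F (Z 0) (Suc l) x = Z (Suc l) x"
      proof eventually_elim
        case (elim x)
        then have "(\<Sum>j\<le>m. F (Suc l) (Suc j) x * quasi_deriv F (Z 0) j x) = (\<Sum>j\<le>m. F (Suc l) (Suc j) x * Z j x)"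
          if "m \<le> l"
          using that by (intro sum.cong) auto
        with elim show ?case by (simp add: g(2) R_def del: quasi_deriv.simps)
      qed
      then show ?thesis by (simp only: Suc)
    qed simp
  qed
  have y: "Z 0 \<in> quasi_domain (2 * m + 1) F"
    unfolding quasi_domain_def
  proof (intro CollectI allI impI)
    fix k assume "k < 2 * m + 1"
    then have k: "k < N" by (simp add: N_def)
    obtain g where g: "weak_deriv (Z k) g" using Z'[OF k] by blast
    have "weak_deriv (quasi_deriv F (Z 0) k) g"
      using weak_deriv_AE_cong[OF g] qd[OF k] by (simp add: eq_commute)
    then show "quasi_deriv F (Z 0) k \<in> W1 1" using W1_1_iff by blast
  qed
  have "AE x in leb01. norm (wderiv k (Z 0) x - (vderiv ^^ k) w x) \<le> \<epsilon>" if k: "k \<le> m" for k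
  proof -
    have kN: "k < N" using k by (simp add: N_def)
    show ?thesis using quasi_domain_W1(2)[OF F y k] qd[OF kN]
    proof eventually_elim
      case (elim x)
      with kN k Ve[of k x] show ?case by (simp add: Z_def Y_def U_def W_def)
    qed
  qed
  with y show ?thesis by (rule that)
qed

section \<open>The matrices \<chi> and the symbol\<close>

lemma sum_even_odd:
  fixes f :: "nat \<Rightarrow> 'a::comm_monoid_add"
  shows "(\<Sum>\<nu><2*m+1. f \<nu>) = (\<Sum>k\<le>m. f (2*k)) + (\<Sum>k<m. f (2*k+1))"
  by (induction m) (simp_all add: ac_simps)

lemma sum4_swap:
  "(\<Sum>r\<in>R. \<Sum>s\<in>S. \<Sum>\<nu>\<in>C. \<Sum>i\<in>D \<nu>. g r s \<nu> i) = (\<Sum>\<nu>\<in>C. \<Sum>i\<in>D \<nu>. \<Sum>r\<in>R. \<Sum>s\<in>S. g r s \<nu> i)"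
proof -
  have "(\<Sum>r\<in>R. \<Sum>s\<in>S. \<Sum>\<nu>\<in>C. \<Sum>i\<in>D \<nu>. g r s \<nu> i) = (\<Sum>r\<in>R. \<Sum>\<nu>\<in>C. \<Sum>s\<in>S. \<Sum>i\<in>D \<nu>. g r s \<nu> i)"
    by (intro sum.cong refl sum.swap)
  also have "\<dots> = (\<Sum>\<nu>\<in>C. \<Sum>r\<in>R. \<Sum>s\<in>S. \<Sum>i\<in>D \<nu>. g r s \<nu> i)"
    by (rule sum.swap)
  also have "\<dots> = (\<Sum>\<nu>\<in>C. \<Sum>r\<in>R. \<Sum>i\<in>D \<nu>. \<Sum>s\<in>S. g r s \<nu> i)"
    by (intro sum.cong refl sum.swap)
  also have "\<dots> = (\<Sum>\<nu>\<in>C. \<Sum>i\<in>D \<nu>. \<Sum>r\<in>R. \<Sum>s\<in>S. g r s \<nu> i)"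
    by (intro sum.cong refl sum.swap)
  finally show ?thesis .
qed

lemma double_sum_delta:
  fixes f :: "nat \<Rightarrow> nat \<Rightarrow> complex"
  assumes "a \<le> m" "b \<le> m"
  shows "(\<Sum>r\<le>m. \<Sum>s\<le>m. (if r = a \<and> s = b then c else 0) * f r s) = c * f a b"
proof -
  have "(\<Sum>r\<le>m. \<Sum>s\<le>m. (if r = a \<and> s = b then c else 0) * f r s)
      = (\<Sum>r\<le>m. if r = a then \<Sum>s\<le>m. if s = b then c * f r s else 0 else 0)"
  proof -
    have e: "(if r = a \<and> s = b then c else 0) * f r s
        = (if r = a then if s = b then c * f r s else 0 else 0)" for r s by simp
    show ?thesis unfolding e by (intro sum.cong refl) auto
  qed
  also have "\<dots> = c * f a b"
    using assms by (simp only: sum.delta finite_atMost atMost_iff if_True)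
  finally show ?thesis .
qed

lemma antidiagonal_sum:
  fixes f :: "nat \<Rightarrow> nat \<Rightarrow> complex"
  assumes "k + j \<le> m"
  shows "(\<Sum>r\<le>m. \<Sum>s\<le>m. (\<Sum>p\<le>j. if r = p + k \<and> s = j - p + k then c p else 0) * f r s)
    = (\<Sum>p\<le>j. c p * f (p + k) (j - p + k))"
proof -
  have "(\<Sum>r\<le>m. \<Sum>s\<le>m. (\<Sum>p\<le>j. if r = p + k \<and> s = j - p + k then c p else 0) * f r s)
      = (\<Sum>r\<le>m. \<Sum>s\<le>m. \<Sum>p\<le>j. (if r = p + k \<and> s = j - p + k then c p else 0) * f r s)"
    by (simp only: sum_distrib_right)
  also have "\<dots> = (\<Sum>r\<le>m. \<Sum>p\<le>j. \<Sum>s\<le>m. (if r = p + k \<and> s = j - p + k then c p else 0) * f r s)"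
    by (intro sum.cong refl sum.swap)
  also have "\<dots> = (\<Sum>p\<le>j. \<Sum>r\<le>m. \<Sum>s\<le>m. (if r = p + k \<and> s = j - p + k then c p else 0) * f r s)"
    by (rule sum.swap)
  also have "\<dots> = (\<Sum>p\<le>j. c p * f (p + k) (j - p + k))"
    using assms by (intro sum.cong refl double_sum_delta) auto
  finally show ?thesis .
qed

lemma chi_even: "chi (2 * k) i r s = (\<Sum>p\<le>i. if r = p + k \<and> s = i - p + k then of_nat (i choose p) else 0)"
  by (simp add: chi_def)

lemma chi_odd: "chi (2 * k + 1) i r s = (\<Sum>p\<le>Suc i. if r = p + k \<and> s = Suc i - p + k
    then of_nat (Suc i choose p) - 2 * (if p = 0 then 0 else of_nat (i choose (p - 1))) else 0)"
  unfolding Suc_eq_plus1 by (simp add: chi_def)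

lemma sing_order_even: "sing_order m (2 * k) = m - k"
  and sing_order_odd: "sing_order m (2 * k + 1) = m - k - 1"
  by (simp_all add: sing_order_def)

text \<open>The right side is the Leibniz expansion of the i-th derivative of y^(k) z^(k), the
  product belonging to an even-order term: this is the origin of \<chi> for even index.\<close>

lemma chi_even_sum:
  assumes "k + i \<le> m"
  shows "(\<Sum>r\<le>m. \<Sum>s\<le>m. chi (2 * k) i r s * (Y r * Z s))
    = (\<Sum>p\<le>i. of_nat (i choose p) * (Y (p + k) * Z (i - p + k)))"
  unfolding chi_even by (rule antidiagonal_sum[OF assms])

text \<open>By Pascal's rule the entries are C(i,p) - C(i,p-1), the Leibniz coefficients of the i-th
  derivative of y^(k) z^(k+1) - y^(k+1) z^(k), the combination belonging to an odd-order
  term.\<close>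

lemma chi_odd_sum:
  assumes "Suc (k + i) \<le> m"
  shows "(\<Sum>r\<le>m. \<Sum>s\<le>m. chi (2 * k + 1) i r s * (Y r * Z s))
    = (\<Sum>p\<le>i. of_nat (i choose p) * (Y (p + k) * Z (i - p + Suc k)))
      - (\<Sum>p\<le>i. of_nat (i choose p) * (Y (p + Suc k) * Z (i - p + k)))"
proof -
  define g where "g p = Y (p + k) * Z (Suc i - p + k)" for p
  have "(\<Sum>r\<le>m. \<Sum>s\<le>m. chi (2 * k + 1) i r s * (Y r * Z s))
     = (\<Sum>p\<le>Suc i. (of_nat (Suc i choose p) - 2 * (if p = 0 then 0 else of_nat (i choose (p - 1)))) * g p)"
    unfolding chi_odd g_def using assms by (intro antidiagonal_sum) simp
  also have "\<dots> = g 0 + (\<Sum>p\<le>i. (of_nat (i choose Suc p) - of_nat (i choose p)) * g (Suc p))"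
    by (subst sum.atMost_Suc_shift) (simp add: algebra_simps)
  also have "\<dots> = (g 0 + (\<Sum>p\<le>i. of_nat (i choose Suc p) * g (Suc p))) - (\<Sum>p\<le>i. of_nat (i choose p) * g (Suc p))"
    by (simp add: left_diff_distrib sum_subtractf)
  also have "g 0 + (\<Sum>p\<le>i. of_nat (i choose Suc p) * g (Suc p)) = (\<Sum>p\<le>Suc i. of_nat (i choose p) * g p)"
    by (subst sum.atMost_Suc_shift) simp
  also have "\<dots> = (\<Sum>p\<le>i. of_nat (i choose p) * g p)" by (simp add: binomial_eq_0)
  also have "\<dots> = (\<Sum>p\<le>i. of_nat (i choose p) * (Y (p + k) * Z (i - p + Suc k)))"
    by (intro sum.cong) (auto simp: g_def Suc_diff_le)
  finally show ?thesis by (simp add: g_def)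
qed

section \<open>The matrices \<chi> span all matrices\<close>

definition chi_span :: "nat \<Rightarrow> (nat \<Rightarrow> nat \<Rightarrow> complex) \<Rightarrow> bool" where
  "chi_span m E \<longleftrightarrow> (\<exists>a. \<forall>r s. E r s = (\<Sum>\<nu><2*m+1. \<Sum>i\<le>sing_order m \<nu>. a \<nu> i * chi \<nu> i r s))"

lemma chi_span_add: "chi_span m E \<Longrightarrow> chi_span m E' \<Longrightarrow> chi_span m (\<lambda>r s. E r s + E' r s)"
  unfolding chi_span_def
proof (elim exE)
  fix a a' assume "\<forall>r s. E r s = (\<Sum>\<nu><2*m+1. \<Sum>i\<le>sing_order m \<nu>. a \<nu> i * chi \<nu> i r s)"
    "\<forall>r s. E' r s = (\<Sum>\<nu><2*m+1. \<Sum>i\<le>sing_order m \<nu>. a' \<nu> i * chi \<nu> i r s)"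
  then show "\<exists>a. \<forall>r s. E r s + E' r s = (\<Sum>\<nu><2*m+1. \<Sum>i\<le>sing_order m \<nu>. a \<nu> i * chi \<nu> i r s)"
    by (intro exI[of _ "\<lambda>\<nu> i. a \<nu> i + a' \<nu> i"]) (simp only: sum.distrib distrib_right simp_thms)
qed

lemma chi_span_cmult: "chi_span m E \<Longrightarrow> chi_span m (\<lambda>r s. c * E r s)"
  unfolding chi_span_def
proof (elim exE)
  fix a assume "\<forall>r s. E r s = (\<Sum>\<nu><2*m+1. \<Sum>i\<le>sing_order m \<nu>. a \<nu> i * chi \<nu> i r s)"
  then show "\<exists>a. \<forall>r s. c * E r s = (\<Sum>\<nu><2*m+1. \<Sum>i\<le>sing_order m \<nu>. a \<nu> i * chi \<nu> i r s)"
    by (intro exI[of _ "\<lambda>\<nu> i. c * a \<nu> i"]) (simp only: sum_distrib_left mult.assoc simp_thms)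
qed

lemma chi_span_sum:
  "finite I \<Longrightarrow> (\<And>p. p \<in> I \<Longrightarrow> chi_span m (E p)) \<Longrightarrow> chi_span m (\<lambda>r s. \<Sum>p\<in>I. E p r s)"
proof (induction I rule: finite_induct)
  case empty
  show ?case by (auto simp: chi_span_def intro!: exI[of _ "\<lambda>_ _. 0"])
qed (auto intro: chi_span_add)

lemma chi_span_chi:
  assumes "\<nu> < 2 * m + 1" "i \<le> sing_order m \<nu>"
  shows "chi_span m (chi \<nu> i)"
  unfolding chi_span_def
proof (intro exI[of _ "\<lambda>\<mu> j. if \<mu> = \<nu> \<and> j = i then 1 else 0"] allI)
  fix r s
  have "(\<Sum>\<mu><2*m+1. \<Sum>j\<le>sing_order m \<mu>. (if \<mu> = \<nu> \<and> j = i then 1 else 0) * chi \<mu> j r s)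
     = (\<Sum>\<mu><2*m+1. if \<mu> = \<nu> then \<Sum>j\<le>sing_order m \<mu>. if j = i then chi \<mu> j r s else 0 else 0)"
  proof -
    have e: "(if \<mu> = \<nu> \<and> j = i then 1 else 0) * chi \<mu> j r s
        = (if \<mu> = \<nu> then if j = i then chi \<mu> j r s else 0 else 0)" for \<mu> j by simp
    show ?thesis unfolding e by (intro sum.cong refl) auto
  qed
  also have "\<dots> = chi \<nu> i r s"
    using assms by (simp only: sum.delta finite_atMost finite_lessThan atMost_iff lessThan_iff if_True)
  finally show "chi \<nu> i r s = (\<Sum>\<mu><2*m+1. \<Sum>j\<le>sing_order m \<mu>. (if \<mu> = \<nu> \<and> j = i then 1 else 0) * chi \<mu> j r s)"
    by (rule sym)
qed

text \<open>On the antidiagonal through \<open>(k, k + j)\<close>, \<open>\<chi>\<^bsub>2k,j\<^esub> \<plusminus> \<chi>\<^bsub>2k+1,j-1\<^esub>\<close> isolates one of the two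
  extreme entries up to entries closer to the main diagonal.\<close>

lemma chi_span_unit_aux:
  "k + j \<le> m \<Longrightarrow> chi_span m (\<lambda>r s. if r = k \<and> s = k + j then 1 else 0) \<and>
     chi_span m (\<lambda>r s. if r = k + j \<and> s = k then 1 else 0)"
proof (induction j arbitrary: k rule: less_induct)
  case (less j)
  define E where "E a b = (\<lambda>r s. if r = a \<and> s = b then 1 else 0 :: complex)" for a b :: nat
  show ?case
  proof (cases j)
    case 0
    have "chi (2 * k) 0 = E k k" by (auto simp: fun_eq_iff chi_even E_def)
    moreover have "chi_span m (chi (2 * k) 0)" using less.prems by (intro chi_span_chi) auto
    ultimately show ?thesis using 0 by (simp add: E_def)
  next
    case (Suc l)
    \<comment> \<open>The entry (p + k, j - p + k) is |j - 2p| < j away from the main diagonal, so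
      the induction hypothesis covers it on whichever side it lies.\<close>
    have inner: "chi_span m (E (p + k) (j - p + k))" if p: "p \<in> {1..<j}" for p
    proof (cases "p \<le> j - p")
      case True
      have "chi_span m (E (p + k) (p + k + (j - 2 * p)))"
        using less.IH[of "j - 2 * p" "p + k"] p True less.prems by (auto simp: E_def)
      moreover have "p + k + (j - 2 * p) = j - p + k" using True p by auto
      ultimately show ?thesis by simp
    next
      case False
      have "chi_span m (E (j - p + k + (2 * p - j)) (j - p + k))"
        using less.IH[of "2 * p - j" "j - p + k"] p False less.prems by (auto simp: E_def)
      moreover have "j - p + k + (2 * p - j) = p + k" using False p by auto
      ultimately show ?thesis by simp
    qed
    have split: "(\<Sum>p\<le>j. c p * E (p + k) (j - p + k) r s) =
       c 0 * E k (k + j) r s + c j * E (k + j) k r s + (\<Sum>p\<in>{1..<j}. c p * E (p + k) (j - p + k) r s)"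
      for c r s
    proof -
      have "{..j} = insert 0 (insert j {1..<j})" using Suc by auto
      then show ?thesis using Suc by (simp add: add.commute)
    qed
    have in_span: "chi_span m (\<lambda>r s. c 0 * E k (k + j) r s + c j * E (k + j) k r s)"
      if "chi_span m (\<lambda>r s. \<Sum>p\<le>j. c p * E (p + k) (j - p + k) r s)" for c
    proof -
      have "chi_span m (\<lambda>r s. (\<Sum>p\<le>j. c p * E (p + k) (j - p + k) r s)
         + (-1) * (\<Sum>p\<in>{1..<j}. c p * E (p + k) (j - p + k) r s))"
        by (intro chi_span_add chi_span_cmult chi_span_sum that inner) auto
      then show ?thesis unfolding split by simp
    qed
    have "chi_span m (chi (2 * k) j)"
      using less.prems by (intro chi_span_chi) (auto simp: sing_order_even)
    also have "chi (2 * k) j = (\<lambda>r s. \<Sum>p\<le>j. of_nat (j choose p) * E (p + k) (j - p + k) r s)"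
      by (auto simp: chi_even E_def fun_eq_iff intro!: sum.cong)
    finally have 1: "chi_span m (\<lambda>r s. of_nat (j choose 0) * E k (k + j) r s + of_nat (j choose j) * E (k + j) k r s)"
      by (rule in_span)
    \<comment> \<open>At the ends d is 1 and 1 - 2 = -1, while the even matrix has 1 and 1; half the
      sum and half the difference separate the two corners.\<close>
    define d where "d p = of_nat (j choose p) - 2 * (if p = 0 then 0 else of_nat (l choose (p - 1)) :: complex)" for p
    have "chi_span m (chi (2 * k + 1) l)"
      using less.prems Suc by (intro chi_span_chi) (auto simp: sing_order_odd[simplified])
    also have "chi (2 * k + 1) l = (\<lambda>r s. \<Sum>p\<le>j. d p * E (p + k) (j - p + k) r s)"
      unfolding chi_odd Suc[symmetric]
      by (auto simp: E_def d_def fun_eq_iff intro!: sum.cong)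
    finally have "chi_span m (\<lambda>r s. d 0 * E k (k + j) r s + d j * E (k + j) k r s)" by (rule in_span)
    then have 2: "chi_span m (\<lambda>r s. E k (k + j) r s - E (k + j) k r s)" by (simp add: d_def Suc)
    have "chi_span m (\<lambda>r s. (1/2) * (of_nat (j choose 0) * E k (k + j) r s + of_nat (j choose j) * E (k + j) k r s)
        + (1/2) * (E k (k + j) r s - E (k + j) k r s))"
      "chi_span m (\<lambda>r s. (1/2) * (of_nat (j choose 0) * E k (k + j) r s + of_nat (j choose j) * E (k + j) k r s)
        + (-1/2) * (E k (k + j) r s - E (k + j) k r s))"
      by (intro chi_span_add chi_span_cmult 1 2)+
    moreover have "(1/2) * (of_nat (j choose 0) * x + of_nat (j choose j) * y) + (1/2) * (x - y) = x"
      "(1/2) * (of_nat (j choose 0) * x + of_nat (j choose j) * y) + (-1/2) * (x - y) = y" for x y :: complex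
      by (simp_all add: field_simps)
    ultimately show ?thesis by (simp only: E_def)
  qed
qed

text \<open>There are (m+1)^2 admissible pairs of indices \<nu>, i, as many as entries, so the
  \<chi> even form a basis.\<close>

lemma chi_span_unit:
  assumes "a \<le> m" "b \<le> m"
  shows "chi_span m (\<lambda>r s. if r = a \<and> s = b then 1 else 0)"
proof (cases "a \<le> b")
  case True
  then show ?thesis using chi_span_unit_aux[of a "b - a" m] assms by simp
next
  case False
  then show ?thesis using chi_span_unit_aux[of b "a - b" m] assms by simp
qed

definition coeff_matrix :: "nat \<Rightarrow> (nat \<Rightarrow> nat \<Rightarrow> real \<Rightarrow> complex) \<Rightarrow> nat \<Rightarrow> nat \<Rightarrow> real \<Rightarrow> complex" where
  "coeff_matrix m t r s x = (\<Sum>\<nu><2*m+1. \<Sum>i\<le>sing_order m \<nu>. t \<nu> i x * chi \<nu> i r s)"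

text \<open>Each unit matrix expands with constant coefficients, so the functions \<open>t\<close>
  are finite linear combinations of the entries of \<open>Q\<close> and inherit
  integrability.\<close>

lemma coeff_matrix_decomposition:
  assumes Q: "\<And>r s. r \<le> m \<Longrightarrow> s \<le> m \<Longrightarrow> Q r s \<in> L1"
  obtains t where "\<And>\<nu> i. t \<nu> i \<in> L1" "\<And>r s x. r \<le> m \<Longrightarrow> s \<le> m \<Longrightarrow> coeff_matrix m t r s x = Q r s x"
proof -
  define c where "c a b = (SOME c. \<forall>r s. (if r = a \<and> s = b then 1 else 0) =
      (\<Sum>\<nu><2*m+1. \<Sum>i\<le>sing_order m \<nu>. c \<nu> i * chi \<nu> i r s))" for a b
  have c: "(if r = a \<and> s = b then 1 else 0) =
      (\<Sum>\<nu><2*m+1. \<Sum>i\<le>sing_order m \<nu>. c a b \<nu> i * chi \<nu> i r s)" if "a \<le> m" "b \<le> m" for a b r s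
    using someI_ex[OF chi_span_unit[OF that, unfolded chi_span_def]] unfolding c_def by blast
  define t where "t \<nu> i x = (\<Sum>a\<le>m. \<Sum>b\<le>m. Q a b x * c a b \<nu> i)" for \<nu> i x
  show ?thesis
  proof (rule that[of t])
    show "t \<nu> i \<in> L1" for \<nu> i
      unfolding t_def[abs_def] by (intro L1_sum L1_mult_const Q) auto
    fix r s x assume rs: "r \<le> m" "s \<le> m"
    have "coeff_matrix m t r s x = (\<Sum>\<nu><2*m+1. \<Sum>i\<le>sing_order m \<nu>. \<Sum>a\<le>m. \<Sum>b\<le>m. Q a b x * (c a b \<nu> i * chi \<nu> i r s))"
      by (simp only: coeff_matrix_def t_def sum_distrib_right mult.assoc)
    also have "\<dots> = (\<Sum>a\<le>m. \<Sum>b\<le>m. \<Sum>\<nu><2*m+1. \<Sum>i\<le>sing_order m \<nu>. Q a b x * (c a b \<nu> i * chi \<nu> i r s))"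
      by (rule sum4_swap[symmetric])
    also have "\<dots> = (\<Sum>a\<le>m. \<Sum>b\<le>m. (if a = r \<and> b = s then 1 else 0) * Q a b x)"
    proof (intro sum.cong refl)
      fix a b assume "a \<in> {..m}" "b \<in> {..m}"
      then have "(\<Sum>\<nu><2*m+1. \<Sum>i\<le>sing_order m \<nu>. Q a b x * (c a b \<nu> i * chi \<nu> i r s))
          = Q a b x * (if r = a \<and> s = b then 1 else 0)"
        using c[of a b r s] by (simp only: sum_distrib_left atMost_iff)
      then show "(\<Sum>\<nu><2*m+1. \<Sum>i\<le>sing_order m \<nu>. Q a b x * (c a b \<nu> i * chi \<nu> i r s))
          = (if a = r \<and> b = s then 1 else 0) * Q a b x"
        by auto
    qed
    also have "\<dots> = Q r s x" by (subst double_sum_delta[OF rs]) simp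
    finally show "coeff_matrix m t r s x = Q r s x" .
  qed
qed

text \<open>The value of \<open>S\<close> on w^(k) z^(j) for w = e^(cx) and z = e^(-cx) \<phi>, as a
  polynomial in c: the exponentials cancel, and the Leibniz rule leaves powers from c^k to
  c^(k+j).\<close>

definition symbol_poly :: "functional \<Rightarrow> (real \<Rightarrow> complex) \<Rightarrow> nat \<Rightarrow> nat \<Rightarrow> complex poly" where
  "symbol_poly S \<phi> k j = (\<Sum>l\<le>j. monom ((-1) ^ l * of_nat (j choose l) * S ((vderiv ^^ (j - l)) \<phi>)) (k + l))"

lemma poly_symbol_poly:
  assumes S: "test_linear S" and \<phi>: "\<phi> \<in> test_functions"
  shows "S (\<lambda>x. (vderiv ^^ k) (\<lambda>x. exp (c * of_real x)) x * (vderiv ^^ j) (\<lambda>x. exp (- c * of_real x) * \<phi> x) x)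
    = poly (symbol_poly S \<phi> k j) c"
proof -
  have "(\<lambda>x. (vderiv ^^ k) (\<lambda>x. exp (c * of_real x)) x * (vderiv ^^ j) (\<lambda>x. exp (- c * of_real x) * \<phi> x) x)
    = (\<lambda>x. \<Sum>l\<le>j. (c ^ k * (- c) ^ l * of_nat (j choose l)) * (vderiv ^^ (j - l)) \<phi> x)"
  proof
    fix x :: real
    have e: "exp (c * of_real x) * exp (- c * of_real x) = 1" by (simp add: exp_minus)
    have "c ^ k * exp (c * of_real x) * (\<Sum>l\<le>j. of_nat (j choose l) * ((- c) ^ l * exp (- c * of_real x) * (vderiv ^^ (j - l)) \<phi> x))
       = (\<Sum>l\<le>j. (exp (c * of_real x) * exp (- c * of_real x)) * ((c ^ k * (- c) ^ l * of_nat (j choose l)) * (vderiv ^^ (j - l)) \<phi> x))"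
      unfolding sum_distrib_left by (intro sum.cong refl) (simp only: mult_ac)
    then show "(vderiv ^^ k) (\<lambda>x. exp (c * of_real x)) x * (vderiv ^^ j) (\<lambda>x. exp (- c * of_real x) * \<phi> x) x
      = (\<Sum>l\<le>j. (c ^ k * (- c) ^ l * of_nat (j choose l)) * (vderiv ^^ (j - l)) \<phi> x)"
      unfolding smooth_mult(2)[OF smooth_exp(1) test_smooth[OF \<phi>]] smooth_exp(2) e by simp
  qed
  then have "S (\<lambda>x. (vderiv ^^ k) (\<lambda>x. exp (c * of_real x)) x * (vderiv ^^ j) (\<lambda>x. exp (- c * of_real x) * \<phi> x) x)
    = (\<Sum>l\<le>j. (c ^ k * (- c) ^ l * of_nat (j choose l)) * S ((vderiv ^^ (j - l)) \<phi>))"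
    using test_linear_sum[OF S, of "{..j}" "\<lambda>l x. (c ^ k * (- c) ^ l * of_nat (j choose l)) * (vderiv ^^ (j - l)) \<phi> x"]
      test_linearD(3)[OF S test_vderiv[OF \<phi>]] test_cmult[OF test_vderiv[OF \<phi>]] by simp
  also have "\<dots> = poly (symbol_poly S \<phi> k j) c"
    by (simp add: symbol_poly_def poly_sum poly_monom power_add power_minus[of c] mult_ac)
  finally show ?thesis .
qed

text \<open>Only the term l = j, in which no derivative falls on \<phi>, reaches degree k +
  j.\<close>

lemma coeff_symbol_poly:
  "k + j \<le> N \<Longrightarrow> coeff (symbol_poly S \<phi> k j) N = (if N = k + j then (-1) ^ j * S \<phi> else 0)"
proof -
  assume N: "k + j \<le> N"
  have "coeff (symbol_poly S \<phi> k j) N = (\<Sum>l\<le>j. if l = j then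
      (if N = k + j then (-1) ^ j * S \<phi> else 0) else 0)"
    unfolding symbol_poly_def coeff_sum using N by (intro sum.cong refl) auto
  then show ?thesis by simp
qed

text \<open>The contribution of the coefficient \<open>S\<close> of index \<nu> to the form on
  smooth functions. The minus sign for odd \<nu> arises because one of the two products carries one
  derivative more, all of which are moved onto \<open>z\<close>.\<close>

definition order_term :: "functional \<Rightarrow> nat \<Rightarrow> (real \<Rightarrow> complex) \<Rightarrow> (real \<Rightarrow> complex) \<Rightarrow> complex" where
  "order_term S \<nu> w z = (let k = \<nu> div 2 in
     if even \<nu> then S (\<lambda>x. (vderiv ^^ k) w x * (vderiv ^^ k) z x)
     else S (\<lambda>x. (vderiv ^^ k) w x * (vderiv ^^ Suc k) z x) - S (\<lambda>x. (vderiv ^^ Suc k) w x * (vderiv ^^ k) z x))"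

text \<open>With \<open>w = e\<^sup>c\<^sup>x\<close> and \<open>z = e\<^sup>-\<^sup>c\<^sup>x \<phi>\<close> the \<open>\<nu>\<close>-th summand is a polynomial in \<open>c\<close> of degree at most \<open>\<nu>\<close>
  whose coefficient of \<open>c\<^sup>\<nu>\<close> is a nonzero multiple of \<open>S\<^sub>\<nu> \<phi>\<close>, so the \<open>S\<^sub>\<nu>\<close> vanish one after
  another from the top.\<close>

lemma order_terms_vanish:
  assumes S: "\<And>\<nu>. \<nu> < n \<Longrightarrow> test_linear (S \<nu>)"
    and sum0: "\<And>w z. smooth w \<Longrightarrow> z \<in> test_functions \<Longrightarrow> (\<Sum>\<nu><n. order_term (S \<nu>) \<nu> w z) = 0"
    and "\<nu> < n" "\<phi> \<in> test_functions"
  shows "S \<nu> \<phi> = 0"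
  using assms(3,4)
proof (induction "n - \<nu>" arbitrary: \<nu> \<phi> rule: less_induct)
  case less
  note \<phi> = less.prems(2)
  have S0: "S \<mu> \<psi> = 0" if "\<nu> < \<mu>" "\<mu> < n" "\<psi> \<in> test_functions" for \<mu> \<psi>
    using less.hyps[of \<mu> \<psi>] that by simp
  define P where "P \<mu> = (let k = \<mu> div 2 in if even \<mu> then symbol_poly (S \<mu>) \<phi> k k
    else symbol_poly (S \<mu>) \<phi> k (Suc k) - symbol_poly (S \<mu>) \<phi> (Suc k) k)" for \<mu>
  have "poly (\<Sum>\<mu><n. P \<mu>) c = 0" for c
  proof -
    have "(\<Sum>\<mu><n. order_term (S \<mu>) \<mu> (\<lambda>x. exp (c * of_real x)) (\<lambda>x. exp (- c * of_real x) * \<phi> x)) = 0"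
      by (intro sum0 smooth_exp smooth_mult_test \<phi>)
    also have "(\<Sum>\<mu><n. order_term (S \<mu>) \<mu> (\<lambda>x. exp (c * of_real x)) (\<lambda>x. exp (- c * of_real x) * \<phi> x))
       = (\<Sum>\<mu><n. poly (P \<mu>) c)"
    proof (intro sum.cong refl)
      fix \<mu> assume "\<mu> \<in> {..<n}"
      then have "test_linear (S \<mu>)" by (intro S) simp
      from poly_symbol_poly[OF this \<phi>]
      show "order_term (S \<mu>) \<mu> (\<lambda>x. exp (c * of_real x)) (\<lambda>x. exp (- c * of_real x) * \<phi> x) = poly (P \<mu>) c"
        by (cases "even \<mu>") (simp_all only: order_term_def P_def Let_def if_True if_False poly_diff simp_thms)
    qed
    finally show ?thesis by (simp add: poly_sum)
  qed
  then have "(\<Sum>\<mu><n. P \<mu>) = 0" by (simp add: poly_all_0_iff_0[symmetric])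
  then have "(\<Sum>\<mu><n. coeff (P \<mu>) \<nu>) = 0" by (metis coeff_0 coeff_sum)
  \<comment> \<open>Smaller indices have degree below \<nu>; larger ones drop out by the induction
    hypothesis, applied to the derivatives of \<phi> as well.\<close>
  moreover have "coeff (P \<mu>) \<nu> = 0" if \<mu>: "\<mu> < n" "\<mu> \<noteq> \<nu>" for \<mu>
  proof (cases "\<mu> < \<nu>")
    case True
    then show ?thesis
      by (cases "even \<mu>") (auto elim!: evenE oddE simp: P_def coeff_symbol_poly)
  next
    case False
    then have "symbol_poly (S \<mu>) \<phi> k j = 0" for k j
      using S0[of \<mu>] \<mu> test_vderiv[OF \<phi>] by (simp add: symbol_poly_def)
    then show ?thesis by (simp add: P_def Let_def)
  qed
  ultimately have "coeff (P \<nu>) \<nu> = 0"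
    using sum.remove[of "{..<n}" \<nu> "\<lambda>\<mu>. coeff (P \<mu>) \<nu>"] less.prems(1) by simp
  \<comment> \<open>The coefficient is a multiple of \<open>S \<nu> \<phi>\<close>, by (-1)^k for
    \<nu> = 2k and by (-1)^(k+1) - (-1)^k = -2 (-1)^k for \<nu> = 2k + 1; the minus sign in
    \<open>order_term\<close> prevents cancellation.\<close>
  then show ?case
    by (cases "even \<nu>") (auto elim!: evenE oddE simp: P_def coeff_symbol_poly)
qed

section \<open>Bilinear forms of the two differential expressions\<close>

text \<open>\<open>Y\<close> is a free sequence, so that the same form takes the weak derivatives of
  an element of the domain and the classical ones of a smooth function.\<close>

definition pairing :: "nat \<Rightarrow> (nat \<Rightarrow> nat \<Rightarrow> real \<Rightarrow> complex) \<Rightarrow> (nat \<Rightarrow> real \<Rightarrow> complex) \<Rightarrow>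
    (real \<Rightarrow> complex) \<Rightarrow> complex" where
  "pairing m Q Y z =
     int01 (\<lambda>x. \<Sum>r\<le>m. \<Sum>s\<le>m. Q r s x * (Y r x * (vderiv ^^ s) z x))"

lemma vderiv_funpow_add: "(vderiv ^^ a) ((vderiv ^^ b) z) = (vderiv ^^ (a + b)) z"
  by (simp add: funpow_add)

text \<open>Pointwise the sums over \<chi> are Leibniz expansions. Each of these is weakly
  differentiable, so its product with an \<open>L1\<close> function is integrable and the integral
  may be taken term by term.\<close>

lemma pairing_coeff_matrix:
  assumes Y: "\<And>r. r \<le> m \<Longrightarrow> weak_deriv (Y r) (Y (Suc r))" and z: "z \<in> test_functions"
    and t: "\<And>\<nu> i. \<nu> < 2*m+1 \<Longrightarrow> i \<le> sing_order m \<nu> \<Longrightarrow> t \<nu> i \<in> L1"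
  shows "pairing m (coeff_matrix m t) Y z =
    (\<Sum>k\<le>m. \<Sum>i\<le>m-k. int01 (\<lambda>x. t (2*k) i x * leibniz (\<lambda>p. Y (p + k)) ((vderiv ^^ k) z) i x)) +
    (\<Sum>k<m. (\<Sum>i\<le>m-k-1. int01 (\<lambda>x. t (2*k+1) i x * leibniz (\<lambda>p. Y (p + k)) ((vderiv ^^ Suc k) z) i x)) -
       (\<Sum>i\<le>m-k-1. int01 (\<lambda>x. t (2*k+1) i x * leibniz (\<lambda>p. Y (p + Suc k)) ((vderiv ^^ k) z) i x)))"
proof -
  define e where "e k i x = t (2*k) i x * leibniz (\<lambda>p. Y (p + k)) ((vderiv ^^ k) z) i x" for k i x
  define o1 where "o1 k i x = t (2*k+1) i x * leibniz (\<lambda>p. Y (p + k)) ((vderiv ^^ Suc k) z) i x" for k i x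
  define o2 where "o2 k i x = t (2*k+1) i x * leibniz (\<lambda>p. Y (p + Suc k)) ((vderiv ^^ k) z) i x" for k i x
  have sm: "smooth ((vderiv ^^ k) z)" for k by (intro smooth_vderiv test_smooth z)
  have eL: "e k i \<in> L1" if "k \<le> m" "i \<le> m - k" for k i
    unfolding e_def[abs_def] using that Y[of "p + k" for p]
    by (intro L1_mult_chain t sm) (auto simp: sing_order_even)
  have o1L: "o1 k i \<in> L1" if "k < m" "i \<le> m - k - 1" for k i
    unfolding o1_def[abs_def] using that Y[of "p + k" for p]
    by (intro L1_mult_chain t sm) (auto simp: sing_order_odd[simplified])
  have o2L: "o2 k i \<in> L1" if "k < m" "i \<le> m - k - 1" for k i
    unfolding o2_def[abs_def] using that Y[of "p + Suc k" for p]
    by (intro L1_mult_chain t sm) (auto simp: sing_order_odd[simplified])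
  have point: "(\<Sum>r\<le>m. \<Sum>s\<le>m. coeff_matrix m t r s x * (Y r x * (vderiv ^^ s) z x)) =
     (\<Sum>k\<le>m. \<Sum>i\<le>m-k. e k i x) + (\<Sum>k<m. (\<Sum>i\<le>m-k-1. o1 k i x) - (\<Sum>i\<le>m-k-1. o2 k i x))" for x
  proof -
    have "(\<Sum>r\<le>m. \<Sum>s\<le>m. coeff_matrix m t r s x * (Y r x * (vderiv ^^ s) z x)) =
      (\<Sum>\<nu><2*m+1. \<Sum>i\<le>sing_order m \<nu>. \<Sum>r\<le>m. \<Sum>s\<le>m. t \<nu> i x * chi \<nu> i r s * (Y r x * (vderiv ^^ s) z x))"
      unfolding coeff_matrix_def sum_distrib_right by (rule sum4_swap)
    also have "\<dots> = (\<Sum>\<nu><2*m+1. \<Sum>i\<le>sing_order m \<nu>. t \<nu> i x *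
        (\<Sum>r\<le>m. \<Sum>s\<le>m. chi \<nu> i r s * (Y r x * (vderiv ^^ s) z x)))"
      by (simp only: mult.assoc sum_distrib_left)
    also have "\<dots> = (\<Sum>k\<le>m. \<Sum>i\<le>m-k. t (2*k) i x *
        (\<Sum>r\<le>m. \<Sum>s\<le>m. chi (2*k) i r s * (Y r x * (vderiv ^^ s) z x))) +
      (\<Sum>k<m. \<Sum>i\<le>m-k-1. t (2*k+1) i x *
        (\<Sum>r\<le>m. \<Sum>s\<le>m. chi (2*k+1) i r s * (Y r x * (vderiv ^^ s) z x)))"
      unfolding sum_even_odd by (simp only: sing_order_even sing_order_odd)
    also have "(\<Sum>k\<le>m. \<Sum>i\<le>m-k. t (2*k) i x *
        (\<Sum>r\<le>m. \<Sum>s\<le>m. chi (2*k) i r s * (Y r x * (vderiv ^^ s) z x))) = (\<Sum>k\<le>m. \<Sum>i\<le>m-k. e k i x)"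
      by (intro sum.cong refl, subst chi_even_sum) (auto simp: e_def leibniz_def vderiv_funpow_add)
    also have "(\<Sum>k<m. \<Sum>i\<le>m-k-1. t (2*k+1) i x *
        (\<Sum>r\<le>m. \<Sum>s\<le>m. chi (2*k+1) i r s * (Y r x * (vderiv ^^ s) z x))) =
      (\<Sum>k<m. (\<Sum>i\<le>m-k-1. o1 k i x) - (\<Sum>i\<le>m-k-1. o2 k i x))"
      unfolding sum_subtractf[symmetric]
      by (intro sum.cong refl, subst chi_odd_sum)
        (auto simp: o1_def o2_def leibniz_def vderiv_funpow_add right_diff_distrib simp del: funpow.simps)
    finally show ?thesis .
  qed
  have i1: "integrable leb01 (\<lambda>x. \<Sum>i\<le>m-k-1. o1 k i x)" if "k \<in> {..<m}" for k
    using o1L that by (intro L1_integrable L1_sum) auto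
  have i2: "integrable leb01 (\<lambda>x. \<Sum>i\<le>m-k-1. o2 k i x)" if "k \<in> {..<m}" for k
    using o2L that by (intro L1_integrable L1_sum) auto
  have ie: "integrable leb01 (\<lambda>x. \<Sum>i\<le>m-k. e k i x)" if "k \<in> {..m}" for k
    using eL that by (intro L1_integrable L1_sum) auto
  have "pairing m (coeff_matrix m t) Y z =
     int01 (\<lambda>x. \<Sum>k\<le>m. \<Sum>i\<le>m-k. e k i x)
     + int01 (\<lambda>x. \<Sum>k<m. (\<Sum>i\<le>m-k-1. o1 k i x) - (\<Sum>i\<le>m-k-1. o2 k i x))"
    unfolding pairing_def point
    by (intro Bochner_Integration.integral_add Bochner_Integration.integrable_sum
        Bochner_Integration.integrable_diff i1 i2 ie)
  also have "int01 (\<lambda>x. \<Sum>k\<le>m. \<Sum>i\<le>m-k. e k i x) = (\<Sum>k\<le>m. int01 (\<lambda>x. \<Sum>i\<le>m-k. e k i x))"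
    by (rule Bochner_Integration.integral_sum[OF ie])
  also have "\<dots> = (\<Sum>k\<le>m. \<Sum>i\<le>m-k. int01 (e k i))"
    using eL by (intro sum.cong refl Bochner_Integration.integral_sum L1_integrable) auto
  also have "int01 (\<lambda>x. \<Sum>k<m. (\<Sum>i\<le>m-k-1. o1 k i x) - (\<Sum>i\<le>m-k-1. o2 k i x)) =
     (\<Sum>k<m. int01 (\<lambda>x. (\<Sum>i\<le>m-k-1. o1 k i x) - (\<Sum>i\<le>m-k-1. o2 k i x)))"
    by (intro Bochner_Integration.integral_sum Bochner_Integration.integrable_diff i1 i2)
  also have "\<dots> = (\<Sum>k<m. (\<Sum>i\<le>m-k-1. int01 (o1 k i)) - (\<Sum>i\<le>m-k-1. int01 (o2 k i)))"
  proof (intro sum.cong refl)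
    fix k assume k: "k \<in> {..<m}"
    show "int01 (\<lambda>x. (\<Sum>i\<le>m-k-1. o1 k i x) - (\<Sum>i\<le>m-k-1. o2 k i x)) =
      (\<Sum>i\<le>m-k-1. int01 (o1 k i)) - (\<Sum>i\<le>m-k-1. int01 (o2 k i))"
      using k o1L o2L
      by (subst Bochner_Integration.integral_diff[OF i1[OF k] i2[OF k]])
        (intro arg_cong2[of _ _ _ _ minus] Bochner_Integration.integral_sum L1_integrable; auto)
  qed
  finally show ?thesis by (simp only: e_def[abs_def] o1_def[abs_def] o2_def[abs_def])
qed

text \<open>By \<open>dmul_dsum\<close> each product is a sum of Leibniz expansions, and the signs
  of the expression meet those of the outer derivatives. The singularity orders fit:
  \<open>sing_order m \<nu>\<close> plus the order of the derivative of \<open>y\<close> in each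
  product is at most m, matching \<open>W1 (m + 1)\<close>.\<close>

lemma diff_expr_pairing:
  assumes y: "y \<in> W1 (m + 1)" and z: "z \<in> test_functions"
    and t: "\<And>\<nu> i. \<nu> < 2*m+1 \<Longrightarrow> i \<le> sing_order m \<nu> \<Longrightarrow> t \<nu> i \<in> L1"
    and \<tau>: "\<And>\<nu>. \<nu> < 2*m+1 \<Longrightarrow> \<tau> \<nu> = dsum (sing_order m \<nu>) (t \<nu>)"
  shows "diff_expr m \<tau> y z =
    (ddiff ^^ (2*m+1)) (reg y) z + pairing m (coeff_matrix m t) (\<lambda>r. wderiv r y) z"
proof -
  have Y: "weak_deriv (wderiv r y) (wderiv (Suc r) y)" if "r \<le> m" for r
    using that by (intro W1_weak_deriv[OF y]) simp
  have dm: "dmul (sing_order m \<nu>) (\<tau> \<nu>) (wderiv k y) w =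
      (\<Sum>i\<le>sing_order m \<nu>. int01 (\<lambda>x. t \<nu> i x * leibniz (\<lambda>p. wderiv (p + k) y) w i x))"
    if "\<nu> < 2*m+1" "sing_order m \<nu> + k \<le> m" "w \<in> test_functions" for \<nu> k w
    using dmul_dsum[of "sing_order m \<nu>" "t \<nu>" "\<lambda>p. wderiv (p + k) y" w] t[OF that(1)] Y that
    by (simp add: \<tau>)
  note sgn = ddiff_funpow_apply[OF z] minus_one_power_mult_self
  have ev: "(-1) ^ k * (ddiff ^^ k) (dmul (sing_order m (2*k)) (\<tau> (2*k)) (wderiv k y)) z =
     (\<Sum>i\<le>m-k. int01 (\<lambda>x. t (2*k) i x * leibniz (\<lambda>p. wderiv (p + k) y) ((vderiv ^^ k) z) i x))"
    if "k \<le> m" for k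
    using dm[of "2*k" k "(vderiv ^^ k) z"] that test_vderiv[OF z]
    by (simp add: sgn sing_order_even)
  have od: "(-1) ^ (k+1) *
          ((ddiff ^^ (k+1)) (dmul (sing_order m (2*k+1)) (\<tau> (2*k+1)) (wderiv k y)) z
           + (ddiff ^^ k) (dmul (sing_order m (2*k+1)) (\<tau> (2*k+1)) (wderiv (k+1) y)) z) =
     (\<Sum>i\<le>m-k-1. int01 (\<lambda>x. t (2*k+1) i x * leibniz (\<lambda>p. wderiv (p + k) y) ((vderiv ^^ Suc k) z) i x)) -
     (\<Sum>i\<le>m-k-1. int01 (\<lambda>x. t (2*k+1) i x * leibniz (\<lambda>p. wderiv (p + Suc k) y) ((vderiv ^^ k) z) i x))"
    if k: "k < m" for k
  proof -
    define a where "a = dmul (sing_order m (2*k+1)) (\<tau> (2*k+1)) (wderiv k y) ((vderiv ^^ Suc k) z)"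
    define b where "b = dmul (sing_order m (2*k+1)) (\<tau> (2*k+1)) (wderiv (Suc k) y) ((vderiv ^^ k) z)"
    have "(-1) ^ (k+1) * ((-1) ^ (k+1) * a + (-1) ^ k * b) = a - b"
      unfolding distrib_left minus_one_power_mult_self by (simp add: minus_one_power_mult_self)
    moreover have "a = (\<Sum>i\<le>m-k-1. int01 (\<lambda>x. t (2*k+1) i x * leibniz (\<lambda>p. wderiv (p + k) y) ((vderiv ^^ Suc k) z) i x))"
      unfolding a_def using dm[of "2*k+1" k, OF _ _ test_vderiv[OF z]] k by (simp add: sing_order_odd[simplified] del: funpow.simps)
    moreover have "b = (\<Sum>i\<le>m-k-1. int01 (\<lambda>x. t (2*k+1) i x * leibniz (\<lambda>p. wderiv (p + Suc k) y) ((vderiv ^^ k) z) i x))"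
      unfolding b_def using dm[of "2*k+1" "Suc k", OF _ _ test_vderiv[OF z]] k by (simp add: sing_order_odd[simplified] del: funpow.simps)
    ultimately show ?thesis
      unfolding ddiff_funpow_apply[OF z] a_def b_def by (simp only: Suc_eq_plus1)
  qed
  have "diff_expr m \<tau> y z = (ddiff ^^ (2*m+1)) (reg y) z +
     ((\<Sum>k\<le>m. (-1) ^ k * (ddiff ^^ k) (dmul (sing_order m (2*k)) (\<tau> (2*k)) (wderiv k y)) z) +
     (\<Sum>k<m. (-1) ^ (k+1) *
          ((ddiff ^^ (k+1)) (dmul (sing_order m (2*k+1)) (\<tau> (2*k+1)) (wderiv k y)) z
           + (ddiff ^^ k) (dmul (sing_order m (2*k+1)) (\<tau> (2*k+1)) (wderiv (k+1) y)) z)))"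
    by (simp only: diff_expr_def add.assoc)
  also have "(\<Sum>k\<le>m. (-1) ^ k * (ddiff ^^ k) (dmul (sing_order m (2*k)) (\<tau> (2*k)) (wderiv k y)) z) =
      (\<Sum>k\<le>m. \<Sum>i\<le>m-k. int01 (\<lambda>x. t (2*k) i x * leibniz (\<lambda>p. wderiv (p + k) y) ((vderiv ^^ k) z) i x))"
    by (intro sum.cong refl ev) simp
  also have "(\<Sum>k<m. (-1) ^ (k+1) *
          ((ddiff ^^ (k+1)) (dmul (sing_order m (2*k+1)) (\<tau> (2*k+1)) (wderiv k y)) z
           + (ddiff ^^ k) (dmul (sing_order m (2*k+1)) (\<tau> (2*k+1)) (wderiv (k+1) y)) z)) =
     (\<Sum>k<m. (\<Sum>i\<le>m-k-1. int01 (\<lambda>x. t (2*k+1) i x * leibniz (\<lambda>p. wderiv (p + k) y) ((vderiv ^^ Suc k) z) i x)) -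
       (\<Sum>i\<le>m-k-1. int01 (\<lambda>x. t (2*k+1) i x * leibniz (\<lambda>p. wderiv (p + Suc k) y) ((vderiv ^^ k) z) i x)))"
    by (intro sum.cong refl od) simp
  finally show ?thesis
    using Y z t by (subst pairing_coeff_matrix[of m "\<lambda>r. wderiv r y" z t]) (assumption | simp only:)+
qed

text \<open>Unrolling y^[k+1] = (y^[k])' - a_k subtracts the derivative of order 2m - k of each a_k.
  With s = 2m - k, row k + 1 of \<open>F\<close> becomes the factor of z^(s), and the sign -(-1)^s =
  (-1)^(2m+1-s) is the one in \<open>S_map\<close>.\<close>

lemma quasi_deriv_pairing:
  assumes F: "F \<in> matrix_class m" and y: "y \<in> quasi_domain (2*m+1) F" and z: "z \<in> test_functions"
  shows "reg (quasi_deriv F y (2*m+1)) z = (ddiff ^^ (2*m+1)) (reg y) z +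
    pairing m (\<lambda>r s x. (-1) ^ (2*m+1-s) * F (2*m+1-s) (Suc r) x) (\<lambda>r. wderiv r y) z"
proof -
  note yW = quasi_domain_W1[OF F y]
  have Y: "weak_deriv (wderiv r y) (wderiv (Suc r) y)" if "r \<le> m" for r
    using that by (intro W1_weak_deriv[OF yW(1)]) simp
  define a where "a k x = (if m \<le> k then \<Sum>j\<le>m. F (Suc k) (Suc j) x * wderiv j y x else 0)" for k x
  have FY: "(\<lambda>x. F (Suc k) (Suc j) x * wderiv j y x) \<in> L1" if "m \<le> k" "k \<le> 2*m" "j \<le> m" for k j
    using that by (intro L1_mult_weak[OF matrix_class_L1[OF F] Y])
  have aL: "a k \<in> L1" if "k \<le> 2*m" for k
    unfolding a_def[abs_def] using that FY by (cases "m \<le> k") (auto intro!: L1_sum L1_const)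
  have step: "reg (quasi_deriv F y (Suc k)) z = ddiff (reg (quasi_deriv F y k)) z - reg (a k) z"
    if k: "k < 2*m+1" and z: "z \<in> test_functions" for k z
  proof -
    define g where "g = wderiv 1 (quasi_deriv F y k)"
    have g: "weak_deriv (quasi_deriv F y k) g" unfolding g_def by (rule quasi_domain_weak_deriv[OF y k])
    have "AE x in leb01. \<forall>j\<in>{..m}. wderiv j y x = quasi_deriv F y j x"
      using yW(2) by (intro AE_finite_allI) auto
    then have ae: "AE x in leb01. g x - a k x = quasi_deriv F y (Suc k) x"
      using quasi_deriv_Suc_AE[OF F k g]
    proof eventually_elim
      case (elim x)
      then have "a k x = (if m \<le> k then \<Sum>j\<le>m. F (Suc k) (Suc j) x * quasi_deriv F y j x else 0)"
        by (auto simp: a_def intro!: sum.cong)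
      with elim(2) show ?case by (simp del: quasi_deriv.simps)
    qed
    have L: "g \<in> L1" "a k \<in> L1" using weak_derivD(2)[OF g] aL k by auto
    have "reg (quasi_deriv F y (Suc k)) z = reg (\<lambda>x. g x - a k x) z"
      using reg_AE_cong[OF L1_diff[OF L] ae] by simp
    also have "\<dots> = reg g z - reg (a k) z"
      using z L[THEN integrable_mult_test, OF z] by (simp add: reg_apply left_diff_distrib)
    finally show ?thesis by (simp only: weak_derivD(3)[OF g])
  qed
  have all: "reg (quasi_deriv F y K) z = (ddiff ^^ K) (reg y) z - (\<Sum>k<K. (ddiff ^^ (K - 1 - k)) (reg (a k)) z)"
    if "K \<le> 2*m+1" "z \<in> test_functions" for K z
    using that
  proof (induction K arbitrary: z)
    case (Suc K)
    have "reg (quasi_deriv F y (Suc K)) z = - reg (quasi_deriv F y K) (vderiv z) - reg (a K) z"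
      using step[of K z] Suc.prems by (simp add: ddiff_apply del: quasi_deriv.simps)
    also have "reg (quasi_deriv F y K) (vderiv z) =
        (ddiff ^^ K) (reg y) (vderiv z) - (\<Sum>k<K. (ddiff ^^ (K - 1 - k)) (reg (a k)) (vderiv z))"
      using Suc.prems by (intro Suc.IH test_vderiv1) auto
    also have "(\<Sum>k<K. (ddiff ^^ (K - 1 - k)) (reg (a k)) (vderiv z)) = - (\<Sum>k<K. (ddiff ^^ (K - k)) (reg (a k)) z)"
      unfolding sum_negf[symmetric]
    proof (intro sum.cong refl)
      fix k assume "k \<in> {..<K}"
      then have "K - k = Suc (K - 1 - k)" by auto
      then show "(ddiff ^^ (K - 1 - k)) (reg (a k)) (vderiv z) = - (ddiff ^^ (K - k)) (reg (a k)) z"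
        using Suc.prems by (simp add: ddiff_apply)
    qed
    finally show ?case using Suc.prems(2) by (simp add: ddiff_apply)
  qed simp
  \<comment> \<open>For k < m the term \<open>a k\<close> is 0; the others correspond to s = 2m - k
    from 0 to m.\<close>
  have "(\<Sum>k<2*m+1. (ddiff ^^ (2*m+1 - 1 - k)) (reg (a k)) z)
     = (\<Sum>k\<in>{m..2*m}. (ddiff ^^ (2*m+1 - 1 - k)) (reg (a k)) z)"
  proof (rule sum.mono_neutral_right)
    show "\<forall>k\<in>{..<2*m+1} - {m..2*m}. (ddiff ^^ (2*m+1 - 1 - k)) (reg (a k)) z = 0"
      using z by (auto simp: ddiff_funpow_reg_apply a_def)
  qed auto
  also have "\<dots> = (\<Sum>s\<le>m. (ddiff ^^ s) (reg (a (2*m - s))) z)"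
    by (rule sum.reindex_bij_witness[of _ "\<lambda>s. 2*m - s" "\<lambda>k. 2*m - k"]) auto
  also have "\<dots> = - pairing m (\<lambda>r s x. (-1) ^ (2*m+1-s) * F (2*m+1-s) (Suc r) x) (\<lambda>r. wderiv r y) z"
  proof -
    have i: "(\<lambda>x. a (2*m - s) x * (vderiv ^^ s) z x) \<in> L1" if "s \<le> m" for s
      by (intro L1_mult_test aL test_vderiv z) simp
    have "pairing m (\<lambda>r s x. (-1) ^ (2*m+1-s) * F (2*m+1-s) (Suc r) x) (\<lambda>r. wderiv r y) z
      = int01 (\<lambda>x. \<Sum>s\<le>m. (- ((-1) ^ s)) * (a (2*m - s) x * (vderiv ^^ s) z x))"
      unfolding pairing_def
    proof (intro Bochner_Integration.integral_cong refl, subst sum.swap, intro sum.cong refl)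
      fix x s assume "s \<in> {..m}"
      then have s: "s \<le> m" "Suc (2*m - s) = 2*m+1-s" "m \<le> 2*m - s" by auto
      have "(-1) ^ (2*m+1-s) = - ((-1 :: complex) ^ s)"
        using minus_one_power_diff[of s "2*m+1"] s(1) by simp
      then show "(\<Sum>r\<le>m. (-1) ^ (2*m+1-s) * F (2*m+1-s) (Suc r) x * (wderiv r y x * (vderiv ^^ s) z x))
        = - ((-1) ^ s) * (a (2*m - s) x * (vderiv ^^ s) z x)"
        using s by (simp only: a_def if_True sum_distrib_left sum_distrib_right mult.assoc)
    qed
    also have "\<dots> = (\<Sum>s\<le>m. (- ((-1) ^ s)) * int01 (\<lambda>x. a (2*m - s) x * (vderiv ^^ s) z x))"
      using i by (subst Bochner_Integration.integral_sum) (auto simp: L1_def)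
    finally show ?thesis using z by (simp add: ddiff_funpow_reg_apply sum_negf)
  qed
  finally show ?thesis using all[of "2*m+1" z] z by simp
qed

text \<open>The form contains derivatives of order at most m and is Lipschitz in them for the
  uniform norm, with a constant \<open>K\<close> that depends on \<open>E\<close> and
  \<open>z\<close> alone; so \<open>quasi_domain_dense\<close> applies.\<close>

lemma pairing_smooth_eq_0:
  assumes F: "F \<in> matrix_class m" and E: "\<And>r s. r \<le> m \<Longrightarrow> s \<le> m \<Longrightarrow> E r s \<in> L1"
    and z: "z \<in> test_functions" and w: "smooth w"
    and 0: "\<And>y. y \<in> quasi_domain (2*m+1) F \<Longrightarrow> pairing m E (\<lambda>r. wderiv r y) z = 0"
  shows "pairing m E (\<lambda>r. (vderiv ^^ r) w) z = 0"
proof -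
  define K where "K = int01 (\<lambda>x. \<Sum>r\<le>m. \<Sum>s\<le>m. norm (E r s x * (vderiv ^^ s) z x))"
  have Ez: "(\<lambda>x. E r s x * (vderiv ^^ s) z x) \<in> L1" if "r \<le> m" "s \<le> m" for r s
    using that by (intro L1_mult_test E test_vderiv z)
  have Kint: "integrable leb01 (\<lambda>x. \<Sum>r\<le>m. \<Sum>s\<le>m. norm (E r s x * (vderiv ^^ s) z x))"
    using Ez by (intro Bochner_Integration.integrable_sum integrable_norm L1_integrable) auto
  have le: "norm (pairing m E (\<lambda>r. (vderiv ^^ r) w) z) \<le> \<epsilon> * K" if \<epsilon>: "\<epsilon> > 0" for \<epsilon>
  proof -
    obtain y where y: "y \<in> quasi_domain (2*m+1) F"
      "\<And>k. k \<le> m \<Longrightarrow> AE x in leb01. norm (wderiv k y x - (vderiv ^^ k) w x) \<le> \<epsilon>"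
      using quasi_domain_dense[OF F w \<epsilon>] by metis
    have Y: "weak_deriv (wderiv r y) (wderiv (Suc r) y)" if "r \<le> m" for r
      using that by (intro W1_weak_deriv[OF quasi_domain_W1(1)[OF F y(1)]]) simp
    define f where "f V x = (\<Sum>r\<le>m. \<Sum>s\<le>m. E r s x * (V r x * (vderiv ^^ s) z x))" for V x
    have fL: "f V \<in> L1" if "\<And>r. r \<le> m \<Longrightarrow> weak_deriv (V r) (V (Suc r))" for V
    proof -
      have "(\<lambda>x. (E r s x * V r x) * (vderiv ^^ s) z x) \<in> L1" if "r \<le> m" "s \<le> m" for r s
        using that \<open>\<And>r. r \<le> m \<Longrightarrow> weak_deriv (V r) (V (Suc r))\<close>
        by (intro L1_mult_test test_vderiv z L1_mult_weak[OF E]) auto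
      then show ?thesis unfolding f_def[abs_def] by (intro L1_sum) (auto simp: mult.assoc)
    qed
    have fw: "f (\<lambda>r. (vderiv ^^ r) w) \<in> L1"
      using weak_deriv_smooth[OF smooth_vderiv[OF w]] by (intro fL) simp
    have fy: "f (\<lambda>r. wderiv r y) \<in> L1" using fL[of "\<lambda>r. wderiv r y"] Y by blast
    have "pairing m E (\<lambda>r. (vderiv ^^ r) w) z = int01 (\<lambda>x. f (\<lambda>r. (vderiv ^^ r) w) x - f (\<lambda>r. wderiv r y) x)"
      using 0[OF y(1)] Bochner_Integration.integral_diff[OF fw[THEN L1_integrable] fy[THEN L1_integrable]]
      by (simp add: pairing_def f_def[abs_def])
    then have "norm (pairing m E (\<lambda>r. (vderiv ^^ r) w) z) \<le>
        int01 (\<lambda>x. norm (f (\<lambda>r. (vderiv ^^ r) w) x - f (\<lambda>r. wderiv r y) x))"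
      by (simp only: integral_norm_bound)
    also have "\<dots> \<le> int01 (\<lambda>x. \<epsilon> * (\<Sum>r\<le>m. \<Sum>s\<le>m. norm (E r s x * (vderiv ^^ s) z x)))"
    proof (rule integral_mono_AE)
      show "integrable leb01 (\<lambda>x. norm (f (\<lambda>r. (vderiv ^^ r) w) x - f (\<lambda>r. wderiv r y) x))"
        by (intro integrable_norm L1_integrable L1_diff fw fy)
      show "integrable leb01 (\<lambda>x. \<epsilon> * (\<Sum>r\<le>m. \<Sum>s\<le>m. norm (E r s x * (vderiv ^^ s) z x)))"
        by (intro integrable_mult_right Kint)
      have "AE x in leb01. \<forall>k\<in>{..m}. norm (wderiv k y x - (vderiv ^^ k) w x) \<le> \<epsilon>"
        using y(2) by (intro AE_finite_allI) auto
      then show "AE x in leb01. norm (f (\<lambda>r. (vderiv ^^ r) w) x - f (\<lambda>r. wderiv r y) x)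
         \<le> \<epsilon> * (\<Sum>r\<le>m. \<Sum>s\<le>m. norm (E r s x * (vderiv ^^ s) z x))"
      proof eventually_elim
        case (elim x)
        have "f (\<lambda>r. (vderiv ^^ r) w) x - f (\<lambda>r. wderiv r y) x =
          (\<Sum>r\<le>m. \<Sum>s\<le>m. ((vderiv ^^ r) w x - wderiv r y x) * (E r s x * (vderiv ^^ s) z x))"
          unfolding f_def sum_subtractf[symmetric] by (intro sum.cong refl) (simp add: algebra_simps)
        also have "norm \<dots> \<le> (\<Sum>r\<le>m. \<Sum>s\<le>m. \<epsilon> * norm (E r s x * (vderiv ^^ s) z x))"
        proof (intro order_trans[OF norm_sum sum_mono] order_trans[OF norm_sum sum_mono])
          fix r s assume "r \<in> {..m}"
          then have "norm ((vderiv ^^ r) w x - wderiv r y x) \<le> \<epsilon>"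
            using elim by (simp add: norm_minus_commute)
          then show "norm (((vderiv ^^ r) w x - wderiv r y x) * (E r s x * (vderiv ^^ s) z x))
            \<le> \<epsilon> * norm (E r s x * (vderiv ^^ s) z x)"
            unfolding norm_mult[of "_ - _"] by (rule mult_right_mono) simp
        qed
        finally show ?case by (simp only: sum_distrib_left)
      qed
    qed
    also have "\<dots> = \<epsilon> * K" unfolding K_def by (rule integral_mult_right_zero)
    finally show ?thesis .
  qed
  have K: "K \<ge> 0" unfolding K_def by (intro integral_nonneg_AE AE_I2 sum_nonneg) simp
  define N where "N = norm (pairing m E (\<lambda>r. (vderiv ^^ r) w) z)"
  have "N \<le> 0"
  proof (rule field_le_epsilon)
    fix e :: real assume e: "e > 0"
    have "N \<le> e / (K + 1) * K" unfolding N_def using e K by (intro le) simp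
    also have "\<dots> \<le> 0 + e" using e K by (simp add: field_simps)
    finally show "N \<le> 0 + e" .
  qed
  then show ?thesis by (simp add: N_def)
qed

section \<open>Associated matrices\<close>

lemma leibniz_smooth:
  assumes "smooth w" "smooth z"
  shows "leibniz (\<lambda>p. (vderiv ^^ (p + k)) w) ((vderiv ^^ j) z) i =
    (vderiv ^^ i) (\<lambda>x. (vderiv ^^ k) w x * (vderiv ^^ j) z x)"
  unfolding leibniz_def smooth_mult(2)[OF smooth_vderiv[OF assms(1)] smooth_vderiv[OF assms(2)]]
  by (simp add: vderiv_funpow_add)

lemma pairing_smooth:
  assumes w: "smooth w" and z: "z \<in> test_functions"
    and t: "\<And>\<nu> i. \<nu> < 2*m+1 \<Longrightarrow> i \<le> sing_order m \<nu> \<Longrightarrow> t \<nu> i \<in> L1"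
  shows "pairing m (coeff_matrix m t) (\<lambda>r. (vderiv ^^ r) w) z =
    (\<Sum>\<nu><2*m+1. order_term (dsum (sing_order m \<nu>) (t \<nu>)) \<nu> w z)"
proof -
  have T: "(\<lambda>x. (vderiv ^^ k) w x * (vderiv ^^ j) z x) \<in> test_functions" for k j
    by (intro smooth_mult_test smooth_vderiv w test_vderiv z)
  have W: "weak_deriv ((vderiv ^^ r) w) ((vderiv ^^ Suc r) w)" for r
    using weak_deriv_smooth[OF smooth_vderiv[OF w]] by simp
  have ds: "(\<Sum>i\<le>d. int01 (\<lambda>x. u i x * leibniz (\<lambda>p. (vderiv ^^ (p + k)) w) ((vderiv ^^ j) z) i x))
    = dsum d u (\<lambda>x. (vderiv ^^ k) w x * (vderiv ^^ j) z x)" for d u k j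
    by (simp only: dsum_apply[OF T] leibniz_smooth[OF w test_smooth[OF z]])
  have "pairing m (coeff_matrix m t) (\<lambda>r. (vderiv ^^ r) w) z =
    (\<Sum>k\<le>m. dsum (m-k) (t (2*k)) (\<lambda>x. (vderiv ^^ k) w x * (vderiv ^^ k) z x)) +
    (\<Sum>k<m. dsum (m-k-1) (t (2*k+1)) (\<lambda>x. (vderiv ^^ k) w x * (vderiv ^^ Suc k) z x)
      - dsum (m-k-1) (t (2*k+1)) (\<lambda>x. (vderiv ^^ Suc k) w x * (vderiv ^^ k) z x))"
    using pairing_coeff_matrix[of m "\<lambda>r. (vderiv ^^ r) w", OF W z t] by (simp only: ds)
  also have "\<dots> = (\<Sum>\<nu><2*m+1. order_term (dsum (sing_order m \<nu>) (t \<nu>)) \<nu> w z)"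
  proof -
    have "order_term S (2*k) w z = S (\<lambda>x. (vderiv ^^ k) w x * (vderiv ^^ k) z x)" for S k
      by (simp add: order_term_def)
    moreover have "order_term S (2*k+1) w z = S (\<lambda>x. (vderiv ^^ k) w x * (vderiv ^^ Suc k) z x)
        - S (\<lambda>x. (vderiv ^^ Suc k) w x * (vderiv ^^ k) z x)" for S k
      by (simp add: order_term_def Let_def del: funpow.simps)
    ultimately show ?thesis by (simp only: sum_even_odd sing_order_even sing_order_odd)
  qed
  finally show ?thesis .
qed

lemma coeff_matrix_L1:
  "(\<And>\<nu> i. \<nu> < 2*m+1 \<Longrightarrow> i \<le> sing_order m \<nu> \<Longrightarrow> t \<nu> i \<in> L1) \<Longrightarrow> coeff_matrix m t r s \<in> L1"
  unfolding coeff_matrix_def[abs_def] by (intro L1_sum L1_mult_const) auto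

lemma pairing_integrable:
  assumes Q: "\<And>r s. r \<le> m \<Longrightarrow> s \<le> m \<Longrightarrow> Q r s \<in> L1"
    and Y: "\<And>r. r \<le> m \<Longrightarrow> weak_deriv (Y r) (Y' r)" and z: "z \<in> test_functions"
  shows "(\<lambda>x. \<Sum>r\<le>m. \<Sum>s\<le>m. Q r s x * (Y r x * (vderiv ^^ s) z x)) \<in> L1"
proof (intro L1_sum)
  fix r s assume "r \<in> {..m}" "s \<in> {..m}"
  then have "(\<lambda>x. (Q r s x * Y r x) * (vderiv ^^ s) z x) \<in> L1"
    by (intro L1_mult_test L1_mult_weak[OF Q Y] test_vderiv z) auto
  then show "(\<lambda>x. Q r s x * (Y r x * (vderiv ^^ s) z x)) \<in> L1" by (simp add: mult.assoc)
qed

lemma pairing_AE_cong: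
  assumes Q: "\<And>r s. r \<le> m \<Longrightarrow> s \<le> m \<Longrightarrow> Q r s \<in> L1"
    and Q': "\<And>r s. r \<le> m \<Longrightarrow> s \<le> m \<Longrightarrow> AE x in leb01. Q r s x = Q' r s x"
    and Y: "\<And>r. r \<le> m \<Longrightarrow> weak_deriv (Y r) (Y' r)" and z: "z \<in> test_functions"
  shows "pairing m Q Y z = pairing m Q' Y z"
proof -
  have "AE x in leb01. \<forall>p\<in>{..m} \<times> {..m}. Q (fst p) (snd p) x = Q' (fst p) (snd p) x"
    using Q' by (intro AE_finite_allI) auto
  then have ae: "AE x in leb01. (\<Sum>r\<le>m. \<Sum>s\<le>m. Q r s x * (Y r x * (vderiv ^^ s) z x)) =
      (\<Sum>r\<le>m. \<Sum>s\<le>m. Q' r s x * (Y r x * (vderiv ^^ s) z x))"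
    by eventually_elim (auto intro!: sum.cong)
  note L = pairing_integrable[OF Q Y z]
  show ?thesis unfolding pairing_def
    using L1_measurable[OF L] L1_measurable[OF L1_AE_cong[OF L ae]] ae by (intro integral_cong_AE)
qed

text \<open>Density of the domain and the comparison of powers of c meet here: the form on the
  domain of a single matrix \<open>F\<close> already determines every coefficient.\<close>

lemma dsum_eq_0_of_pairing:
  assumes F: "F \<in> matrix_class m"
    and e: "\<And>\<nu> i. \<nu> < 2*m+1 \<Longrightarrow> i \<le> sing_order m \<nu> \<Longrightarrow> e \<nu> i \<in> L1"
    and 0: "\<And>y z. y \<in> quasi_domain (2*m+1) F \<Longrightarrow> z \<in> test_functions \<Longrightarrow>
      pairing m (coeff_matrix m e) (\<lambda>r. wderiv r y) z = 0"
    and \<nu>: "\<nu> < 2*m+1" and z: "z \<in> test_functions"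
  shows "dsum (sing_order m \<nu>) (e \<nu>) z = 0"
proof (rule order_terms_vanish[where n="2*m+1" and S="\<lambda>\<nu>. dsum (sing_order m \<nu>) (e \<nu>)"])
  show "test_linear (dsum (sing_order m \<nu>) (e \<nu>))" if "\<nu> < 2*m+1" for \<nu>
    using e[OF that] by (intro test_linear_dsum)
  fix w z assume w: "smooth w" and z: "z \<in> test_functions"
  have "pairing m (coeff_matrix m e) (\<lambda>r. (vderiv ^^ r) w) z = 0"
    by (rule pairing_smooth_eq_0[OF F coeff_matrix_L1 z w 0[OF _ z]]) (use e in auto)
  then show "(\<Sum>\<nu><2*m+1. order_term (dsum (sing_order m \<nu>) (e \<nu>)) \<nu> w z) = 0"
    using pairing_smooth[OF w z e] by simp
qed (rule \<nu> z)+

section \<open>Regularity of the top coefficients\<close>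

lemma reg_add: "f \<in> L1 \<Longrightarrow> g \<in> L1 \<Longrightarrow> (\<lambda>z. reg f z + reg g z) = reg (\<lambda>x. f x + g x)"
  and reg_diff: "f \<in> L1 \<Longrightarrow> g \<in> L1 \<Longrightarrow> (\<lambda>z. reg f z - reg g z) = reg (\<lambda>x. f x - g x)"
  by (rule ext; case_tac "z \<in> test_functions";
      simp add: reg_apply reg_outside ring_distribs integrable_mult_test)+

lemma reg_cmult: "(\<lambda>z. c * reg f z) = reg (\<lambda>x. c * f x)"
  by (rule ext) (simp add: reg_def mult.assoc)

lemma ddiff_funpow_reg_poly:
  fixes p :: "complex poly"
  assumes "\<And>i. d \<le> i \<Longrightarrow> coeff p i = 0"
  shows "(ddiff ^^ d) (reg (\<lambda>x. poly p (of_real x))) z = 0"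
proof -
  have "weak_deriv (\<lambda>x. poly ((pderiv ^^ j) p) (of_real x)) (\<lambda>x. poly ((pderiv ^^ Suc j) p) (of_real x))" for j
    using weak_deriv_smooth[OF smooth_poly(1)[of "(pderiv ^^ j) p"]] smooth_poly(2)[of 1 "(pderiv ^^ j) p"] by simp
  then have "(ddiff ^^ d) (reg (\<lambda>x. poly ((pderiv ^^ 0) p) (of_real x))) = reg (\<lambda>x. poly ((pderiv ^^ d) p) (of_real x))"
    by (intro ddiff_funpow_chain[where G="\<lambda>j x. poly ((pderiv ^^ j) p) (of_real x)" and d=d]) auto
  also have "(pderiv ^^ d) p = 0" by (rule pderiv_funpow_eq_0[OF assms])
  finally show ?thesis by (simp add: reg_def)
qed

lemma polynomial_sum_eq_poly:
  fixes c :: "nat \<Rightarrow> complex"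
  obtains p where "\<And>i. d \<le> i \<Longrightarrow> coeff p i = 0" "(\<lambda>x. \<Sum>i<d. c i * of_real x ^ i) = (\<lambda>x. poly p (of_real x))"
  by (rule that[of "\<Sum>i<d. monom (c i) i"]) (auto simp: coeff_sum poly_sum poly_monom)

lemma poly_eq_polynomial_sum:
  fixes p :: "complex poly"
  assumes "\<And>i. d \<le> i \<Longrightarrow> coeff p i = 0"
  shows "(\<lambda>x. poly p (of_real x)) = (\<lambda>x. \<Sum>i<d. coeff p i * of_real x ^ i)"
proof -
  have "p = (\<Sum>i<d. monom (coeff p i) i)"
    by (rule poly_eqI) (use assms in \<open>auto simp: coeff_sum\<close>)
  then have "poly p x = (\<Sum>i<d. coeff p i * x ^ i)" for x
    using arg_cong[of p _ "\<lambda>q. poly q x"] by (metis (no_types, lifting) poly_monom poly_sum sum.cong)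
  then show ?thesis by blast
qed

lemma dsum_split_top:
  "dsum d (\<lambda>i. if i < d then t i else f) z =
    (\<Sum>i<d. (-1) ^ i * (ddiff ^^ i) (reg (t i)) z) + (-1) ^ d * (ddiff ^^ d) (reg f) z"
  unfolding dsum_def lessThan_Suc_atMost[symmetric] sum.lessThan_Suc by simp

text \<open>\<open>\<tau> \<nu>\<close> minus the lower terms is the d-th derivative of an
  integrable function. The chosen antiderivative differs from that function by a polynomial and so
  is integrable as well. The polynomial with coefficients \<open>c \<nu>\<close> has degree below d
  and is lost under d derivatives.\<close>

lemma top_coeff_reg:
  assumes A: "antiderivative_choice A" and \<tau>: "\<tau> \<nu> \<in> W1_neg (sing_order m \<nu>)"
    and t: "\<And>i. i < sing_order m \<nu> \<Longrightarrow> t \<nu> i \<in> L1"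
  obtains f where "f \<in> L1" "top_coeff m A \<tau> t c \<nu> = reg f"
    "\<tau> \<nu> = dsum (sing_order m \<nu>) (\<lambda>i. if i < sing_order m \<nu> then t \<nu> i else f)"
proof -
  define d where "d = sing_order m \<nu>"
  obtain \<sigma> where \<sigma>: "\<sigma> \<in> L1" "\<tau> \<nu> = (ddiff ^^ d) (reg \<sigma>)"
    using \<tau> by (auto simp: W1_neg_def d_def)
  \<comment> \<open>With top term 0, \<open>dsum_primitive d t0\<close> is an antiderivative of the
    lower terms alone.\<close>
  define t0 where "t0 i = (if i < d then t \<nu> i else (\<lambda>x. 0))" for i
  have t0: "t0 i \<in> L1" for i using t by (simp add: t0_def d_def L1_const)
  define S where "S z = \<tau> \<nu> z - (\<Sum>i<d. (-1) ^ i * (ddiff ^^ i) (reg (t \<nu> i)) z)" for z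
  have "(ddiff ^^ d) (reg (\<lambda>x. 0)) z = 0" for z
    using ddiff_funpow_reg_poly[of d 0 z] by simp
  then have "S z = (ddiff ^^ d) (reg \<sigma>) z - (ddiff ^^ d) (reg (dsum_primitive d t0)) z" for z
    using dsum_split_top[of d "t \<nu>" "\<lambda>x. 0" z] dsum_eq_ddiff[of d t0, OF t0]
    by (simp add: S_def \<sigma>(2) t0_def[abs_def])
  then have S: "S = (ddiff ^^ d) (reg (\<lambda>x. \<sigma> x - dsum_primitive d t0 x))"
    using ddiff_funpow_diff[of "reg \<sigma>" "reg (dsum_primitive d t0)" d] \<sigma>(1) dsum_primitive_L1[of d t0, OF t0]
    by (simp add: test_linear_reg reg_diff fun_eq_iff)
  have L0: "(\<lambda>x. \<sigma> x - dsum_primitive d t0 x) \<in> L1" by (intro L1_diff \<sigma> dsum_primitive_L1 t0)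
  then have "S \<in> W1_neg d" unfolding W1_neg_def S by (rule imageI)
  then have u: "A d S \<in> distributions" "(ddiff ^^ d) (A d S) = S"
    using A by (auto simp: antiderivative_choice_def)
  obtain p where p: "A d S = (\<lambda>z. reg (\<lambda>x. \<sigma> x - dsum_primitive d t0 x) z + reg (\<lambda>x. poly p (of_real x)) z)"
    using equal_primitives_poly[OF distributions_test_linear[OF u(1)] test_linear_reg[OF L0], of d]
      u(2) S by metis
  define g where "g x = \<sigma> x - dsum_primitive d t0 x + poly p (of_real x)" for x
  have g: "g \<in> L1" unfolding g_def[abs_def] by (intro L1_add L0 smooth_L1 smooth_poly)
  have Ag: "A d S = reg g"
    unfolding p g_def[abs_def] by (rule reg_add[OF L0 smooth_L1[OF smooth_poly(1)]])
  define P where "P = (\<lambda>x. \<Sum>i<d. c \<nu> i * of_real x ^ i)"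
  obtain q where q: "\<And>i. d \<le> i \<Longrightarrow> coeff q i = 0" "P = (\<lambda>x. poly q (of_real x))"
    using polynomial_sum_eq_poly[of d "c \<nu>"] unfolding P_def by metis
  have P: "P \<in> L1" unfolding q(2) by (intro smooth_L1 smooth_poly)
  define f where "f x = (-1) ^ d * g x + P x" for x
  have f: "f \<in> L1" unfolding f_def[abs_def] by (intro L1_add L1_cmult g P)
  have f_reg: "reg f z = (-1) ^ d * reg g z + reg P z" for z
    using fun_cong[OF reg_add[OF L1_cmult[OF g, of "(-1) ^ d"] P], of z] fun_cong[OF reg_cmult[of "(-1) ^ d" g], of z]
    by (simp add: f_def[abs_def])
  show ?thesis
  proof (rule that[of f])
    show "top_coeff m A \<tau> t c \<nu> = reg f"
      by (rule ext) (simp only: top_coeff_def Let_def d_def[symmetric] S_def[symmetric, abs_def] f_reg Ag P_def)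
    show "\<tau> \<nu> = dsum (sing_order m \<nu>) (\<lambda>i. if i < sing_order m \<nu> then t \<nu> i else f)"
      unfolding d_def[symmetric]
    proof (rule test_linear_eqI)
      show "test_linear (\<tau> \<nu>)" unfolding \<sigma> by (intro test_linear_ddiff_funpow test_linear_reg \<sigma>)
      show "test_linear (dsum d (\<lambda>i. if i < d then t \<nu> i else f))"
        using t f by (intro test_linear_dsum) (auto simp: d_def)
      fix z assume z: "z \<in> test_functions"
      have "(ddiff ^^ d) (reg f) z = (-1) ^ d * (ddiff ^^ d) (reg g) z + (ddiff ^^ d) (reg P) z"
        by (simp add: ddiff_funpow_apply[OF z] f_reg distrib_left mult.left_commute)
      also have "(ddiff ^^ d) (reg P) z = 0" unfolding q(2) by (rule ddiff_funpow_reg_poly[OF q(1)])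
      also have "(ddiff ^^ d) (reg g) z = S z" using u(2) by (simp only: Ag)
      finally have "(-1) ^ d * (ddiff ^^ d) (reg f) z = S z" by (simp add: minus_one_power_mult_self)
      then show "\<tau> \<nu> z = dsum d (\<lambda>i. if i < d then t \<nu> i else f) z"
        unfolding dsum_split_top by (simp add: S_def)
    qed
  qed (rule f)
qed

lemma diff_expr_outside: "z \<notin> test_functions \<Longrightarrow> diff_expr m \<tau> y z = 0"
proof -
  assume z: "z \<notin> test_functions"
  have "(ddiff ^^ k) u z = 0" if "u z = 0" for k u
    using that z by (cases k) (auto simp: ddiff_def)
  moreover have "dmul i v g z = 0" for i v g using z by (simp add: dmul_def Let_def)
  ultimately show ?thesis using z by (simp add: diff_expr_def reg_outside del: funpow.simps)
qed

section \<open>Matrices built from parameters are associated\<close>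

lemma script_F_eq_S_map:
  "script_F m A \<tau> t c = S_map m (coeff_matrix m (\<lambda>\<nu> i. if i < sing_order m \<nu> then t \<nu> i
     else density (top_coeff m A \<tau> t c \<nu>)))"
  unfolding script_F_def coeff_matrix_def[abs_def]
  by (intro arg_cong[of _ _ "S_map m"] ext sum.cong refl) simp

lemma quasi_rows_L1:
  assumes "F \<in> matrix_class m" "r \<le> m" "s \<le> m"
  shows "(\<lambda>x. (-1) ^ (2*m+1-s) * F (2*m+1-s) (Suc r) x) \<in> L1"
proof -
  have "F (Suc (2*m-s)) (Suc r) \<in> L1" using assms by (intro matrix_class_L1) auto
  then show ?thesis using assms by (intro L1_cmult) (simp add: Suc_diff_le)
qed

text \<open>By \<open>top_coeff_reg\<close> the parameters represent \<tau>, so the differential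
  expression and the n-th quasi-derivative lead to pairings with a.e. equal matrices.\<close>

lemma script_F_associated:
  assumes A: "antiderivative_choice A" and \<tau>: "\<tau> \<in> coeff_space m"
    and t: "\<And>\<nu> i. \<nu> < 2*m \<Longrightarrow> i < sing_order m \<nu> \<Longrightarrow> t \<nu> i \<in> L1"
    and F: "matrix_ae_eq (2*m+1) F (script_F m A \<tau> t c)"
  shows "F \<in> associated_matrices m \<tau>"
proof -
  define t' where "t' = (\<lambda>\<nu> i. if i < sing_order m \<nu> then t \<nu> i else density (top_coeff m A \<tau> t c \<nu>))"
  have t': "(\<forall>i\<le>sing_order m \<nu>. t' \<nu> i \<in> L1) \<and> \<tau> \<nu> = dsum (sing_order m \<nu>) (t' \<nu>)" if \<nu>: "\<nu> < 2*m+1" for \<nu>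
  proof -
    \<comment> \<open>Index 2m has singularity order 0 and therefore no parameters below the top
      one.\<close>
    have t\<nu>: "t \<nu> i \<in> L1" if "i < sing_order m \<nu>" for i
      using t[OF _ that] that \<nu> by (cases "\<nu> = 2*m") (auto simp: sing_order_def)
    have \<tau>\<nu>: "\<tau> \<nu> \<in> W1_neg (sing_order m \<nu>)" using \<tau> \<nu> by (simp add: coeff_space_def)
    obtain f where f: "f \<in> L1" "top_coeff m A \<tau> t c \<nu> = reg f"
      "\<tau> \<nu> = dsum (sing_order m \<nu>) (\<lambda>i. if i < sing_order m \<nu> then t \<nu> i else f)"
      using top_coeff_reg[where t=t and c=c and m=m and \<tau>=\<tau> and \<nu>=\<nu>, OF A \<tau>\<nu> t\<nu>] by metis
    have "reg (t' \<nu> i) = reg (if i < sing_order m \<nu> then t \<nu> i else f)" for i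
      using density_reg(2)[OF f(1)] by (simp add: t'_def f(2))
    then have "dsum (sing_order m \<nu>) (t' \<nu>) = \<tau> \<nu>" unfolding f(3) dsum_def by simp
    then show ?thesis using t\<nu> density_reg(1)[OF f(1)] by (simp add: t'_def f(2))
  qed
  have C: "coeff_matrix m t' r s \<in> L1" for r s using t' by (intro coeff_matrix_L1) auto
  have FS: "AE x in leb01. S_map m (coeff_matrix m t') k j x = F k j x" if "k \<in> {1..2*m+1}" "j \<in> {1..2*m+1}" for k j
    using F that unfolding matrix_ae_eq_def script_F_eq_S_map t'_def[symmetric] by (auto simp: eq_commute)
  have mc: "F \<in> matrix_class m"
    unfolding matrix_class_def
  proof (intro CollectI conjI ballI impI)
    fix k j assume kj: "k \<in> {m+1..2*m+1}" "j \<in> {1..m+1}"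
    have "S_map m (coeff_matrix m t') k j = (\<lambda>x. (-1) ^ k * coeff_matrix m t' (j - 1) (2*m+1-k) x)"
      using kj by (auto simp: S_map_def)
    then have "S_map m (coeff_matrix m t') k j \<in> L1" using L1_cmult[OF C] by simp
    then show "F k j \<in> L1" by (rule L1_AE_cong) (use kj in \<open>auto intro!: FS\<close>)
  next
    fix k j assume kj: "k \<in> {1..2*m+1}" "j \<in> {1..2*m+1}" "k < m + 1 \<or> m + 1 < j"
    show "AE x in leb01. F k j x = 0"
      using FS[OF kj(1,2)] by eventually_elim (use kj(3) in \<open>auto simp: S_map_def\<close>)
  qed
  have "diff_expr m \<tau> y z = reg (quasi_deriv F y (2*m+1)) z" if y: "y \<in> quasi_domain (2*m+1) F" for y z
  proof (cases "z \<in> test_functions")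
    case True
    note yW = quasi_domain_W1(1)[OF mc y]
    have "pairing m (coeff_matrix m t') (\<lambda>r. wderiv r y) z =
        pairing m (\<lambda>r s x. (-1) ^ (2*m+1-s) * F (2*m+1-s) (Suc r) x) (\<lambda>r. wderiv r y) z"
    proof (rule pairing_AE_cong[OF C])
      fix r s assume rs: "r \<le> m" "s \<le> m"
      have "AE x in leb01. S_map m (coeff_matrix m t') (2*m+1-s) (Suc r) x = F (2*m+1-s) (Suc r) x"
        using rs by (intro FS) auto
      then show "AE x in leb01. coeff_matrix m t' r s x = (-1) ^ (2*m+1-s) * F (2*m+1-s) (Suc r) x"
      proof eventually_elim
        case (elim x)
        \<comment> \<open>Entry (r, s) sits in row 2m + 1 - s and column r + 1 of \<open>F\<close>,
          up to a sign that is its own inverse.\<close>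
        have "2*m+1-s \<in> {m+1..2*m+1}" "Suc r \<in> {1..m+1}" "2*m+1-(2*m+1-s) = s" using rs by auto
        then have "S_map m (coeff_matrix m t') (2*m+1-s) (Suc r) x = (-1) ^ (2*m+1-s) * coeff_matrix m t' r s x"
          by (simp only: S_map_def) simp
        with elim show ?case by (metis minus_one_power_mult_self)
      qed
    next
      show "weak_deriv (wderiv r y) (wderiv (Suc r) y)" if "r \<le> m" for r
        using that by (intro W1_weak_deriv[OF yW]) simp
    qed (rule True)
    then show ?thesis
      using diff_expr_pairing[OF yW True, of t' \<tau>] t' quasi_deriv_pairing[OF mc y True] by simp
  qed (simp add: diff_expr_outside reg_outside)
  then show ?thesis using mc by (auto simp: associated_matrices_def)
qed

section \<open>Recovering the parameters of an associated matrix\<close>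

lemma dsum_diff:
  assumes "\<And>i. i \<le> d \<Longrightarrow> t i \<in> L1" "\<And>i. i \<le> d \<Longrightarrow> u i \<in> L1" and z: "z \<in> test_functions"
  shows "dsum d (\<lambda>i x. t i x - u i x) z = dsum d t z - dsum d u z"
  unfolding dsum_apply[OF z] sum_subtractf[symmetric] left_diff_distrib
  using assms by (intro sum.cong refl Bochner_Integration.integral_diff integrable_mult_test test_vderiv) auto

text \<open>The entries of \<open>F\<close> yield functions \<open>t\<close> that represent some
  coefficients, and a second family \<open>u\<close> represents \<tau>. Since \<open>F\<close> is
  associated, the forms of both agree on its domain, so \<open>t\<close> represents \<tau>
  too.\<close>

lemma associated_coefficients:
  assumes A: "antiderivative_choice A" and \<tau>: "\<tau> \<in> coeff_space m" and F: "F \<in> associated_matrices m \<tau>"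
  obtains t where "\<And>\<nu> i. t \<nu> i \<in> L1"
    "\<And>\<nu>. \<nu> < 2*m+1 \<Longrightarrow> \<tau> \<nu> = dsum (sing_order m \<nu>) (t \<nu>)"
    "\<And>r s x. r \<le> m \<Longrightarrow> s \<le> m \<Longrightarrow> coeff_matrix m t r s x = (-1) ^ (2*m+1-s) * F (2*m+1-s) (Suc r) x"
proof -
  have mc: "F \<in> matrix_class m" and
    as: "\<And>y. y \<in> quasi_domain (2*m+1) F \<Longrightarrow> diff_expr m \<tau> y = reg (quasi_deriv F y (2*m+1))"
    using F by (auto simp: associated_matrices_def)
  obtain t where t: "\<And>\<nu> i. t \<nu> i \<in> L1" and tQ: "\<And>r s x. r \<le> m \<Longrightarrow> s \<le> m \<Longrightarrow>
      coeff_matrix m t r s x = (-1) ^ (2*m+1-s) * F (2*m+1-s) (Suc r) x"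
    using coeff_matrix_decomposition[of m "\<lambda>r s x. (-1) ^ (2*m+1-s) * F (2*m+1-s) (Suc r) x",
        OF quasi_rows_L1[OF mc]] by metis
  \<comment> \<open>The simplest representation has lower parameters 0 and everything in the top
    term.\<close>
  have "\<exists>u. (\<forall>i. u i \<in> L1) \<and> \<tau> \<nu> = dsum (sing_order m \<nu>) u" if "\<nu> < 2*m+1" for \<nu>
  proof -
    have \<tau>\<nu>: "\<tau> \<nu> \<in> W1_neg (sing_order m \<nu>)" using \<tau> that by (simp add: coeff_space_def)
    obtain f where "f \<in> L1"
      "\<tau> \<nu> = dsum (sing_order m \<nu>) (\<lambda>i. if i < sing_order m \<nu> then (\<lambda>x. 0) else f)"
      using top_coeff_reg[where t="\<lambda>_ _ _. 0" and c="\<lambda>_ _. 0" and m=m and \<tau>=\<tau> and \<nu>=\<nu>, OF A \<tau>\<nu> L1_const] by metis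
    then show ?thesis
      by (intro exI[of _ "\<lambda>i. if i < sing_order m \<nu> then (\<lambda>x. 0) else f"]) (auto intro: L1_const)
  qed
  then obtain u where u: "\<And>\<nu> i. \<nu> < 2*m+1 \<Longrightarrow> u \<nu> i \<in> L1"
    "\<And>\<nu>. \<nu> < 2*m+1 \<Longrightarrow> \<tau> \<nu> = dsum (sing_order m \<nu>) (u \<nu>)" by metis
  define e where "e \<nu> i x = t \<nu> i x - u \<nu> i x" for \<nu> i x
  have eL: "e \<nu> i \<in> L1" if "\<nu> < 2*m+1" for \<nu> i
    unfolding e_def[abs_def] by (intro L1_diff t u that)
  have e0: "dsum (sing_order m \<nu>) (e \<nu>) z = 0" if "\<nu> < 2*m+1" "z \<in> test_functions" for \<nu> z
  proof (rule dsum_eq_0_of_pairing[OF mc eL _ that])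
    fix y z assume y: "y \<in> quasi_domain (2*m+1) F" and z: "z \<in> test_functions"
    note yW = quasi_domain_W1(1)[OF mc y]
    have Y: "weak_deriv (wderiv r y) (wderiv (Suc r) y)" if "r \<le> m" for r
      using that by (intro W1_weak_deriv[OF yW]) simp
    have Cu: "coeff_matrix m u r s \<in> L1" and Ct: "coeff_matrix m t r s \<in> L1" for r s
      using u(1) t by (auto intro!: coeff_matrix_L1)
    have "pairing m (coeff_matrix m u) (\<lambda>r. wderiv r y) z =
        pairing m (\<lambda>r s x. (-1) ^ (2*m+1-s) * F (2*m+1-s) (Suc r) x) (\<lambda>r. wderiv r y) z"
      using diff_expr_pairing[OF yW z u(1) u(2)] quasi_deriv_pairing[OF mc y z] fun_cong[OF as[OF y], of z] by simp
    also have "\<dots> = pairing m (coeff_matrix m t) (\<lambda>r. wderiv r y) z"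
      by (rule pairing_AE_cong[OF quasi_rows_L1[OF mc] AE_I2 Y z]) (auto simp: tQ)
    finally have eq: "pairing m (coeff_matrix m u) (\<lambda>r. wderiv r y) z = pairing m (coeff_matrix m t) (\<lambda>r. wderiv r y) z" .
    have ce: "coeff_matrix m e r s x = coeff_matrix m t r s x - coeff_matrix m u r s x" for r s x
      by (simp only: coeff_matrix_def e_def left_diff_distrib sum_subtractf)
    show "pairing m (coeff_matrix m e) (\<lambda>r. wderiv r y) z = 0"
      using eq Bochner_Integration.integral_diff[OF
          pairing_integrable[where Q="coeff_matrix m t" and m=m and Y="\<lambda>r. wderiv r y" and z=z, THEN L1_integrable, OF Ct Y z]
          pairing_integrable[where Q="coeff_matrix m u" and m=m and Y="\<lambda>r. wderiv r y" and z=z, THEN L1_integrable, OF Cu Y z]]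
      unfolding pairing_def ce left_diff_distrib sum_subtractf by simp
  qed
  have "\<tau> \<nu> = dsum (sing_order m \<nu>) (t \<nu>)" if \<nu>: "\<nu> < 2*m+1" for \<nu>
    unfolding u(2)[OF \<nu>]
  proof (rule test_linear_eqI)
    fix z assume z: "z \<in> test_functions"
    have "dsum (sing_order m \<nu>) (\<lambda>i x. t \<nu> i x - u \<nu> i x) z = 0"
      using e0[OF \<nu> z] by (simp only: e_def[abs_def])
    then show "dsum (sing_order m \<nu>) (u \<nu>) z = dsum (sing_order m \<nu>) (t \<nu>) z"
      using dsum_diff[of "sing_order m \<nu>" "t \<nu>" "u \<nu>", OF t u(1)[OF \<nu>] z] by simp
  qed (intro test_linear_dsum t u \<nu>)+
  from that[OF t this tQ] show ?thesis .
qed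

text \<open>Keeping the lower functions \<open>t\<close> fixes the top one up to a polynomial of
  degree below the singularity order; the constants \<open>c\<close> are the coefficients of this
  polynomial.\<close>

lemma associated_script_F:
  assumes A: "antiderivative_choice A" and \<tau>: "\<tau> \<in> coeff_space m" and F: "F \<in> associated_matrices m \<tau>"
  obtains t c where "\<And>\<nu> i. t \<nu> i \<in> L1" "matrix_ae_eq (2*m+1) F (script_F m A \<tau> t c)"
proof -
  have mc: "F \<in> matrix_class m" using F by (simp add: associated_matrices_def)
  obtain t where t: "\<And>\<nu> i. t \<nu> i \<in> L1"
    and \<tau>t: "\<And>\<nu>. \<nu> < 2*m+1 \<Longrightarrow> \<tau> \<nu> = dsum (sing_order m \<nu>) (t \<nu>)"
    and tQ: "\<And>r s x. r \<le> m \<Longrightarrow> s \<le> m \<Longrightarrow>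
      coeff_matrix m t r s x = (-1) ^ (2*m+1-s) * F (2*m+1-s) (Suc r) x"
    using associated_coefficients[OF A \<tau> F] by metis
  \<comment> \<open>Quantifying over all \<open>c\<close> with a prescribed \<nu>-th row allows the
    rows found separately to be assembled into one \<open>c\<close>.\<close>
  have "\<exists>c\<nu>. \<forall>c. c \<nu> = c\<nu> \<longrightarrow> top_coeff m A \<tau> t c \<nu> = reg (t \<nu> (sing_order m \<nu>))" if \<nu>: "\<nu> < 2*m+1" for \<nu>
  proof -
    define d where "d = sing_order m \<nu>"
    have \<tau>\<nu>: "\<tau> \<nu> \<in> W1_neg (sing_order m \<nu>)" using \<tau> \<nu> by (simp add: coeff_space_def)
    obtain f where f: "f \<in> L1" "top_coeff m A \<tau> t (\<lambda>_ _. 0) \<nu> = reg f"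
      "\<tau> \<nu> = dsum d (\<lambda>i. if i < d then t \<nu> i else f)"
      unfolding d_def using top_coeff_reg[where t=t and c="\<lambda>_ _. 0" and m=m and \<tau>=\<tau> and \<nu>=\<nu>, OF A \<tau>\<nu> t] by metis
    have "dsum d (\<lambda>i. if i < d then t \<nu> i else t \<nu> d) = dsum d (t \<nu>)"
      by (rule ext) (auto simp: dsum_def intro!: sum.cong)
    then have "dsum d (\<lambda>i. if i < d then t \<nu> i else t \<nu> d) = dsum d (\<lambda>i. if i < d then t \<nu> i else f)"
      using f(3) \<tau>t[OF \<nu>] by (simp only: d_def)
    then have "(ddiff ^^ d) (reg (t \<nu> d)) z = (ddiff ^^ d) (reg f) z" for z
      using dsum_split_top[of d "t \<nu>" "t \<nu> d" z] dsum_split_top[of d "t \<nu>" f z] by simp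
    then obtain p where p: "\<And>i. d \<le> i \<Longrightarrow> coeff p i = 0"
      "reg (t \<nu> d) = (\<lambda>z. reg f z + reg (\<lambda>x. poly p (of_real x)) z)"
      using equal_primitives_poly[OF test_linear_reg[OF t] test_linear_reg[OF f(1)], of d \<nu> d] by blast
    have "top_coeff m A \<tau> t c \<nu> z = reg (t \<nu> d) z" if "c \<nu> = coeff p" for c z
    proof -
      have "top_coeff m A \<tau> t c \<nu> z = top_coeff m A \<tau> t (\<lambda>_ _. 0) \<nu> z + reg (\<lambda>x. \<Sum>i<d. coeff p i * of_real x ^ i) z"
        using that by (simp add: top_coeff_def Let_def d_def reg_def)
      also have "(\<lambda>x. \<Sum>i<d. coeff p i * of_real x ^ i) = (\<lambda>x. poly p (of_real x))"
        by (rule poly_eq_polynomial_sum[OF p(1), symmetric])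
      finally show ?thesis by (simp only: f(2) p(2))
    qed
    then show ?thesis unfolding d_def by blast
  qed
  then obtain c where c: "top_coeff m A \<tau> t c \<nu> = reg (t \<nu> (sing_order m \<nu>))" if "\<nu> < 2*m+1" for \<nu>
    by metis
  have "AE x in leb01. \<forall>\<nu>\<in>{..<2*m+1}. density (top_coeff m A \<tau> t c \<nu>) x = t \<nu> (sing_order m \<nu>) x"
    using c density_reg(3)[OF t] by (intro AE_finite_allI) auto
  then have ae: "AE x in leb01. \<forall>r s. coeff_matrix m (\<lambda>\<nu> i. if i < sing_order m \<nu> then t \<nu> i
     else density (top_coeff m A \<tau> t c \<nu>)) r s x = coeff_matrix m t r s x"
  proof eventually_elim
    case (elim x)
    show ?case unfolding coeff_matrix_def
    proof (intro allI sum.cong refl)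
      fix r s \<nu> i assume "\<nu> \<in> {..<2*m+1}" "i \<in> {..sing_order m \<nu>}"
      then show "(if i < sing_order m \<nu> then t \<nu> i else density (top_coeff m A \<tau> t c \<nu>)) x * chi \<nu> i r s = t \<nu> i x * chi \<nu> i r s"
        using elim by (cases "i = sing_order m \<nu>") auto
    qed
  qed
  have "matrix_ae_eq (2*m+1) F (script_F m A \<tau> t c)"
    unfolding matrix_ae_eq_def script_F_eq_S_map
  proof (intro ballI)
    fix k j assume kj: "k \<in> {1..2*m+1}" "j \<in> {1..2*m+1}"
    show "AE x in leb01. F k j x = S_map m (coeff_matrix m (\<lambda>\<nu> i. if i < sing_order m \<nu> then t \<nu> i
        else density (top_coeff m A \<tau> t c \<nu>))) k j x"
    proof (cases "m + 1 \<le> k \<and> j \<le> m + 1")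
      case True
      show ?thesis using ae
      proof eventually_elim
        case (elim x)
        have rs: "j - 1 \<le> m" "2*m+1-k \<le> m" "2*m+1-(2*m+1-k) = k" "Suc (j - 1) = j" using True kj by auto
        have "coeff_matrix m t (j - 1) (2*m+1-k) x = (-1) ^ k * F k j x"
          using tQ[OF rs(1,2), of x] by (simp only: rs(3,4))
        with elim True kj show ?case
          by (simp add: S_map_def minus_one_power_mult_self)
      qed
    next
      case False
      then have "AE x in leb01. F k j x = 0"
        using mc kj unfolding matrix_class_def by auto
      then show ?thesis by eventually_elim (use False in \<open>auto simp: S_map_def\<close>)
    qed
  qed
  with t show ?thesis by (rule that)
qed

theorem mainTheorem4:
  fixes m n :: nat
    and A :: "nat \<Rightarrow> functional \<Rightarrow> functional"
    and \<tau> :: "nat \<Rightarrow> functional"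
  assumes "n = 2 * m + 1"
    and "antiderivative_choice A"
    and "\<tau> \<in> coeff_space m"
  shows "(\<forall>t c. (\<forall>\<nu><n. \<forall>i<sing_order m \<nu>. t \<nu> i \<in> L1) \<longrightarrow>
            (\<forall>\<nu><n. top_coeff m A \<tau> t c \<nu> \<in> reg ` L1)) \<and>
         associated_matrices m \<tau> =
           {F. \<exists>t c. (\<forall>\<nu><n-1. \<forall>i<sing_order m \<nu>. t \<nu> i \<in> L1) \<and>
                     matrix_ae_eq n F (script_F m A \<tau> t c)}"
proof (intro conjI allI impI)
  fix t :: "nat \<Rightarrow> nat \<Rightarrow> real \<Rightarrow> complex" and c \<nu>
  assume t: "\<forall>\<nu><n. \<forall>i<sing_order m \<nu>. t \<nu> i \<in> L1" and \<nu>: "\<nu> < n"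
  have "\<tau> \<nu> \<in> W1_neg (sing_order m \<nu>)" using assms(1,3) \<nu> by (simp add: coeff_space_def)
  moreover have "\<And>i. i < sing_order m \<nu> \<Longrightarrow> t \<nu> i \<in> L1" using t \<nu> by blast
  ultimately obtain f where "f \<in> L1" "top_coeff m A \<tau> t c \<nu> = reg f"
    using top_coeff_reg[where t=t and c=c and m=m and \<tau>=\<tau> and \<nu>=\<nu>, OF assms(2)] by metis
  then show "top_coeff m A \<tau> t c \<nu> \<in> reg ` L1" by simp
next
  show "associated_matrices m \<tau> =
           {F. \<exists>t c. (\<forall>\<nu><n-1. \<forall>i<sing_order m \<nu>. t \<nu> i \<in> L1) \<and>
                     matrix_ae_eq n F (script_F m A \<tau> t c)}"
  proof (intro set_eqI iffI)
    fix F assume "F \<in> associated_matrices m \<tau>"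
    then obtain t c where "\<And>\<nu> i. t \<nu> i \<in> L1" "matrix_ae_eq (2 * m + 1) F (script_F m A \<tau> t c)"
      using associated_script_F[OF assms(2,3)] by metis
    then show "F \<in> {F. \<exists>t c. (\<forall>\<nu><n-1. \<forall>i<sing_order m \<nu>. t \<nu> i \<in> L1) \<and>
                     matrix_ae_eq n F (script_F m A \<tau> t c)}"
      unfolding assms(1) by blast
  next
    fix F assume "F \<in> {F. \<exists>t c. (\<forall>\<nu><n-1. \<forall>i<sing_order m \<nu>. t \<nu> i \<in> L1) \<and>
                     matrix_ae_eq n F (script_F m A \<tau> t c)}"
    then obtain t c where "\<forall>\<nu><n-1. \<forall>i<sing_order m \<nu>. t \<nu> i \<in> L1"
      "matrix_ae_eq n F (script_F m A \<tau> t c)" by blast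
    then show "F \<in> associated_matrices m \<tau>"
      using assms(1) by (intro script_F_associated[OF assms(2,3), of t F c]) auto
  qed
qed

end
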